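(* The constant $1/2$ is sharp in the following statement: if $A\subset\mathcal{P}$ satisfies $\inf_{W,b}\underline{\delta}(A;W,b)>1/2$, where the infimum is taken over all reduced residue classes $b\pmod W$, then almost all even positive integers $N$ can be written as $N=p_1+p_2$ with $p_1,p_2\in A$. Namely, for any $\alpha>2$ we may define $$A=\{p\in\mathcal{P}: p\in[1,N_1]\cup[\alpha N_1,N_2]\cup[\alpha N_2,N_3]\cup\cdots\},$$ where $N_1<N_2<N_3<\cdots$ is a rapidly increasing sequence. Then $\underline{\delta}(A;W,b)=1/\alpha$ for all reduced residue classes $b\pmod W$, and $A+A$ misses a positive proportion of even integers.
   Context: $\mathcal{P}$ denotes the set of all primes, and $A+A=\{p_1+p_2:p_1,p_2\in A\}$. For $A\subset\mathcal{P}$ and a reduced residue class $b\pmod W$ (that is, $W$ is a positive integer and $\gcd(b,W)=1$), the relative lower density of $A$ in the primes within this residue class is $$\underline{\delta}(A;W,b)=\liminf_{N\to\infty}\frac{|A\cap\{1\le n\le N: n\equiv b\pmod W\}|}{|\mathcal{P}\cap\{1\le n\le N: n\equiv b\pmod W\}|}.$$ *)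

theory Defs
  imports Complex_Main "HOL-Library.Extended_Real" "HOL-Library.Set_Algebras"
    "HOL-Number_Theory.Number_Theory"
begin

text \<open>
  The liminf is taken in \<^typ>\<open>ereal\<close>, where it always exists. A quotient whose denominator is
  still zero is read as 0; by Dirichlet's theorem, for a reduced class this affects only finitely
  many \<open>N\<close>.
\<close>
definition rel_lower_density :: "nat set \<Rightarrow> nat \<Rightarrow> nat \<Rightarrow> ereal" where
  "rel_lower_density A W b =
     liminf (\<lambda>N. ereal (real (card {n \<in> A. 1 \<le> n \<and> n \<le> N \<and> [n = b] (mod W)}) /
                        real (card {n. prime n \<and> 1 \<le> n \<and> n \<le> N \<and> [n = b] (mod W)})))"

definition reduced_classes :: "(nat \<times> nat) set" where
  "reduced_classes = {(W, b). W > 0 \<and> coprime b W}"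

definition missed_even_proportion :: "nat set \<Rightarrow> nat \<Rightarrow> real" where
  "missed_even_proportion S X =
     real (card {n. 1 \<le> n \<and> n \<le> X \<and> even n \<and> n \<notin> S}) /
     real (card {n. 1 \<le> n \<and> n \<le> X \<and> even n})"

definition contains_almost_all_even :: "nat set \<Rightarrow> bool" where
  "contains_almost_all_even S \<longleftrightarrow> missed_even_proportion S \<longlonglongrightarrow> 0"

text \<open>
  ``Positive proportion'' means positive upper density, the negation of ``almost all''. For the
  sets below the lower density of the missed even numbers is 0, so no other reading is possible.
\<close>
definition misses_positive_proportion_even :: "nat set \<Rightarrow> bool" where
  "misses_positive_proportion_even S \<longleftrightarrow>
     limsup (\<lambda>X. ereal (missed_even_proportion S X)) > 0"

text \<open>
  The statement whose constant is at issue, with an arbitrary \<open>c\<close> in place of \<open>1/2\<close>; here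
  \<^term>\<open>A + A\<close> is the sumset of \<^theory>\<open>HOL-Library.Set_Algebras\<close>.
\<close>
definition density_Goldbach_statement :: "real \<Rightarrow> bool" where
  "density_Goldbach_statement c \<longleftrightarrow>
     (\<forall>A :: nat set. A \<subseteq> {p. prime p} \<longrightarrow>
        (INF (W, b) \<in> reduced_classes. rel_lower_density A W b) > ereal c \<longrightarrow>
        contains_almost_all_even (A + A))"

text \<open>
  Sequences are indexed from 0, so \<open>N 0\<close> is the \<open>N\<^sub>1\<close> of the usual notation. ``Rapidly increasing''
  means that the ratios of consecutive terms tend to infinity.
\<close>
definition rapidly_increasing :: "(nat \<Rightarrow> real) \<Rightarrow> bool" where
  "rapidly_increasing N \<longleftrightarrow>
     1 \<le> N 0 \<and> strict_mono N \<and> filterlim (\<lambda>k. N (Suc k) / N k) at_top sequentially"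

definition gap_primes :: "real \<Rightarrow> (nat \<Rightarrow> real) \<Rightarrow> nat set" where
  "gap_primes \<alpha> N =
     {p. prime p \<and> real p \<in> {1..N 0} \<union> (\<Union>k. {\<alpha> * N k..N (Suc k)})}"

end

theory Submission
  imports "HOL-Complex_Analysis.Complex_Analysis" "HOL-Real_Asymp.Real_Asymp" Defs
begin

text \<open>
  An even number in \<open>(2 N\<^sub>k, \<alpha> N\<^sub>k]\<close> is not a sum of two elements of \<open>A\<close>: one of the two primes would exceed
  \<open>N\<^sub>k\<close>, hence be at least \<open>\<alpha> N\<^sub>k\<close>. The relative density of \<open>A\<close> is smallest at the right end of these gaps,
  where it tends to \<open>1/\<alpha>\<close> because the number of primes up to \<open>x\<close> in a reduced class is regularly varying
  of index 1. That is the prime number theorem for arithmetic progressions.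

  It is obtained by Newman's method. The functions \<open>L(s, chi)\<close> are continued to the right half-plane by
  summation by parts; they do not vanish on the line of real part 1, by \<open>3 + 4 cos \<theta> + cos 2\<theta> \<ge> 0\<close>
  and, for real characters at 1, by Monsky's Lambert series argument. Newman's contour integral then gives the
  convergence of \<open>\<Sum> (\<psi>(n) - \<delta> n) / (n (n + 1))\<close> for every character, hence by linearity for every reduced
  class, where monotonicity of \<open>\<psi>\<close> turns it into an asymptotic formula.
\<close>

section \<open>Kernels with a telescoping majorant\<close>

text \<open>An asymptotic formula for primes in a class is unavoidable: at the end of a gap the
  density is the limit of the quotient of the prime counts up to N_k and up to \<alpha> N_k, and
  bounds up to a constant factor do not determine such a limit. Rapid growth is used for the lower
  bound of the density: the primes below \<alpha> N_k become negligible against those below \<alpha>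
  N_(k+1), so each gap can be treated as if it were the first one. The numbers of the form
  1/\<alpha> with \<alpha> > 2 fill (0, 1/2), which is why every constant below 1/2 fails; the
  missed proportion up to \<alpha> N_k is about 1 - 2/\<alpha>. On the analytic side, subtracting
  \<open>\<delta> n\<close> inside the series cancels the pole at 1 before Newman's theorem is
  applied, so that theorem only ever sees a function holomorphic on a neighbourhood of the closed
  half-plane. Convergence of the resulting series is linear in the weight and passes from characters
  to classes. Monotonicity, which extracts the asymptotics, is available only for classes. The
  change from characters to a class therefore has to take place between these two steps.\<close>

lemma has_integral_powr_complex:
  fixes a b :: real and w :: complex
  assumes "0 < a" "a \<le> b"
  shows "((\<lambda>x. w * of_real x powr (- w - 1)) has_integral
           (of_real a powr (- w) - of_real b powr (- w))) {a..b}"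
proof -
  have "((\<lambda>x. w * of_real x powr (- w - 1)) has_integral
          (- (of_real b powr (- w)) - (- (of_real a powr (- w))))) {a..b}"
  proof (rule fundamental_theorem_of_calculus[OF assms(2)])
    fix x assume "x \<in> {a..b}"
    then have x: "0 < x" using assms by auto
    have "((\<lambda>z. - (z powr (- w))) has_field_derivative w * of_real x powr (- w - 1)) (at (of_real x))"
      using x by (auto intro!: derivative_eq_intros)
    then show "((\<lambda>x. - (of_real x powr (- w))) has_vector_derivative
        w * of_real x powr (- w - 1)) (at x within {a..b})"
      by (rule has_vector_derivative_real_field)
  qed
  then show ?thesis by simp
qed

lemma has_integral_powr_real:
  fixes a b u :: real
  assumes "0 < a" "a \<le> b"
  shows "((\<lambda>x. u * x powr (- u - 1)) has_integral (a powr (- u) - b powr (- u))) {a..b}"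
proof -
  have "((\<lambda>x. u * x powr (- u - 1)) has_integral (- (b powr (- u)) - (- (a powr (- u))))) {a..b}"
  proof (rule fundamental_theorem_of_calculus[OF assms(2)])
    fix x assume "x \<in> {a..b}"
    then have x: "0 < x" using assms by auto
    then show "((\<lambda>x. - (x powr (- u))) has_vector_derivative u * x powr (- u - 1)) (at x within {a..b})"
      unfolding has_real_derivative_iff_has_vector_derivative[symmetric]
      by (auto intro!: derivative_eq_intros)
  qed
  then show ?thesis by simp
qed

text \<open>The kernel of a step function: summing \<open>c k * newman_kernel k z\<close> integrates
  c(floor x) x^(-2-z), which is Newman's Laplace integral after x = e^t. The closed form in
  \<open>newman_kernel_eq\<close> would divide by 1 + z; the integral is entire with no exception at
  z = -1, as the left half of Newman's circle requires.\<close>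

definition newman_kernel :: "nat \<Rightarrow> complex \<Rightarrow> complex" where
  "newman_kernel n z = integral {real n..real (Suc n)} (\<lambda>x. of_real x powr (- 2 - z))"

lemma newman_kernel_holomorphic:
  assumes "n > 0"
  shows "newman_kernel n holomorphic_on S"
proof -
  have "(\<lambda>z. integral (cbox (real n) (real (Suc n))) (\<lambda>x. of_real x powr (- 2 - z))) holomorphic_on UNIV"
  proof (rule leibniz_rule_holomorphic)
    fix z :: complex and t assume t: "t \<in> cbox (real n) (real (Suc n))"
    then have "t > 0" using assms by auto
    then show "((\<lambda>z. of_real t powr (- 2 - z)) has_field_derivative
        - (of_real (ln t) * of_real t powr (- 2 - z))) (at z within UNIV)"
      by (auto intro!: derivative_eq_intros simp: Ln_of_real powr_def)
  next
    fix z :: complex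
    have "continuous_on (cbox (real n) (real (Suc n))) (\<lambda>x. of_real x powr (- 2 - z))"
      using assms by (intro continuous_intros) auto
    then show "(\<lambda>x. of_real x powr (- 2 - z)) integrable_on cbox (real n) (real (Suc n))"
      by (rule integrable_continuous)
  next
    show "continuous_on (UNIV \<times> cbox (real n) (real (Suc n)))
       (\<lambda>(x, t). - (complex_of_real (ln t) * of_real t powr (- 2 - x)))"
      using assms unfolding case_prod_unfold by (intro continuous_intros) (auto simp: complex_nonpos_Reals_iff)
  qed auto
  then have "newman_kernel n holomorphic_on UNIV" by (simp add: newman_kernel_def[abs_def])
  then show ?thesis by (rule holomorphic_on_subset) auto
qed

lemma newman_kernel_eq:
  assumes "n > 0"
  shows "(1 + z) * newman_kernel n z = of_nat n powr (- (1 + z)) - of_nat (Suc n) powr (- (1 + z))"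
proof -
  have "((\<lambda>x. (1 + z) * of_real x powr (- (1 + z) - 1)) has_integral
           (of_real (real n) powr (- (1 + z)) - of_real (real (Suc n)) powr (- (1 + z)))) {real n..real (Suc n)}"
    by (rule has_integral_powr_complex) (use assms in auto)
  moreover have "(\<lambda>x. (1 + z) * of_real x powr (- (1 + z) - 1)) = (\<lambda>x. (1 + z) * of_real x powr (- 2 - z))"
    by (intro ext arg_cong2[of _ _ _ _ "(*)"] arg_cong2[of _ _ _ _ "(powr)"]) auto
  ultimately have "integral {real n..real (Suc n)} (\<lambda>x. (1 + z) * of_real x powr (- 2 - z))
     = of_real (real n) powr (- (1 + z)) - of_real (real (Suc n)) powr (- (1 + z))"
    by (metis integral_unique)
  then show ?thesis by (simp add: newman_kernel_def)
qed

text \<open>Since n <= x on the interval, the factor n is absorbed and leaves x^(-1-Re z), whose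
  integrals telescope in n. Keeping the sign of \<open>Re z\<close> in the denominator lets the same
  estimate serve tails in the right half-plane and initial segments in the left one.\<close>

lemma newman_kernel_bound:
  assumes "n > 0" "Re z \<noteq> 0"
  shows "real n * norm (newman_kernel n z) \<le> (real n powr (- Re z) - real (Suc n) powr (- Re z)) / Re z"
proof -
  let ?u = "Re z"
  have cont: "continuous_on {real n..real (Suc n)} (\<lambda>x. of_real x powr (- 2 - z))"
    using assms by (intro continuous_intros) auto
  have hi: "((\<lambda>x. ?u * x powr (- ?u - 1) / ?u) has_integral
      (real n powr (- ?u) - real (Suc n) powr (- ?u)) / ?u) {real n..real (Suc n)}"
    by (rule has_integral_divide[OF has_integral_powr_real]) (use assms in auto)
  have "norm (integral {real n..real (Suc n)} (\<lambda>x. of_nat n * of_real x powr (- 2 - z)))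
    \<le> integral {real n..real (Suc n)} (\<lambda>x. ?u * x powr (- ?u - 1) / ?u)"
  proof (rule integral_norm_bound_integral)
    show "(\<lambda>x. of_nat n * of_real x powr (- 2 - z)) integrable_on {real n..real (Suc n)}"
      by (intro integrable_continuous_interval continuous_intros cont)
    show "(\<lambda>x. ?u * x powr (- ?u - 1) / ?u) integrable_on {real n..real (Suc n)}"
      using hi by blast
    fix x assume x: "x \<in> {real n..real (Suc n)}"
    then have x0: "x > 0" using assms by auto
    have "norm (of_nat n * complex_of_real x powr (- 2 - z)) = real n * x powr (- 2 - ?u)"
      using x0 by (simp add: norm_mult norm_powr_real_powr)
    also have "\<dots> \<le> x * x powr (- 2 - ?u)" using x by (intro mult_right_mono) auto
    also have "\<dots> = x powr (1 + (- 2 - ?u))" using x0 by (simp add: powr_mult_base)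
    also have "1 + (- 2 - ?u) = - ?u - 1" by simp
    finally show "norm (of_nat n * complex_of_real x powr (- 2 - z)) \<le> ?u * x powr (- ?u - 1) / ?u"
      using assms by simp
  qed
  then have "norm (of_nat n * newman_kernel n z) \<le> (real n powr (- ?u) - real (Suc n) powr (- ?u)) / ?u"
    using hi by (simp add: newman_kernel_def integral_unique)
  then show ?thesis by (simp add: norm_mult)
qed

lemma sum_newman_kernel_bound:
  assumes "1 \<le> m" "m \<le> n" "Re z \<noteq> 0" "0 \<le> B" "\<And>k. norm (c k) \<le> B * real k"
  shows "norm (\<Sum>k=m..<n. c k * newman_kernel k z) \<le> B * ((real m powr (- Re z) - real n powr (- Re z)) / Re z)"
proof -
  have "norm (\<Sum>k=m..<n. c k * newman_kernel k z) \<le> (\<Sum>k=m..<n. B * ((real k powr (- Re z) - real (Suc k) powr (- Re z)) / Re z))"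
  proof (rule sum_norm_le)
    fix k assume k: "k \<in> {m..<n}"
    have "norm (c k * newman_kernel k z) \<le> B * real k * norm (newman_kernel k z)"
      using assms(5)[of k] by (simp add: norm_mult mult_right_mono)
    also have "\<dots> = B * (real k * norm (newman_kernel k z))" by simp
    also have "\<dots> \<le> B * ((real k powr (- Re z) - real (Suc k) powr (- Re z)) / Re z)"
      using k assms by (intro mult_left_mono newman_kernel_bound) auto
    finally show "norm (c k * newman_kernel k z) \<le> B * ((real k powr (- Re z) - real (Suc k) powr (- Re z)) / Re z)" .
  qed
  also have "\<dots> = B * ((\<Sum>k=m..<n. (real k powr (- Re z) - real (Suc k) powr (- Re z))) / Re z)"
    by (simp add: sum_distrib_left sum_divide_distrib)
  also have "(\<Sum>k=m..<n. (real k powr (- Re z) - real (Suc k) powr (- Re z))) = real m powr (- Re z) - real n powr (- Re z)"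
    using sum_Suc_diff'[OF assms(2), of "\<lambda>k. - (real k powr (- Re z))"] by simp
  finally show ?thesis .
qed

section \<open>Newman's Tauberian theorem\<close>

lemma contour_integral_starlike_path_independent:
  assumes S: "open S" "starlike S" "f holomorphic_on S"
    and one: "(f has_contour_integral c) p"
    and p: "valid_path p" "path_image p \<subseteq> S"
    and q: "valid_path q" "path_image q \<subseteq> S"
    and ends: "pathstart q = pathstart p" "pathfinish q = pathfinish p"
  shows "(f has_contour_integral c) q"
proof -
  have iq: "(f has_contour_integral contour_integral q f) q"
    by (rule has_contour_integral_integral[OF contour_integrable_holomorphic_simple[OF S(3,1) q]])
  have zero: "(f has_contour_integral 0) (p +++ reversepath q)"
  proof (rule Cauchy_theorem_starlike_simple[OF S])
    show "valid_path (p +++ reversepath q)" using p q ends by (intro valid_path_join) auto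
    show "path_image (p +++ reversepath q) \<subseteq> S"
      using p(2) q(2) ends by (subst path_image_join) auto
    show "pathfinish (p +++ reversepath q) = pathstart (p +++ reversepath q)" using ends by simp
  qed
  have "(f has_contour_integral (c + - contour_integral q f)) (p +++ reversepath q)"
    by (rule has_contour_integral_join[OF one has_contour_integral_reversepath[OF q(1) iq] p(1)])
       (use q in simp)
  from has_contour_integral_unique[OF this zero] have "contour_integral q f = c" by simp
  with iq show ?thesis by simp
qed

text \<open>The left semicircle and the polygon that replaces it both avoid [0, \<infinity>), and
  the plane slit there is starlike. So the value that a parametrization gives at once on the
  semicircle passes to the polygon.\<close>

lemma contour_integral_inverse_eq:
  assumes one: "((\<lambda>z. 1 / z) has_contour_integral c) p"
    and p: "valid_path p" "path_image p \<subseteq> - (complex_of_real ` {0..})"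
    and q: "valid_path q" "path_image q \<subseteq> - (complex_of_real ` {0..})"
    and ends: "pathstart q = pathstart p" "pathfinish q = pathfinish p"
  shows "((\<lambda>z. 1 / z) has_contour_integral c) q"
proof (rule contour_integral_starlike_path_independent[OF _ starlike_slotted_complex_plane_right _ one p q ends])
  show "(\<lambda>z. 1 / z) holomorphic_on - (complex_of_real ` {0..})"
  proof (intro holomorphic_intros)
    have "0 \<in> complex_of_real ` {0..}" by (rule image_eqI[of _ _ 0]) auto
    then show "z \<noteq> 0" if "z \<in> - (complex_of_real ` {0..})" for z using that by blast
  qed
  show "open (- (complex_of_real ` {0..}))"
    using closed_slot_right[of 0] by (rule open_Compl)
qed

text \<open>F z / z splits into the holomorphic quotient \<open>h\<close> and F 0 / z. Cauchy's
  theorem removes \<open>h\<close> on the closed curve, and 1/z gives \<i> * pi on each half. Taking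
  that value on \<gamma> as a hypothesis stands in for a winding number, and leaves the left half
  free to be a semicircle for the partial sums and a polygon for the limit function.\<close>

lemma contour_integral_half_circle_add:
  assumes Q: "open Q" "convex Q" and F: "F holomorphic_on Q" and R: "R > 0" and "0 \<in> Q"
    and sub: "path_image (part_circlepath 0 R (- pi/2) (pi/2)) \<subseteq> Q" "path_image \<gamma> \<subseteq> Q - {0}"
    and \<gamma>: "valid_path \<gamma>" "pathstart \<gamma> = \<i> * R" "pathfinish \<gamma> = - \<i> * R"
    and one: "((\<lambda>z. 1 / z) has_contour_integral \<i> * pi) \<gamma>"
  shows "contour_integral (part_circlepath 0 R (- pi/2) (pi/2)) (\<lambda>z. F z / z) +
         contour_integral \<gamma> (\<lambda>z. F z / z) = 2 * pi * \<i> * F 0"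
proof -
  define C where "C = part_circlepath 0 R (- pi/2) (pi/2)"
  define h where "h = (\<lambda>z. if z = 0 then deriv F 0 else (F z - F 0) / (z - 0))"
  have h: "h holomorphic_on Q"
    unfolding h_def by (rule pole_lemma_open[OF F Q(1)])
  have exp: "exp (\<i> * complex_of_real (pi/2)) = \<i>" "exp (\<i> * complex_of_real (- pi/2)) = - \<i>"
    unfolding cis_conv_exp[symmetric] by (simp_all add: complex_eq_iff)
  have C: "valid_path C" "pathstart C = - \<i> * R" "pathfinish C = \<i> * R"
    unfolding C_def pathstart_part_circlepath pathfinish_part_circlepath exp by auto
  have C0: "0 \<notin> path_image C"
    using path_image_part_circlepath_subset'[of R 0 "- pi/2" "pi/2"] R by (auto simp: C_def)
  have subC: "path_image C \<subseteq> Q - {0}" using C0 sub(1) by (auto simp: C_def)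
  have oneC: "((\<lambda>z. 1 / z) has_contour_integral \<i> * pi) C"
    unfolding C_def
  proof (subst has_contour_integral_part_circlepath_iff)
    have "((\<lambda>t. \<i>) has_integral (pi/2 - (- pi/2)) *\<^sub>R \<i>) {- pi/2..pi/2}"
      by (rule has_integral_const_real[THEN has_integral_eq_rhs]) (auto)
    then show "((\<lambda>t. 1 / (0 + of_real R * cis t) * of_real R * \<i> * cis t) has_integral \<i> * pi) {- pi/2..pi/2}"
      using R by (simp add: field_simps scaleR_conv_of_real)
  qed auto
  have "(h has_contour_integral 0) (C +++ \<gamma>)"
    by (rule Cauchy_theorem_convex_simple[OF h Q(2)])
       (use C \<gamma> sub subC in \<open>auto simp: path_image_join\<close>)
  moreover have hi: "h contour_integrable_on C" "h contour_integrable_on \<gamma>"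
    using contour_integrable_holomorphic_simple[OF h Q(1)] C \<gamma> sub by (auto simp: C_def)
  ultimately have sum0: "contour_integral C h + contour_integral \<gamma> h = 0"
    using C \<gamma> by (metis contour_integral_join contour_integral_unique)
  have split: "contour_integral p (\<lambda>z. F z / z) = contour_integral p h + F 0 * (\<i> * pi)"
    if "path_image p \<subseteq> Q - {0}" "h contour_integrable_on p" "((\<lambda>z. 1 / z) has_contour_integral \<i> * pi) p" for p
  proof (rule contour_integral_unique)
    have "((\<lambda>z. h z + F 0 * (1 / z)) has_contour_integral (contour_integral p h + F 0 * (\<i> * pi))) p"
      by (intro has_contour_integral_add has_contour_integral_lmul has_contour_integral_integral that)
    then show "((\<lambda>z. F z / z) has_contour_integral (contour_integral p h + F 0 * (\<i> * pi))) p"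
      by (rule has_contour_integral_eq) (use that(1) in \<open>auto simp: h_def field_simps\<close>)
  qed
  show ?thesis
    using split[OF subC hi(1) oneC] split[OF sub(2) hi(2) one] sum0
    by (simp add: C_def algebra_simps)
qed

text \<open>On a segment leaving the imaginary axis to the left, the size of x^z is exp (- d t ln
  x), and its integral over t is at most 1 / (d ln x). This explicit rate takes the place of a
  dominated convergence argument.\<close>

lemma powr_decay_contour_bound:
  fixes a b :: complex
  assumes ab: "Re a = 0" "Re b = - d" "d > 0" and x: "x > (1::real)"
    and f: "continuous_on (closed_segment a b) f" "\<And>z. z \<in> closed_segment a b \<Longrightarrow> norm (f z) \<le> M"
  shows "norm (contour_integral (linepath a b) (\<lambda>z. of_real x powr z * f z)) \<le> M * norm (b - a) / (d * ln x)"
proof -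
  have M: "M \<ge> 0" using order_trans[OF norm_ge_zero f(2)[of a]] by simp
  have L: "ln x > 0" using x by simp
  define L where "L = d * ln x"
  have L0: "L > 0" using L ab by (simp add: L_def)
  let ?f = "\<lambda>z. of_real x powr z * f z"
  have cont: "continuous_on (closed_segment a b) ?f"
    using x by (intro continuous_intros f) auto
  have I: "((\<lambda>t. ?f (linepath a b t) * (b - a)) has_integral contour_integral (linepath a b) ?f) {0..1}"
    using has_contour_integral_integral[OF contour_integrable_continuous_linepath[OF cont]]
    by (simp only: has_contour_integral_linepath)
  have E: "((\<lambda>t. M * norm (b - a) * exp (- L * t)) has_integral
       M * norm (b - a) * (- exp (- L * 1) / L - (- exp (- L * 0) / L))) {0..1}"
    by (intro has_integral_mult_right fundamental_theorem_of_calculus)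
       (use L0 in \<open>auto intro!: derivative_eq_intros simp flip: has_real_derivative_iff_has_vector_derivative\<close>)
  have "norm (contour_integral (linepath a b) ?f) \<le> M * norm (b - a) * (- exp (- L * 1) / L - (- exp (- L * 0) / L))"
    unfolding integral_unique[OF I, symmetric] integral_unique[OF E, symmetric]
  proof (rule integral_norm_bound_integral)
    fix t :: real assume t: "t \<in> {0..1}"
    then have mem: "linepath a b t \<in> closed_segment a b" by (auto simp: linepath_in_path)
    have "Re (linepath a b t) = - d * t" using ab by (simp add: linepath_def)
    then have "norm (of_real x powr linepath a b t) = exp (- L * t)"
      using x by (simp add: norm_powr_real_powr powr_def L_def)
    then have "norm (?f (linepath a b t) * (b - a)) \<le> exp (- L * t) * M * norm (b - a)"
      using f(2)[OF mem] by (simp add: norm_mult mult_right_mono mult_left_mono)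
    then show "norm (?f (linepath a b t) * (b - a)) \<le> M * norm (b - a) * exp (- L * t)"
      by (simp add: mult_ac)
  qed (use I E in blast)+
  also have "\<dots> \<le> M * norm (b - a) * (1 / L)"
    using M L0 by (intro mult_left_mono) (auto simp: field_simps)
  finally show ?thesis by (simp add: L_def)
qed

text \<open>Compactness of the half disc gives a uniform width to the left of the axis. The radius
  has to be fixed first, because U may narrow towards the axis at large heights.\<close>

lemma half_plane_nbhd:
  assumes "open U" "{z. Re z \<ge> 0} \<subseteq> U"
  obtains e where "e > 0" "{z. Re z > - e} \<inter> ball 0 r \<subseteq> U"
proof -
  have "compact ({z. Re z \<ge> 0} \<inter> cball (0::complex) r)"
    by (intro closed_Int_compact closed_halfspace_Re_ge) auto
  from compact_subset_open_imp_cball_epsilon_subset[OF this assms(1)] assms(2)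
  obtain e where e: "e > 0" "(\<Union>x\<in>{z. Re z \<ge> 0} \<inter> cball (0::complex) r. cball x e) \<subseteq> U" by blast
  have "z \<in> U" if z: "Re z > - e" "norm z < r" for z
  proof (cases "Re z \<ge> 0")
    case True then show ?thesis using assms by auto
  next
    case False
    let ?w = "Complex 0 (Im z)"
    have "norm ?w \<le> norm z" by (metis Im_complex_of_real abs_Im_le_cmod complex_norm norm_complex_def complex.sel(1) complex.sel(2) power_zero_numeral add_0 real_sqrt_abs)
    moreover have "dist ?w z \<le> e"
      using False z by (simp add: dist_norm cmod_def)
    ultimately have "z \<in> (\<Union>x\<in>{z. Re z \<ge> 0} \<inter> cball (0::complex) r. cball x e)"
      using z by (auto intro!: bexI[of _ ?w])
    then show ?thesis using e(2) by (rule subsetD[rotated])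
  qed
  then show ?thesis using that[OF e(1)] by (auto simp: subset_iff)
qed

text \<open>On the right half circle \<open>g - G N\<close> is integrated as a whole. On the left
  the entire function \<open>G N\<close> stays on the circle, while \<open>g\<close> is moved to a
  polygon inside U. Each half circle contributes at most B / R whatever N is, and the polygon O(1 /
  ln N); so N tends to infinity first and R afterwards.\<close>

theorem newman_tauberian:
  fixes c :: "nat \<Rightarrow> complex"
  assumes U: "open U" "{z. Re z \<ge> 0} \<subseteq> U" and g: "g holomorphic_on U"
    and B: "0 \<le> B" "\<And>n. norm (c n) \<le> B * real n"
    and lim: "\<And>z. Re z > 0 \<Longrightarrow> (\<lambda>N. \<Sum>k=1..<N. c k * newman_kernel k z) \<longlonglongrightarrow> g z"
  shows "(\<lambda>N. \<Sum>k=1..<N. c k * newman_kernel k 0) \<longlonglongrightarrow> g 0"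
proof -
  define G where "G = (\<lambda>N z. \<Sum>k=1..<N. c k * newman_kernel k z)"
  have G_hol: "G N holomorphic_on S" for N S
    unfolding G_def by (intro holomorphic_intros newman_kernel_holomorphic) auto
  have bound_right: "norm (g z - G N z) \<le> B * (real N powr (- Re z) / Re z)" if "Re z > 0" "N \<ge> 1" for z N
  proof (rule tendsto_le[OF sequentially_bot tendsto_const])
    show "(\<lambda>M. norm (G M z - G N z)) \<longlonglongrightarrow> norm (g z - G N z)"
      unfolding G_def by (intro tendsto_intros lim that)
    show "\<forall>\<^sub>F M in sequentially. norm (G M z - G N z) \<le> B * (real N powr (- Re z) / Re z)"
      using eventually_ge_at_top[of N]
    proof eventually_elim
      case (elim M)
      have "G M z - G N z = (\<Sum>k=N..<M. c k * newman_kernel k z)"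
        unfolding G_def using sum.atLeastLessThan_concat[OF that(2) elim, of "\<lambda>k. c k * newman_kernel k z"]
        by (simp add: algebra_simps)
      then have "norm (G M z - G N z) \<le> B * ((real N powr (- Re z) - real M powr (- Re z)) / Re z)"
        using sum_newman_kernel_bound[OF that(2) elim _ B] that by simp
      also have "\<dots> \<le> B * (real N powr (- Re z) / Re z)"
        using that B by (intro mult_left_mono divide_right_mono) auto
      finally show ?case .
    qed
  qed
  have bound_left: "norm (G N z) \<le> B * (real N powr (- Re z) / (- Re z))" if "Re z < 0" "N \<ge> 1" for z N
  proof -
    have "norm (G N z) \<le> B * ((real 1 powr (- Re z) - real N powr (- Re z)) / Re z)"
      unfolding G_def using sum_newman_kernel_bound[OF _ that(2) _ B, where z = z] that by simp
    also have "\<dots> \<le> B * (real N powr (- Re z) / (- Re z))"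
      using that B by (intro mult_left_mono) (auto simp: field_simps)
    finally show ?thesis .
  qed
  have main: "\<exists>M. \<forall>N>1. norm (g 0 - G N 0) \<le> 2 * B / R + M / ln (real N)" if R: "R > 0" for R
  proof -
    obtain e where e: "e > 0" "{z. Re z > - e} \<inter> ball 0 (R + 1) \<subseteq> U"
      using half_plane_nbhd[OF U] by blast
    define Q where "Q = {z. Re z > - e} \<inter> ball 0 (R + 1)"
    have Q: "open Q" "convex Q" "0 \<in> Q" "g holomorphic_on Q"
      using e R g unfolding Q_def
      by (auto intro!: open_Int open_halfspace_Re_gt convex_Int convex_halfspace_Re_gt intro: holomorphic_on_subset)
    \<comment> \<open>The vertex -d of the polygon must lie in \<open>Q\<close>: d < e for the
      half-plane, d <= R for the ball.\<close>
    define d where "d = min (e / 2) R"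
    have d: "d > 0" "d < e" "d \<le> R" using e R by (auto simp: d_def)
    define Cp where "Cp = part_circlepath 0 R (- pi/2) (pi/2)"
    define Cm where "Cm = part_circlepath 0 R (pi/2) (3 * pi/2)"
    define P where "P = linepath (\<i> * R) (- of_real d) +++ linepath (- of_real d) (- \<i> * R)"
    have "cos (3 * pi / 2) = 0" "sin (3 * pi / 2) = -1"
      using cos_3over2_pi sin_3over2_pi by (simp_all add: field_simps)
    then have exp: "exp (\<i> * complex_of_real (pi/2)) = \<i>" "exp (\<i> * complex_of_real (3 * pi/2)) = - \<i>"
      unfolding cis_conv_exp[symmetric] by (simp_all add: complex_eq_iff)
    have Cp_img: "norm z = R \<and> Re z \<ge> 0" if "z \<in> path_image Cp" for z
    proof -
      from that obtain t where t: "t \<in> {-pi/2..pi/2}" "z = R * cis t"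
        unfolding Cp_def path_image_part_circlepath' by (auto simp: closed_segment_eq_real_ivl)
      have "cos t \<ge> 0" using t by (intro cos_ge_zero) auto
      then show ?thesis using t R by (simp add: norm_mult)
    qed
    have Cm_img: "norm z = R \<and> Re z \<le> 0" if "z \<in> path_image Cm" for z
    proof -
      from that obtain t where t: "t \<in> {pi/2..3*pi/2}" "z = R * cis t"
        unfolding Cm_def path_image_part_circlepath' by (auto simp: closed_segment_eq_real_ivl)
      have "cos (t - pi) \<ge> 0" using t by (intro cos_ge_zero) auto
      then have "cos t \<le> 0" by simp
      then show ?thesis using t(2) R by (simp add: norm_mult mult_nonneg_nonpos)
    qed
    have seg: "closed_segment (\<i> * R) (- of_real d) \<subseteq> Q - {0}" "closed_segment (- of_real d) (- \<i> * R) \<subseteq> Q - {0}"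
      "closed_segment (\<i> * R) (- of_real d) \<subseteq> - (complex_of_real ` {0..})"
      "closed_segment (- of_real d) (- \<i> * R) \<subseteq> - (complex_of_real ` {0..})"
    proof -
      have inQ: "\<i> * R \<in> Q" "- of_real d \<in> Q" "- \<i> * R \<in> Q"
        using d R e by (auto simp: Q_def norm_mult)
      then have "closed_segment (\<i> * R) (- of_real d) \<subseteq> Q" "closed_segment (- of_real d) (- \<i> * R) \<subseteq> Q"
        using Q(2) by (auto simp: closed_segment_subset)
      moreover show *: "closed_segment (\<i> * R) (- of_real d) \<subseteq> - (complex_of_real ` {0..})"
        "closed_segment (- of_real d) (- \<i> * R) \<subseteq> - (complex_of_real ` {0..})"
        using d R by (auto simp: closed_segment_def complex_eq_iff zero_le_mult_iff mult_le_0_iff)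
      moreover have "0 \<in> complex_of_real ` {0..}" by force
      ultimately show "closed_segment (\<i> * R) (- of_real d) \<subseteq> Q - {0}"
        "closed_segment (- of_real d) (- \<i> * R) \<subseteq> Q - {0}" by auto
    qed
    have P: "valid_path P" "pathstart P = \<i> * R" "pathfinish P = - \<i> * R" "path_image P \<subseteq> Q - {0}"
      "path_image P \<subseteq> - (complex_of_real ` {0..})"
      using seg by (auto simp: P_def path_image_join)
    have notin: "z \<notin> complex_of_real ` {0..}" if "norm z = R" "Re z \<le> 0" for z
      using that R by auto
    have Cm: "valid_path Cm" "pathstart Cm = \<i> * R" "pathfinish Cm = - \<i> * R"
      unfolding Cm_def pathstart_part_circlepath pathfinish_part_circlepath exp by auto
    have Cm': "path_image Cm \<subseteq> UNIV - {0}" "path_image Cm \<subseteq> - (complex_of_real ` {0..})"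
      using Cm_img R notin by (fastforce, blast)
    have Cp: "valid_path Cp" "path_image Cp \<subseteq> Q - {0}"
    proof -
      show "path_image Cp \<subseteq> Q - {0}"
      proof
        fix z assume "z \<in> path_image Cp"
        from Cp_img[OF this] show "z \<in> Q - {0}" using R e(1) by (auto simp: Q_def)
      qed
    qed (simp add: Cp_def)
    have oneCm: "((\<lambda>z. 1 / z) has_contour_integral \<i> * pi) Cm"
      unfolding Cm_def
    proof (subst has_contour_integral_part_circlepath_iff)
      have "((\<lambda>t. \<i>) has_integral (3*pi/2 - pi/2) *\<^sub>R \<i>) {pi/2..3*pi/2}"
        by (rule has_integral_const_real[THEN has_integral_eq_rhs]) (auto)
      then show "((\<lambda>t. 1 / (0 + of_real R * cis t) * of_real R * \<i> * cis t) has_integral \<i> * pi) {pi/2..3*pi/2}"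
        using R by (simp add: field_simps scaleR_conv_of_real)
    qed auto
    have holS: "(\<lambda>z. 1 / z) holomorphic_on - (complex_of_real ` {0..})"
    proof (intro holomorphic_intros)
      have "0 \<in> complex_of_real ` {0..}" by (rule image_eqI[of _ _ 0]) auto
      then show "z \<noteq> 0" if "z \<in> - (complex_of_real ` {0..})" for z using that by blast
    qed
    have openS: "open (- (complex_of_real ` {0..}))"
      using closed_slot_right[of 0] by (auto simp: open_Compl)
    have oneP: "((\<lambda>z. 1 / z) has_contour_integral \<i> * pi) P"
      by (rule contour_integral_inverse_eq[OF oneCm Cm(1) Cm'(2) P(1,5)]) (simp_all only: Cm P)
    \<comment> \<open>Newman's factor. It is 1 at 0, and on the circle w z / z equals 2 Re z / R^2,
      which cancels the 1 / |Re z| in the bounds for \<open>g - G N\<close> and for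
      \<open>G N\<close>.\<close>
    define w where "w = (\<lambda>z. 1 + z\<^sup>2 / complex_of_real (R\<^sup>2))"
    have w_hol: "w holomorphic_on S" for S
      unfolding w_def by (intro holomorphic_intros) (use R in auto)
    have w_bound: "norm (w z / z) = 2 * \<bar>Re z\<bar> / R\<^sup>2" if "norm z = R" for z
    proof -
      have z: "z \<noteq> 0" using that R by auto
      have "complex_of_real (R\<^sup>2) = z * cnj z" using that complex_norm_square[of z] by simp
      then have "w z / z = (z + cnj z) / complex_of_real (R\<^sup>2)"
        using z by (simp add: w_def field_simps power2_eq_square)
      also have "z + cnj z = complex_of_real (2 * Re z)" by (simp add: complex_add_cnj)
      finally have "w z / z = complex_of_real (2 * Re z / R\<^sup>2)" by simp
      then show ?thesis by (simp only: norm_of_real) (simp add: abs_mult)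
    qed
    have contP: "continuous_on (Q - {0}) (\<lambda>z. g z * w z / z)"
      using Q(4) w_hol[of Q] by (intro continuous_intros holomorphic_on_imp_continuous_on) (auto intro: holomorphic_on_subset)
    have bdd: "\<exists>M\<ge>0. \<forall>z\<in>closed_segment a b. norm (g z * w z / z) \<le> M" if "closed_segment a b \<subseteq> Q - {0}" for a b
    proof -
      have "compact ((\<lambda>z. g z * w z / z) ` closed_segment a b)"
        by (intro compact_continuous_image continuous_on_subset[OF contP that]) auto
      from compact_imp_bounded[OF this] obtain K where "K > 0"
        "\<forall>y\<in>(\<lambda>z. g z * w z / z) ` closed_segment a b. norm y \<le> K" unfolding bounded_pos by blast
      then show ?thesis by (intro exI[of _ K]) (simp del: closed_segment_def)
    qed
    obtain M1 where M1: "M1 \<ge> 0" "\<And>z. z \<in> closed_segment (\<i> * R) (- of_real d) \<Longrightarrow> norm (g z * w z / z) \<le> M1"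
      using bdd[OF seg(1)] by blast
    obtain M2 where M2: "M2 \<ge> 0" "\<And>z. z \<in> closed_segment (- of_real d) (- \<i> * R) \<Longrightarrow> norm (g z * w z / z) \<le> M2"
      using bdd[OF seg(2)] by blast
    \<comment> \<open>Depends on R and the polygon, but not on N.\<close>
    define M where "M = (M1 * norm (- of_real d - \<i> * R) / d + M2 * norm (- of_real d - (- \<i> * R)) / d) / (2 * pi)"
    have "norm (g 0 - G N 0) \<le> 2 * B / R + M / ln (real N)" if N: "N > 1" for N
    proof -
      define x where "x = real N"
      have x: "x > 1" using N by (simp add: x_def)
      define Fg where "Fg = (\<lambda>z. of_real x powr z * (g z * w z))"
      define FG where "FG = (\<lambda>z. of_real x powr z * (G N z * w z))"
      have hol: "Fg holomorphic_on Q" "FG holomorphic_on UNIV"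
        unfolding Fg_def FG_def using x by (auto intro!: holomorphic_intros G_hol w_hol Q(4))
      have at0: "Fg 0 = g 0" "FG 0 = G N 0" using x by (auto simp: Fg_def FG_def w_def)
      have 1: "contour_integral Cp (\<lambda>z. FG z / z) + contour_integral Cm (\<lambda>z. FG z / z) = 2 * pi * \<i> * FG 0"
        unfolding Cp_def by (rule contour_integral_half_circle_add[OF _ _ hol(2) R]) (use Cm Cm' oneCm in auto)
      have 2: "contour_integral Cp (\<lambda>z. Fg z / z) + contour_integral P (\<lambda>z. Fg z / z) = 2 * pi * \<i> * Fg 0"
        unfolding Cp_def by (rule contour_integral_half_circle_add[OF Q(1,2) hol(1) R])
           (use P oneP Q Cp in \<open>auto simp: Cp_def\<close>)
      have open0: "open (Q - {0})" "open (UNIV - {0::complex})" using Q by auto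
      have hol0: "(\<lambda>z. Fg z / z) holomorphic_on Q - {0}" "(\<lambda>z. FG z / z) holomorphic_on UNIV - {0}"
         using hol by (auto intro!: holomorphic_intros intro: holomorphic_on_subset)
      have int: "(\<lambda>z. Fg z / z) contour_integrable_on Cp" "(\<lambda>z. FG z / z) contour_integrable_on Cp"
        "(\<lambda>z. FG z / z) contour_integrable_on Cm"
        using contour_integrable_holomorphic_simple[OF hol0(1) open0(1)]
           contour_integrable_holomorphic_simple[OF hol0(2) open0(2)] Cp Cm Cm' by auto
      have xz: "norm (of_real x powr z) = x powr Re z" for z
        using x by (simp add: norm_powr_real_powr)
      have bCp: "norm (contour_integral Cp (\<lambda>z. Fg z / z - FG z / z)) \<le> (2 * B / R\<^sup>2) * R * (pi/2 - (- pi/2))"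
      proof (rule has_contour_integral_bound_part_circlepath)
        show "((\<lambda>z. Fg z / z - FG z / z) has_contour_integral contour_integral Cp (\<lambda>z. Fg z / z - FG z / z))
            (part_circlepath 0 R (- pi / 2) (pi / 2))"
          unfolding Cp_def[symmetric] using int by (intro has_contour_integral_integral contour_integrable_diff)
        fix z assume "z \<in> path_image (part_circlepath 0 R (- pi / 2) (pi / 2))"
        then have z: "norm z = R" "Re z \<ge> 0" using Cp_img by (auto simp: Cp_def)
        have eq: "Fg z / z - FG z / z = of_real x powr z * ((g z - G N z) * (w z / z))"
          by (simp add: Fg_def FG_def algebra_simps diff_divide_distrib)
        show "norm (Fg z / z - FG z / z) \<le> 2 * B / R\<^sup>2"
        proof (cases "Re z = 0")
          case True
          then have "norm (w z / z) = 0" unfolding w_bound[OF z(1)] by simp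
          then have w0: "w z / z = 0" by (rule norm_eq_zero[THEN iffD1])
          show ?thesis unfolding eq w0 using B by simp
        next
          case False
          then have z0: "Re z > 0" using z by auto
          have "norm (Fg z / z - FG z / z) = x powr Re z * (norm (g z - G N z) * (2 * Re z / R\<^sup>2))"
            unfolding eq norm_mult xz w_bound[OF z(1)] using z0 by simp
          also have "\<dots> \<le> x powr Re z * ((B * (x powr (- Re z) / Re z)) * (2 * Re z / R\<^sup>2))"
            using bound_right[OF z0, of N] N z0 unfolding x_def[symmetric]
            by (intro mult_left_mono mult_right_mono) auto
          also have "\<dots> = 2 * B / R\<^sup>2" using z0 x by (simp add: powr_minus field_simps)
          finally show ?thesis .
        qed
      qed (use B R in auto)
      have bCm: "norm (contour_integral Cm (\<lambda>z. FG z / z)) \<le> (2 * B / R\<^sup>2) * R * (3*pi/2 - pi/2)"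
      proof (rule has_contour_integral_bound_part_circlepath)
        show "((\<lambda>z. FG z / z) has_contour_integral contour_integral Cm (\<lambda>z. FG z / z))
            (part_circlepath 0 R (pi / 2) (3*pi / 2))"
          unfolding Cm_def[symmetric] using int by (intro has_contour_integral_integral)
        fix z assume "z \<in> path_image (part_circlepath 0 R (pi / 2) (3*pi / 2))"
        then have z: "norm z = R" "Re z \<le> 0" using Cm_img by (auto simp: Cm_def)
        have eq: "FG z / z = of_real x powr z * (G N z * (w z / z))"
          by (simp add: FG_def algebra_simps)
        show "norm (FG z / z) \<le> 2 * B / R\<^sup>2"
        proof (cases "Re z = 0")
          case True
          then have "norm (w z / z) = 0" unfolding w_bound[OF z(1)] by simp
          then have w0: "w z / z = 0" by (rule norm_eq_zero[THEN iffD1])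
          show ?thesis unfolding eq w0 using B by simp
        next
          case False
          then have z0: "Re z < 0" using z by auto
          have "norm (FG z / z) = x powr Re z * (norm (G N z) * (2 * (- Re z) / R\<^sup>2))"
            unfolding eq norm_mult xz w_bound[OF z(1)] using z0 by simp
          also have "\<dots> \<le> x powr Re z * ((B * (x powr (- Re z) / (- Re z))) * (2 * (- Re z) / R\<^sup>2))"
            using bound_left[OF z0, of N] N z0 unfolding x_def[symmetric]
            by (intro mult_left_mono mult_right_mono) (auto simp: divide_le_0_iff)
          also have "\<dots> = 2 * B / R\<^sup>2" using z0 x by (simp add: powr_minus field_simps)
          finally show ?thesis .
        qed
      qed (use B R in auto)
      have eqF: "(\<lambda>z. Fg z / z) = (\<lambda>z. of_real x powr z * (g z * w z / z))"
        by (auto simp: Fg_def)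
      have cs: "continuous_on (closed_segment (\<i> * R) (- of_real d)) (\<lambda>z. g z * w z / z)"
           "continuous_on (closed_segment (- \<i> * R) (- of_real d)) (\<lambda>z. g z * w z / z)"
        using continuous_on_subset[OF contP] seg by (auto simp: closed_segment_commute)
      have bP1: "norm (contour_integral (linepath (\<i> * R) (- of_real d)) (\<lambda>z. Fg z / z)) \<le> M1 * norm (- of_real d - \<i> * R) / (d * ln x)"
        unfolding eqF by (rule powr_decay_contour_bound[OF _ _ d(1) x cs(1) M1(2)]) (use d R in auto)
      \<comment> \<open>The decay estimate starts on the imaginary axis, so the second segment is
        traversed backwards.\<close>
      have bP2': "norm (contour_integral (linepath (- \<i> * R) (- of_real d)) (\<lambda>z. Fg z / z)) \<le> M2 * norm (- of_real d - (- \<i> * R)) / (d * ln x)"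
        unfolding eqF by (rule powr_decay_contour_bound[OF _ _ d(1) x cs(2)]) (use d R M2(2) in \<open>auto simp: closed_segment_commute\<close>)
      have bP2: "norm (contour_integral (linepath (- of_real d) (- \<i> * R)) (\<lambda>z. Fg z / z)) \<le> M2 * norm (- of_real d - (- \<i> * R)) / (d * ln x)"
        using bP2' contour_integral_reversepath[of "linepath (- of_real d) (- \<i> * R)" "\<lambda>z. Fg z / z"]
        by (simp add: norm_minus_commute)
      have "contour_integral P (\<lambda>z. Fg z / z) = contour_integral (linepath (\<i> * R) (- of_real d)) (\<lambda>z. Fg z / z)
           + contour_integral (linepath (- of_real d) (- \<i> * R)) (\<lambda>z. Fg z / z)"
        unfolding P_def using contour_integrable_holomorphic_simple[OF hol0(1) open0(1)] seg
        by (intro contour_integral_join) auto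
      moreover have "2 * pi * (M / ln x) = M1 * norm (- of_real d - \<i> * R) / (d * ln x) + M2 * norm (- of_real d - (- \<i> * R)) / (d * ln x)"
        by (simp add: M_def add_divide_distrib distrib_left)
      ultimately have bP: "norm (contour_integral P (\<lambda>z. Fg z / z)) \<le> 2 * pi * (M / ln x)"
        using norm_triangle_mono[OF bP1 bP2] by simp
      have "2 * pi * \<i> * (g 0 - G N 0) = contour_integral Cp (\<lambda>z. Fg z / z - FG z / z)
           - contour_integral Cm (\<lambda>z. FG z / z) + contour_integral P (\<lambda>z. Fg z / z)"
        unfolding contour_integral_diff[OF int(1,2)] right_diff_distrib
          1[unfolded at0, symmetric] 2[unfolded at0, symmetric] by simp
      then have "norm (2 * pi * \<i> * (g 0 - G N 0)) \<le> (2 * B / R\<^sup>2) * R * pi + (2 * B / R\<^sup>2) * R * pi + 2 * pi * (M / ln x)"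
        using bCp bCm bP by (smt (verit) norm_triangle_ineq norm_triangle_ineq4 field_sum_of_halves mult_minus_left)
      also have "\<dots> = 2 * pi * (2 * B / R + M / ln x)"
        using R by (simp add: field_simps power2_eq_square)
      finally have "2 * pi * norm (g 0 - G N 0) \<le> 2 * pi * (2 * B / R + M / ln x)"
        by (simp add: norm_mult)
      then show ?thesis by (simp add: x_def)
    qed
    then show ?thesis by blast
  qed
  have "(\<lambda>N. G N 0) \<longlonglongrightarrow> g 0"
  proof (rule LIMSEQ_I)
    fix r :: real assume r: "r > 0"
    \<comment> \<open>This makes 2 B / R less than r / 2; the summand 1 keeps R positive when B =
      0.\<close>
    define R where "R = 4 * (B + 1) / r"
    have R: "R > 0" using B r by (simp add: R_def)
    have "2 * B / R < r / 2 + 0" using B r by (simp add: R_def field_simps)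
    then have BR: "2 * B / R < r" using r by linarith
    obtain M where M: "\<And>N. N > 1 \<Longrightarrow> norm (g 0 - G N 0) \<le> 2 * B / R + M / ln (real N)"
      using main[OF R] by blast
    have "(\<lambda>N. 2 * B / R + M / ln (real N)) \<longlonglongrightarrow> 2 * B / R" by real_asymp
    then have "\<forall>\<^sub>F N in sequentially. 2 * B / R + M / ln (real N) < r"
      using BR by (rule order_tendstoD)
    then have "\<forall>\<^sub>F N in sequentially. norm (G N 0 - g 0) < r"
      using eventually_gt_at_top[of 1]
      by eventually_elim (use M in \<open>fastforce simp: norm_minus_commute\<close>)
    then show "\<exists>no. \<forall>n\<ge>no. norm (G n 0 - g 0) < r"
      by (simp add: eventually_sequentially)
  qed
  then show ?thesis by (simp add: G_def)
qed

section \<open>Dirichlet characters\<close>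

text \<open>Characters as functions on \<open>nat\<close>, periodic and supported exactly on the
  units. No group is formed, so they can be multiplied, translated and used as coefficients
  directly.\<close>

definition dchar :: "nat \<Rightarrow> (nat \<Rightarrow> complex) \<Rightarrow> bool" where
  "dchar W chi \<longleftrightarrow> (\<forall>a b. chi (a * b) = chi a * chi b) \<and> (\<forall>a b. [a = b] (mod W) \<longrightarrow> chi a = chi b) \<and>
     (\<forall>a. chi a \<noteq> 0 \<longleftrightarrow> coprime a W)"

definition principal_dchar :: "nat \<Rightarrow> nat \<Rightarrow> complex" where
  "principal_dchar W a = (if coprime a W then 1 else 0)"

lemma dchar_mult: "dchar W chi \<Longrightarrow> chi (a * b) = chi a * chi b"
  and dchar_cong: "dchar W chi \<Longrightarrow> [a = b] (mod W) \<Longrightarrow> chi a = chi b"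
  and dchar_nz_iff: "dchar W chi \<Longrightarrow> chi a \<noteq> 0 \<longleftrightarrow> coprime a W"
  by (simp_all add: dchar_def)

lemma dchar_1: assumes "dchar W chi" shows "chi 1 = 1"
  using mult_cancel_left1[THEN iffD1, OF dchar_mult[OF assms, of 1 1, unfolded mult_1_right]]
    dchar_nz_iff[OF assms, of 1] by auto

lemma dchar_power: assumes "dchar W chi" shows "chi (a ^ k) = chi a ^ k"
  by (induction k) (use dchar_1[OF assms] dchar_mult[OF assms] in auto)

lemma dchar_principal: "W > 0 \<Longrightarrow> dchar W (principal_dchar W)"
  unfolding dchar_def principal_dchar_def by (auto dest: cong_imp_coprime cong_imp_coprime[OF cong_sym])

lemma dchar_times: "dchar W chi \<Longrightarrow> dchar W \<psi> \<Longrightarrow> dchar W (\<lambda>n. chi n * \<psi> n)"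
  unfolding dchar_def by (simp add: mult_ac)

lemma dchar_totient:
  assumes "dchar W chi" "coprime a W"
  shows "chi a ^ totient W = 1"
  using dchar_cong[OF assms(1) euler_theorem[OF assms(2)]]
  by (simp only: dchar_power[OF assms(1)] dchar_1[OF assms(1)])

lemma norm_dchar:
  assumes "dchar W chi" "W > 0" "coprime a W"
  shows "norm (chi a) = 1"
proof -
  have "norm (chi a) ^ totient W = 1 ^ totient W"
    using dchar_totient[OF assms(1,3)] by (simp flip: norm_power)
  then show ?thesis by (rule power_eq_imp_eq_base) (use assms(2) in auto)
qed

lemma norm_dchar_le:
  assumes "dchar W chi" "W > 0"
  shows "norm (chi a) \<le> 1"
  using norm_dchar[OF assms, of a] dchar_nz_iff[OF assms(1), of a] by (cases "coprime a W") auto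

text \<open>Multiplication by a unit g with chi g \<noteq> 1 permutes the residues and multiplies
  the sum by chi g.\<close>

lemma sum_dchar_nonprincipal:
  assumes "dchar W chi" "W > 0" "chi \<noteq> principal_dchar W"
  shows "(\<Sum>a<W. chi a) = 0"
proof -
  obtain g where g: "coprime g W" "chi g \<noteq> 1"
    using assms(3) dchar_nz_iff[OF assms(1)] by (auto simp: fun_eq_iff principal_dchar_def split: if_splits)
  have inj: "inj_on (\<lambda>a. g * a mod W) {..<W}"
  proof (rule inj_onI)
    fix x y assume xy: "x \<in> {..<W}" "y \<in> {..<W}" "g * x mod W = g * y mod W"
    then have "[x = y] (mod W)" using g(1) cong_mult_lcancel_nat[of g W x y] by (simp add: cong_def)
    then show "x = y" using xy by (simp add: cong_def)
  qed
  have "(\<lambda>a. g * a mod W) ` {..<W} = {..<W}"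
    by (rule endo_inj_surj[OF _ _ inj]) (use assms(2) in auto)
  with inj have bij: "bij_betw (\<lambda>a. g * a mod W) {..<W} {..<W}" by (simp add: bij_betw_def)
  have "chi g * (\<Sum>a<W. chi a) = (\<Sum>a<W. chi (g * a mod W))"
    unfolding sum_distrib_left
    by (intro sum.cong refl) (simp only: dchar_mult[OF assms(1), symmetric], rule dchar_cong[OF assms(1)], simp add: cong_def)
  also have "\<dots> = (\<Sum>a<W. chi a)" using sum.reindex_bij_betw[OF bij] by simp
  finally show ?thesis using g(2) by simp
qed

text \<open>With \<open>m\<close> the mean over a period, the sums \<open>T\<close> of f - m vanish
  over a full period and are therefore periodic; at most W terms of size at most 2 remain. The last
  2 in the bound pays for the term at index 0.\<close>

lemma periodic_partial_sum_bound:
  fixes f :: "nat \<Rightarrow> complex"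
  assumes W: "W > 0" and f: "\<And>a b. [a = b] (mod W) \<Longrightarrow> f a = f b" "\<And>a. norm (f a) \<le> 1"
    and m: "(\<Sum>a<W. f a) = of_nat W * m"
  shows "norm ((\<Sum>k=1..n. f k) - of_nat n * m) \<le> 2 * real W + 2"
proof -
  define T where "T = (\<lambda>n. \<Sum>k<n. (f k - m))"
  have "real W * norm m = norm (\<Sum>a<W. f a)" by (simp add: m norm_mult)
  also have "\<dots> \<le> real W * 1" by (rule order_trans[OF norm_sum]) (use sum_bounded_above[of "{..<W}" "\<lambda>a. norm (f a)" 1] f in auto)
  finally have m1: "norm m \<le> 1" using W by simp
  have TW: "T W = 0" by (simp add: T_def sum_subtractf m)
  have step: "T (n + W) = T n" for n
  proof -
    have "T (n + W) = (\<Sum>k=0..<W. (f k - m)) + (\<Sum>k=W..<W + n. (f k - m))"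
      by (simp add: T_def sum.atLeastLessThan_concat add.commute flip: atLeast0LessThan)
    also have "(\<Sum>k=W..<W + n. (f k - m)) = (\<Sum>k=0..<n. (f (k + W) - m))"
      using sum.shift_bounds_nat_ivl[of "\<lambda>k. f k - m" 0 W n] by (simp add: add.commute)
    also have "\<dots> = T n" unfolding T_def atLeast0LessThan
      by (intro sum.cong refl arg_cong2[of _ _ _ _ "(-)"] f) (simp add: cong_def)
    finally show ?thesis using TW by (simp add: T_def atLeast0LessThan)
  qed
  have "T (n + q * W) = T n" for n q
  proof (induction q)
    case (Suc q)
    have "T (n + Suc q * W) = T ((n + q * W) + W)" by (simp add: algebra_simps)
    then show ?case using Suc step by simp
  qed simp
  from this[of "Suc n mod W" "Suc n div W"] have "T (Suc n) = T (Suc n mod W)" by simp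
  also have "norm \<dots> \<le> (\<Sum>k<Suc n mod W. 2)"
    unfolding T_def
  proof (rule sum_norm_le)
    fix k show "norm (f k - m) \<le> 2" using norm_triangle_ineq4[of "f k" m] f(2)[of k] m1 by linarith
  qed
  also have "\<dots> \<le> 2 * real W" using W by (simp add: less_imp_le)
  finally have TB: "norm (T (Suc n)) \<le> 2 * real W" .
  have "{..<Suc n} = insert 0 {1..n}" by auto
  then have "(\<Sum>k<Suc n. f k) = f 0 + (\<Sum>k=1..n. f k)" by simp
  moreover have "T (Suc n) = (\<Sum>k<Suc n. f k) - of_nat (Suc n) * m"
    by (simp add: T_def sum_subtractf)
  ultimately have "(\<Sum>k=1..n. f k) - of_nat n * m = T (Suc n) - (f 0 - m)" by (simp add: algebra_simps)
  then show ?thesis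
    using TB norm_triangle_ineq4[of "T (Suc n)" "f 0 - m"] norm_triangle_ineq4[of "f 0" m] f(2)[of 0] m1 by simp
qed

section \<open>Decomposition of functions on the reduced classes into characters\<close>

lemma sum_powers_root_unity:
  assumes "i < m"
  shows "(\<Sum>j<m. exp (2 * of_real pi * \<i> * of_nat i / of_nat m) ^ j) = (if i = 0 then of_nat m else (0::complex))"
proof (cases "i = 0")
  case False
  have "exp (2 * of_real pi * \<i> * of_nat i / of_nat m) \<noteq> (1::complex)"
    using complex_root_unity_eq[of m i 0] assms False by simp
  then show ?thesis using False complex_root_unity[of m i] assms by (simp add: geometric_sum)
qed auto

text \<open>
  Every function on the reduced classes is a sum of simultaneous eigenfunctions of the translations,
  and those are multiples of characters. Treating the translations one at a time makes a finite
  Fourier transform over a cyclic group suffice.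
\<close>
lemma dchar_span_induct:
  fixes f :: "nat \<Rightarrow> complex"
  assumes W: "W > 0"
    and f: "\<And>a b. [a = b] (mod W) \<Longrightarrow> f a = f b" "\<And>a. \<not> coprime a W \<Longrightarrow> f a = 0"
    and scale: "\<And>c chi. dchar W chi \<Longrightarrow> P (\<lambda>n. c * chi n)"
    and add: "\<And>f h. P f \<Longrightarrow> P h \<Longrightarrow> P (\<lambda>n. f n + h n)"
  shows "P f"
proof -
  define cls where "cls = {f :: nat \<Rightarrow> complex. (\<forall>a b. [a = b] (mod W) \<longrightarrow> f a = f b) \<and> (\<forall>a. \<not> coprime a W \<longrightarrow> f a = 0)}"
  define E where "E = (\<lambda>S. {f \<in> cls. \<forall>g\<in>S. \<exists>w. \<forall>x. f (g * x) = w * f x})"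
  define T where "T = {g. g < W \<and> coprime g W}"
  have P0: "P (\<lambda>n. 0)" using scale[OF dchar_principal[OF W], of 0] by simp
  have Psum: "P (\<lambda>n. \<Sum>j<m. F j n)" if "\<And>j. j < m \<Longrightarrow> P (F j)" for m :: nat and F
    using that by (induction m) (auto simp: P0 intro!: add)
  have base: "P f" if fE: "f \<in> E T" for f
  proof -
    have cls: "\<And>a b. [a = b] (mod W) \<Longrightarrow> f a = f b" "\<And>a. \<not> coprime a W \<Longrightarrow> f a = 0"
      using fE by (auto simp: E_def cls_def)
    have eig: "\<exists>w. \<forall>x. f (g * x) = w * f x" if "coprime g W" for g
    proof -
      have "g mod W \<in> T" using that W by (simp add: T_def coprime_commute)
      then obtain w where "\<forall>x. f (g mod W * x) = w * f x" using fE by (auto simp: E_def)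
      moreover have "f (g mod W * x) = f (g * x)" for x by (rule cls) (simp add: cong_def mod_mult_left_eq)
      ultimately show ?thesis by auto
    qed
    have eig1: "f (g * x) * f 1 = f g * f x" for g x
    proof (cases "coprime g W")
      case True
      then obtain w where w: "\<And>x. f (g * x) = w * f x" using eig by blast
      show ?thesis using w[of x] w[of 1] by simp
    qed (simp add: cls)
    show ?thesis
    proof (cases "f 1 = 0")
      case True
      have "f g = 0" for g
      proof (cases "coprime g W")
        case True
        then obtain w where w: "\<And>x. f (g * x) = w * f x" using eig by blast
        show ?thesis using w[of 1] \<open>f 1 = 0\<close> by simp
      qed (simp add: cls)
      then have "f = (\<lambda>n. 0)" by auto
      then show ?thesis using P0 by simp
    next
      case False
      have nz: "f a \<noteq> 0" if a: "coprime a W" for a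
      proof -
        obtain w where w: "\<And>x. f (a * x) = w * f x" using eig[OF a] by blast
        have "f (a ^ k * 1) = w ^ k * f 1" for k
          by (induction k) (auto simp: w mult.assoc)
        \<comment> \<open>By Euler's theorem the orbit of 1 under a closes up after
          \<open>totient W\<close> steps, so w is a root of unity on it, in particular
          nonzero.\<close>
        then have "f 1 = w ^ totient W * f 1"
          using cls(1)[OF euler_theorem[OF a]] by simp
        then have "w \<noteq> 0" using False W by (auto simp: power_0_left split: if_splits)
        then show ?thesis using w[of 1] False by simp
      qed
      have iff: "f a \<noteq> 0 \<longleftrightarrow> coprime a W" for a using nz cls(2) by blast
      have "dchar W (\<lambda>n. f n / f 1)"
        unfolding dchar_def
      proof (intro conjI allI impI)
        fix a b
        show "f (a * b) / f 1 = f a / f 1 * (f b / f 1)" using False eig1[of a b] by (simp add: field_simps)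
        show "f a / f 1 = f b / f 1" if "[a = b] (mod W)" using cls(1)[OF that] by simp
        show "f a / f 1 \<noteq> 0 \<longleftrightarrow> coprime a W" unfolding iff[symmetric] using False by simp
      qed
      from scale[OF this, of "f 1"] show ?thesis using False by simp
    qed
  qed
  \<comment> \<open>\<open>S\<close> collects the translations for which f need not yet be an
    eigenfunction; each induction step removes one of them by splitting f.\<close>
  have step: "P f" if S: "S \<subseteq> T" and fE: "f \<in> E (T - S)" for S f
  proof -
    have "finite S" by (rule finite_subset[OF S]) (simp add: T_def)
    then show ?thesis using S fE
    proof (induction S arbitrary: f rule: finite_induct)
      case empty
      then show ?case using base by simp
    next
      case (insert g S)
      have cls: "\<And>a b. [a = b] (mod W) \<Longrightarrow> f a = f b" "\<And>a. \<not> coprime a W \<Longrightarrow> f a = 0"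
        using insert by (auto simp: E_def cls_def)
      have g: "coprime g W" using insert by (auto simp: T_def)
      define m where "m = totient W"
      have m: "m > 0" using W by (simp add: m_def)
      define \<zeta> where "\<zeta> = (\<lambda>i::nat. exp (2 * of_real pi * \<i> * of_nat i / of_nat m) :: complex)"
      have \<zeta>_pow: "\<zeta> i ^ j = \<zeta> (i * j)" for i j
        by (simp add: \<zeta>_def mult_ac flip: exp_of_nat_mult)
      have \<zeta>_m: "\<zeta> (m * j) = 1" for j
        using complex_root_unity[of m j] m \<zeta>_pow[of j m] by (simp add: \<zeta>_def mult.commute)
      have \<zeta>_add: "\<zeta> (i + j) = \<zeta> i * \<zeta> j" for i j
        by (simp add: \<zeta>_def add_divide_distrib algebra_simps flip: exp_add)
      \<comment> \<open>The Fourier transform along the orbit of g, which projects to the eigenvalue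
        \<open>inverse (\<zeta> j)\<close>. The length m = \<open>totient W\<close> may be a proper
        multiple of the order of g; only g^m = 1 modulo W matters. Translations commute, so
        eigenfunction properties already gained are kept.\<close>
      define F where "F = (\<lambda>j x. (\<Sum>i<m. \<zeta> (i * j) * f (g ^ i * x)) / of_nat m)"
      have eigF: "F j (g * x) = inverse (\<zeta> j) * F j x" for j x
      proof -
        define h where "h = (\<lambda>i. \<zeta> (i * j) * f (g ^ i * x))"
        have "[g ^ m * x = 1 * x] (mod W)" unfolding m_def by (intro cong_mult euler_theorem g cong_refl)
        then have "h m = h 0" using \<zeta>_m cls(1) by (fastforce simp: h_def \<zeta>_def)
        moreover have "(\<Sum>i<m. h (Suc i)) + h 0 = (\<Sum>i<m. h i) + h m"
          using sum.lessThan_Suc_shift[of h m] by (simp add: add.commute)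
        ultimately have "(\<Sum>i<m. h (Suc i)) = (\<Sum>i<m. h i)" by simp
        moreover have "(\<Sum>i<m. h (Suc i)) = \<zeta> j * (\<Sum>i<m. \<zeta> (i * j) * f (g ^ i * (g * x)))"
          unfolding sum_distrib_left h_def by (intro sum.cong refl) (simp add: \<zeta>_add mult_ac)
        ultimately have "\<zeta> j * F j (g * x) = F j x" by (simp add: F_def h_def field_simps)
        moreover have "\<zeta> j \<noteq> 0" by (simp add: \<zeta>_def)
        ultimately show ?thesis by (simp add: field_simps)
      qed
      have clsF: "F j \<in> cls" for j
      proof -
        have "F j a = F j b" if "[a = b] (mod W)" for a b
          unfolding F_def by (intro arg_cong2[of _ _ _ _ "(/)"] refl sum.cong arg_cong2[of _ _ _ _ "(*)"] cls cong_mult cong_refl that)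
        moreover have "F j a = 0" if "\<not> coprime a W" for a
          using cls(2) that by (simp add: F_def)
        ultimately show ?thesis by (simp add: cls_def)
      qed
      have "P (F j)" for j
      proof (rule insert.IH)
        show "S \<subseteq> T" using insert by auto
        have "\<exists>w. \<forall>x. F j (s * x) = w * F j x" if s: "s \<in> T - S" for s
        proof (cases "s = g")
          case False
          with s have "s \<in> T - insert g S" by simp
          then obtain w where w: "\<And>x. f (s * x) = w * f x"
            using insert.prems(2) unfolding E_def by blast
          have "f (g ^ i * (s * x)) = w * f (g ^ i * x)" for i x
            using w[of "g ^ i * x"] by (simp only: mult.left_commute)
          then have "F j (s * x) = w * F j x" for x
            by (simp only: F_def mult.left_commute[of _ w]) (simp add: sum_distrib_left[symmetric])
          then show ?thesis by blast
        qed (use eigF in blast)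
        then show "F j \<in> E (T - S)" using clsF by (simp add: E_def)
      qed
      then have "P (\<lambda>x. \<Sum>j<m. F j x)" by (intro Psum)
      moreover have "(\<Sum>j<m. F j x) = f x" for x
      proof -
        have "(\<Sum>j<m. F j x) = (\<Sum>i<m. (\<Sum>j<m. \<zeta> i ^ j) * f (g ^ i * x)) / of_nat m"
          unfolding F_def sum_divide_distrib[symmetric] sum_distrib_right \<zeta>_pow by (subst sum.swap) simp
        also have "(\<Sum>i<m. (\<Sum>j<m. \<zeta> i ^ j) * f (g ^ i * x)) = (\<Sum>i<m. if i = 0 then of_nat m * f (g ^ i * x) else 0)"
          unfolding \<zeta>_def by (intro sum.cong refl) (simp add: sum_powers_root_unity)
        also have "\<dots> / of_nat m = f x" using m by (simp add: sum.delta)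
        finally show ?thesis .
      qed
      ultimately show ?case by simp
    qed
  qed
  show ?thesis
    by (rule step[of T]) (use f in \<open>auto simp: E_def cls_def\<close>)
qed

section \<open>Continuation of Dirichlet series\<close>

abbreviation powr_gap :: "nat \<Rightarrow> complex \<Rightarrow> complex" where
  "powr_gap n s \<equiv> of_nat n powr (- s) - of_nat (Suc n) powr (- s)"

text \<open>In the applications \<open>v 0 = 0\<close> is the convention that 0 powr s is 0, or is
  built into v. It lets series be indexed from 0 while partial sums start at 1.\<close>

lemma abel_summation_finite:
  fixes a v :: "nat \<Rightarrow> 'a::comm_ring_1"
  assumes v: "v 0 = 0"
  shows "(\<Sum>n<Suc N. a n * v n) = (\<Sum>n<N. (\<Sum>k=1..n. a k) * (v n - v (Suc n))) + (\<Sum>k=1..N. a k) * v N"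
  by (induction N) (auto simp: v algebra_simps)

text \<open>Partial sums of order n lose against n^(-s) for Re s > 1, so the boundary term
  disappears. The right-hand series converges further to the left as soon as the partial sums are
  better controlled, and this is the source of the continuation.\<close>

lemma abel_summation_sums_iff:
  fixes a :: "nat \<Rightarrow> complex"
  assumes B: "\<And>n. norm (\<Sum>k=1..n. a k) \<le> B * real n" and s: "Re s > 1"
  shows "(\<lambda>n. a n * of_nat n powr (- s)) sums X \<longleftrightarrow>
         (\<lambda>n. (\<Sum>k=1..n. a k) * powr_gap n s) sums X"
proof -
  define A where "A = (\<lambda>n. \<Sum>k=1..n. a k)"
  have lim: "(\<lambda>N. A N * of_nat N powr (- s)) \<longlonglongrightarrow> 0"
  proof (rule Lim_null_comparison)
    show "\<forall>\<^sub>F n in sequentially. norm (A n * of_nat n powr (- s)) \<le> B * real n powr (1 - Re s)"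
      using eventually_gt_at_top[of 0]
    proof eventually_elim
      case (elim n)
      have "norm (A n * of_nat n powr (- s)) = norm (A n) * real n powr (- Re s)"
        using elim norm_powr_real_powr[of "of_nat n" "- s"] by (simp add: norm_mult)
      also have "\<dots> \<le> B * real n * real n powr (- Re s)"
        using B[of n] by (intro mult_right_mono) (auto simp: A_def)
      also have "\<dots> = B * real n powr (1 - Re s)"
        using elim by (simp add: powr_diff powr_minus field_simps)
      finally show ?case .
    qed
    show "(\<lambda>n. B * real n powr (1 - Re s)) \<longlonglongrightarrow> 0"
      using s by real_asymp
  qed
  have *: "(\<Sum>n<Suc N. a n * of_nat n powr (- s)) =
     (\<Sum>n<N. A n * powr_gap n s) + A N * of_nat N powr (- s)" for N
    unfolding A_def by (rule abel_summation_finite) simp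
  have "(\<lambda>n. a n * of_nat n powr (- s)) sums X \<longleftrightarrow> (\<lambda>N. \<Sum>n<Suc N. a n * of_nat n powr (- s)) \<longlonglongrightarrow> X"
    unfolding sums_def by (rule filterlim_sequentially_Suc[symmetric])
  also have "\<dots> \<longleftrightarrow> (\<lambda>n. A n * powr_gap n s) sums X"
    unfolding * sums_def
  proof
    assume "(\<lambda>N. (\<Sum>n<N. A n * powr_gap n s) + A N * of_nat N powr (- s)) \<longlonglongrightarrow> X"
    from tendsto_diff[OF this lim] show "(\<lambda>N. (\<Sum>n<N. A n * powr_gap n s)) \<longlonglongrightarrow> X"
      by simp
  next
    assume "(\<lambda>N. (\<Sum>n<N. A n * powr_gap n s)) \<longlonglongrightarrow> X"
    from tendsto_add[OF this lim] show "(\<lambda>N. (\<Sum>n<N. A n * powr_gap n s) + A N * of_nat N powr (- s)) \<longlonglongrightarrow> X"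
      by simp
  qed
  finally show ?thesis by (simp add: A_def)
qed

lemma powr_series_bound_le:
  assumes "norm (z::complex) \<le> C * (1 + norm s)\<^sup>2 * real n powr (- Re s - 1)" "s \<in> ball s0 (Re s0 / 2)" "Re s0 > 0" "C \<ge> 0"
  shows "norm z \<le> C * (1 + 2 * norm s0)\<^sup>2 * real n powr (- Re s0 / 2 - 1)"
proof -
  have d: "norm (s - s0) < Re s0 / 2" using assms(2) by (simp add: dist_norm norm_minus_commute)
  have "norm s \<le> norm s0 + norm (s - s0)" using norm_triangle_ineq[of s0 "s - s0"] by simp
  then have 1: "norm s \<le> 2 * norm s0" using d complex_Re_le_cmod[of s0] assms(3) by linarith
  have 2: "Re s \<ge> Re s0 / 2" using d abs_Re_le_cmod[of "s - s0"] by (simp add: abs_le_iff)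
  have "real n powr (- Re s - 1) \<le> real n powr (- Re s0 / 2 - 1)"
    using 2 by (cases "n = 0") (auto intro!: powr_mono)
  then have "C * (1 + norm s)\<^sup>2 * real n powr (- Re s - 1) \<le> C * (1 + 2 * norm s0)\<^sup>2 * real n powr (- Re s0 / 2 - 1)"
    using 1 assms(4) by (intro mult_mono power_mono) auto
  then show ?thesis using assms(1) by linarith
qed

text \<open>The quadratic weight in s is the size of the factor s (s - 1) that arises below. On a
  disc of radius Re s0 / 2 it stays bounded and the exponent of n stays below -1, which gives a
  summable majorant.\<close>

lemma holomorphic_series_half_plane:
  assumes hol: "\<And>n. f n holomorphic_on {s. Re s > 0}" and C: "C \<ge> 0"
    and bound: "\<And>n s. Re s > 0 \<Longrightarrow> norm (f n s) \<le> C * (1 + norm s)\<^sup>2 * real n powr (- Re s - 1)"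
  obtains F where "F holomorphic_on {s. Re s > 0}" "\<And>s. Re s > 0 \<Longrightarrow> (\<lambda>n. f n s) sums F s"
proof -
  let ?H = "{s::complex. Re s > 0}"
  have op: "open ?H" by (rule open_halfspace_Re_gt)
  have der: "(f n has_field_derivative deriv (f n) x) (at x)" if "x \<in> ?H" for n x
    using holomorphic_derivI[OF hol op that] .
  have "\<exists>g g'. \<forall>x\<in>?H. (\<lambda>n. f n x) sums g x \<and> (\<lambda>n. deriv (f n) x) sums g' x \<and> (g has_field_derivative g' x) (at x)"
  proof (rule series_and_derivative_comparison_complex[OF op der])
    fix x :: complex assume x: "x \<in> ?H"
    show "\<exists>d h. 0 < d \<and> summable h \<and> range h \<subseteq> \<real>\<^sub>\<ge>\<^sub>0 \<and> (\<forall>\<^sub>F n in sequentially. \<forall>y\<in>ball x d \<inter> ?H. cmod (f n y) \<le> cmod (h n))"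
    proof (intro exI conjI)
      show "0 < Re x / 2" using x by simp
      let ?h = "\<lambda>n. complex_of_real (C * (1 + 2 * norm x)\<^sup>2 * real n powr (- Re x / 2 - 1))"
      have "summable (\<lambda>n. C * (1 + 2 * norm x)\<^sup>2 * real n powr (- Re x / 2 - 1))"
        using x by (intro summable_mult) (simp add: summable_real_powr_iff)
      then show "summable ?h" by (rule summable_of_real)
      show "range ?h \<subseteq> \<real>\<^sub>\<ge>\<^sub>0" using C by (auto simp: nonneg_Reals_of_real_iff)
      show "\<forall>\<^sub>F n in sequentially. \<forall>y\<in>ball x (Re x / 2) \<inter> ?H. cmod (f n y) \<le> cmod (?h n)"
      proof (intro always_eventually allI ballI)
        fix n y assume y: "y \<in> ball x (Re x / 2) \<inter> ?H"
        have "norm (f n y) \<le> C * (1 + 2 * norm x)\<^sup>2 * real n powr (- Re x / 2 - 1)"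
          by (rule powr_series_bound_le[OF bound]) (use y x C in auto)
        then show "norm (f n y) \<le> norm (?h n)" using C by (simp only: norm_of_real)
      qed
    qed
  qed simp
  then obtain g g' where g: "\<And>x. x \<in> ?H \<Longrightarrow> (\<lambda>n. f n x) sums g x" "\<And>x. x \<in> ?H \<Longrightarrow> (g has_field_derivative g' x) (at x)"
    by blast
  have "g holomorphic_on ?H"
    unfolding holomorphic_on_open[OF op] using g(2) by blast
  with g(1) that show ?thesis by blast
qed

text \<open>After multiplication by s - 1 both terms are integrals over the same block, and the
  integrands combine to s (s - 1) (S - m x) x^(-s-1). Subtracting the mean growth thus gains a power
  of n, and s = 1 is not a special case.\<close>

lemma powr_block_bound:
  fixes S m s :: complex
  assumes n: "n > 0" and s: "Re s > 0"
    and C: "\<And>x. x \<in> {real n..real (Suc n)} \<Longrightarrow> norm (S - m * of_real x) \<le> C"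
  shows "norm ((s - 1) * S * powr_gap n s -
               m * s * (of_nat n powr (1 - s) - of_nat (Suc n) powr (1 - s)))
         \<le> C * norm s * norm (s - 1) * real n powr (- Re s - 1)"
proof -
  let ?I = "{real n..real (Suc n)}"
  have C0: "C \<ge> 0" by (rule order_trans[OF norm_ge_zero C[of "real n"]]) simp
  have 1: "((\<lambda>x. s * of_real x powr (- s - 1)) has_integral powr_gap n s) ?I"
    using has_integral_powr_complex[of "real n" "real (Suc n)" s] n by simp
  have 2: "((\<lambda>x. (s - 1) * of_real x powr (- (s - 1) - 1)) has_integral (of_nat n powr (- (s - 1)) - of_nat (Suc n) powr (- (s - 1)))) ?I"
    using has_integral_powr_complex[of "real n" "real (Suc n)" "s - 1"] n by simp
  have 2: "((\<lambda>x. (s - 1) * of_real x powr (- s)) has_integral (of_nat n powr (1 - s) - of_nat (Suc n) powr (1 - s))) ?I"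
    using 2 by simp
  have I: "((\<lambda>x. (s - 1) * S * (s * of_real x powr (- s - 1)) - m * s * ((s - 1) * of_real x powr (- s))) has_integral
     ((s - 1) * S * powr_gap n s -
               m * s * (of_nat n powr (1 - s) - of_nat (Suc n) powr (1 - s)))) ?I"
    by (intro has_integral_diff has_integral_mult_right 1 2)
  have "norm ((s - 1) * S * powr_gap n s -
               m * s * (of_nat n powr (1 - s) - of_nat (Suc n) powr (1 - s)))
     \<le> (C * norm s * norm (s - 1) * real n powr (- Re s - 1)) * measure lborel (cbox (real n) (real (Suc n)))"
  proof (rule has_integral_bound)
    show "((\<lambda>x. (s - 1) * S * (s * of_real x powr (- s - 1)) - m * s * ((s - 1) * of_real x powr (- s))) has_integral
     ((s - 1) * S * powr_gap n s -
               m * s * (of_nat n powr (1 - s) - of_nat (Suc n) powr (1 - s)))) (cbox (real n) (real (Suc n)))"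
      using I by simp
    show "0 \<le> C * norm s * norm (s - 1) * real n powr (- Re s - 1)" using C0 by simp
    fix x assume "x \<in> cbox (real n) (real (Suc n))"
    then have x: "x \<in> ?I" "x > 0" "x \<ge> real n" using n by auto
    have "complex_of_real x powr (- s) = of_real x * of_real x powr (- s - 1)"
      using x by (simp add: powr_diff)
    then have eq: "(s - 1) * S * (s * of_real x powr (- s - 1)) - m * s * ((s - 1) * of_real x powr (- s)) =
        s * (s - 1) * (S - m * of_real x) * of_real x powr (- s - 1)"
      by (simp add: algebra_simps)
    have "norm \<dots> = norm s * norm (s - 1) * norm (S - m * of_real x) * x powr (- Re s - 1)"
      using x norm_powr_real_powr[of "of_real x" "- s - 1"] by (simp add: norm_mult)
    also have "\<dots> \<le> norm s * norm (s - 1) * C * real n powr (- Re s - 1)"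
      using C[OF x(1)] x n s C0 by (intro mult_mono powr_mono2') auto
    finally show "norm ((s - 1) * S * (s * of_real x powr (- s - 1)) - m * s * ((s - 1) * of_real x powr (- s)))
      \<le> C * norm s * norm (s - 1) * real n powr (- Re s - 1)"
      unfolding eq by (simp add: mult_ac)
  qed
  then show ?thesis by simp
qed

text \<open>The partial sums are m n + O(1). The main part telescopes to m s / (s - 1), and the
  remainder converges for Re s > 0. D is the series with its pole at 1 multiplied away, so D 1 is
  the residue.\<close>

lemma dirichlet_series_continuation:
  fixes f :: "nat \<Rightarrow> complex"
  assumes C: "\<And>n. norm ((\<Sum>k=1..n. f k) - of_nat n * m) \<le> C" and m: "norm m \<le> 1" and f: "\<And>n. norm (f n) \<le> 1"
  obtains D where "D holomorphic_on {s. Re s > 0}" "D 1 = m"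
    "\<And>s. Re s > 1 \<Longrightarrow> (\<lambda>n. f n * of_nat n powr (- s)) sums (D s / (s - 1))"
proof -
  define S where "S = (\<lambda>n. \<Sum>k=1..n. f k)"
  define T where "T = (\<lambda>n s. if n = 0 then 0 else (s - 1) * S n * powr_gap n s -
               m * s * (of_nat n powr (1 - s) - of_nat (Suc n) powr (1 - s)))"
  have C0: "C \<ge> 0" using order_trans[OF norm_ge_zero C] .
  have "norm (S n) \<le> (\<Sum>k=1..n. 1)" for n unfolding S_def by (rule sum_norm_le) (use f in auto)
  then have SB: "norm (S n) \<le> 1 * real n" for n by simp
  have hol: "T n holomorphic_on {s. Re s > 0}" for n
    unfolding T_def by (cases "n = 0") (auto intro!: holomorphic_intros)
  have bound: "norm (T n s) \<le> (C + 1) * (1 + norm s)\<^sup>2 * real n powr (- Re s - 1)" if s: "Re s > 0" for n s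
  proof (cases "n = 0")
    case False
    have "norm (S n - m * of_real x) \<le> C + 1" if "x \<in> {real n..real (Suc n)}" for x
    proof -
      have "norm (m * (of_nat n - of_real x)) = norm m * \<bar>real n - x\<bar>"
        using norm_of_real[of "real n - x", where 'a = complex] by (simp add: norm_mult del: norm_of_real)
      also have "\<dots> \<le> 1 * 1" using m that by (intro mult_mono) auto
      finally have "norm (m * (of_nat n - of_real x)) \<le> 1" by simp
      moreover have eq: "S n - m * of_real x = (S n - of_nat n * m) + m * (of_nat n - of_real x)"
        by (simp add: algebra_simps)
      moreover have "norm (S n - of_nat n * m) \<le> C" using C[of n] by (simp add: S_def)
      ultimately show ?thesis
        using norm_triangle_ineq[of "S n - of_nat n * m" "m * (of_nat n - of_real x)"]
        unfolding eq by linarith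
    qed
    from powr_block_bound[OF _ s this] False
    have "norm (T n s) \<le> (C + 1) * norm s * norm (s - 1) * real n powr (- Re s - 1)" by (simp add: T_def)
    also have "\<dots> \<le> (C + 1) * (1 + norm s) * (1 + norm s) * real n powr (- Re s - 1)"
      using C0 norm_triangle_ineq4[of s 1] by (intro mult_mono) auto
    finally show ?thesis by (simp add: power2_eq_square mult_ac)
  qed (simp add: T_def)
  obtain F where F: "F holomorphic_on {s. Re s > 0}" "\<And>s. Re s > 0 \<Longrightarrow> (\<lambda>n. T n s) sums F s"
    using holomorphic_series_half_plane[OF hol _ bound] C0 by auto
  have T1: "T n 1 = 0" for n by (simp add: T_def del: of_nat_Suc)
  have "F 1 = 0" using F(2)[of 1] by (simp add: T1 sums_unique2)
  show ?thesis
  proof (rule that[of "\<lambda>s. m * s + F s"])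
    show "(\<lambda>s. m * s + F s) holomorphic_on {s. Re s > 0}" by (intro holomorphic_intros F)
    show "m * 1 + F 1 = m" using \<open>F 1 = 0\<close> by simp
    fix s :: complex assume s: "Re s > 1"
    have "(\<lambda>n. of_nat n powr (1 - s)) \<longlonglongrightarrow> 0"
    proof (rule Lim_null_comparison)
      show "\<forall>\<^sub>F n in sequentially. norm (of_nat n powr (1 - s)) \<le> real n powr (1 - Re s)"
        using eventually_gt_at_top[of 0]
        by eventually_elim (use norm_powr_real_powr[of "of_nat _" "1 - s"] in auto)
      show "(\<lambda>n. real n powr (1 - Re s)) \<longlonglongrightarrow> 0" using s by real_asymp
    qed
    from telescope_sums'[OF this]
    have tel: "(\<lambda>n. of_nat n powr (1 - s) - of_nat (Suc n) powr (1 - s)) sums 0" by simp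
    \<comment> \<open>The telescoping series starts at n = 0, where 0 powr (1 - s) = 0, and sums to
      0; its term at 0 is -1, while \<open>T 0\<close> was set to 0. The summand m * s at n = 0
      compensates.\<close>
    have "(\<lambda>n. T n s + m * s * (of_nat n powr (1 - s) - of_nat (Suc n) powr (1 - s)) + (if n = 0 then m * s else 0))
        sums (F s + m * s * 0 + m * s)"
      by (intro sums_add sums_mult tel F(2) sums_If_finite_set[of "{0}" "\<lambda>_. m * s", simplified] ) (use s in auto)
    moreover have "T n s + m * s * (of_nat n powr (1 - s) - of_nat (Suc n) powr (1 - s)) + (if n = 0 then m * s else 0) =
        (s - 1) * (S n * powr_gap n s)" for n
      by (simp add: T_def S_def algebra_simps)
    ultimately have "(\<lambda>n. (s - 1) * (S n * powr_gap n s)) sums (m * s + F s)"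
      by (simp add: add.commute)
    then have "(\<lambda>n. (s - 1) * (S n * powr_gap n s) / (s - 1)) sums ((m * s + F s) / (s - 1))"
      by (rule sums_divide)
    moreover have "s \<noteq> 1" using s by auto
    ultimately have "(\<lambda>n. S n * powr_gap n s) sums ((m * s + F s) / (s - 1))"
      by simp
    then show "(\<lambda>n. f n * of_nat n powr (- s)) sums ((m * s + F s) / (s - 1))"
      using abel_summation_sums_iff[OF SB[unfolded S_def] s] by (simp add: S_def)
  qed
qed

text \<open>The pole-free case is kept apart because Monsky's argument needs the value at s = 1 in
  the form of the series after summation by parts.\<close>

lemma dirichlet_series_continuation_bounded:
  fixes f :: "nat \<Rightarrow> complex"
  assumes C: "\<And>n. norm (\<Sum>k=1..n. f k) \<le> C" and f: "\<And>n. norm (f n) \<le> 1"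
  obtains L where "L holomorphic_on {s. Re s > 0}"
    "\<And>s. Re s > 0 \<Longrightarrow> (\<lambda>n. (\<Sum>k=1..n. f k) * powr_gap n s) sums L s"
    "\<And>s. Re s > 1 \<Longrightarrow> (\<lambda>n. f n * of_nat n powr (- s)) sums L s"
proof -
  define S where "S = (\<lambda>n. \<Sum>k=1..n. f k)"
  define T where "T = (\<lambda>n s. S n * powr_gap n s)"
  have C0: "C \<ge> 0" using order_trans[OF norm_ge_zero C] .
  have "norm (S n) \<le> (\<Sum>k=1..n. 1)" for n unfolding S_def by (rule sum_norm_le) (use f in auto)
  then have SB: "norm (S n) \<le> 1 * real n" for n by simp
  have hol: "T n holomorphic_on {s. Re s > 0}" for n
    unfolding T_def by (cases "n = 0") (auto intro!: holomorphic_intros simp: S_def)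
  have bound: "norm (T n s) \<le> C * (1 + norm s)\<^sup>2 * real n powr (- Re s - 1)" if s: "Re s > 0" for n s
  proof (cases "n = 0")
    case False
    have 1: "((\<lambda>x. s * of_real x powr (- s - 1)) has_integral powr_gap n s) (cbox (real n) (real (Suc n)))"
      using has_integral_powr_complex[of "real n" "real (Suc n)" s] False by simp
    have "norm (powr_gap n s) \<le> (norm s * real n powr (- Re s - 1)) * measure lborel (cbox (real n) (real (Suc n)))"
    proof (rule has_integral_bound[OF _ 1])
      fix x assume x: "x \<in> cbox (real n) (real (Suc n))"
      have "norm (s * of_real x powr (- s - 1)) = norm s * x powr (- Re s - 1)"
        using x False norm_powr_real_powr[of "of_real x" "- s - 1"] by (simp add: norm_mult)
      also have "\<dots> \<le> norm s * real n powr (- Re s - 1)"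
        using x s False by (intro mult_left_mono powr_mono2') auto
      finally show "norm (s * of_real x powr (- s - 1)) \<le> norm s * real n powr (- Re s - 1)" .
    qed auto
    then have "norm (T n s) \<le> C * (norm s * real n powr (- Re s - 1))"
      unfolding T_def norm_mult using C[of n] C0 by (intro mult_mono) (auto simp: S_def)
    also have "\<dots> \<le> C * ((1 + norm s)\<^sup>2 * real n powr (- Re s - 1))"
      using C0 by (intro mult_left_mono mult_right_mono) (auto simp: power2_eq_square algebra_simps)
    finally show ?thesis by (simp add: mult_ac)
  qed (simp add: T_def S_def)
  obtain F where F: "F holomorphic_on {s. Re s > 0}" "\<And>s. Re s > 0 \<Longrightarrow> (\<lambda>n. T n s) sums F s"
    using holomorphic_series_half_plane[OF hol C0 bound] by auto
  show ?thesis
  proof (rule that[OF F(1)])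
    fix s :: complex
    show "(\<lambda>n. (\<Sum>k=1..n. f k) * powr_gap n s) sums F s" if "Re s > 0"
      using F(2)[OF that] by (simp add: T_def S_def)
    then show "(\<lambda>n. f n * of_nat n powr (- s)) sums F s" if "Re s > 1"
      using abel_summation_sums_iff[OF SB[unfolded S_def] that] that by simp
  qed
qed

lemma dirichlet_series_deriv:
  fixes f :: "nat \<Rightarrow> complex"
  assumes f: "\<And>n. norm (f n) \<le> 1"
  obtains g g' where "\<And>s. Re s > 1 \<Longrightarrow> (\<lambda>n. f n * of_nat n powr (- s)) sums g s"
    "\<And>s. Re s > 1 \<Longrightarrow> (\<lambda>n. - (f n * of_real (ln (real n)) * of_nat n powr (- s))) sums g' s"
    "\<And>s. Re s > 1 \<Longrightarrow> (g has_field_derivative g' s) (at s)"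
proof -
  let ?H = "{s::complex. Re s > 1}"
  have op: "open ?H" by (rule open_halfspace_Re_gt)
  have "\<exists>g g'. \<forall>x\<in>?H. (\<lambda>n. f n * of_nat n powr (- x)) sums g x \<and>
     (\<lambda>n. - (f n * of_real (ln (real n)) * of_nat n powr (- x))) sums g' x \<and> (g has_field_derivative g' x) (at x)"
  proof (rule series_and_derivative_comparison_complex[OF op])
    fix n and x :: complex assume x: "x \<in> ?H"
    show "((\<lambda>x. f n * of_nat n powr (- x)) has_field_derivative - (f n * of_real (ln (real n)) * of_nat n powr (- x))) (at x)"
      by (cases "n = 0") (auto intro!: derivative_eq_intros simp: powr_def Ln_of_nat)
  next
    fix x :: complex assume x: "x \<in> ?H"
    show "\<exists>d h. 0 < d \<and> summable h \<and> range h \<subseteq> \<real>\<^sub>\<ge>\<^sub>0 \<and> (\<forall>\<^sub>F n in sequentially. \<forall>y\<in>ball x d \<inter> ?H. cmod (f n * of_nat n powr (- y)) \<le> cmod (h n))"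
    proof (intro exI conjI)
      let ?d = "(Re x - 1) / 2"
      show "0 < ?d" using x by simp
      let ?h = "\<lambda>n. complex_of_real (real n powr (- (1 + ?d)))"
      have "summable (\<lambda>n. real n powr (- (1 + ?d)))"
        using x by (simp add: summable_real_powr_iff)
      then show "summable ?h" by (rule summable_of_real)
      show "range ?h \<subseteq> \<real>\<^sub>\<ge>\<^sub>0" by (auto simp: nonneg_Reals_of_real_iff)
      show "\<forall>\<^sub>F n in sequentially. \<forall>y\<in>ball x ?d \<inter> ?H. cmod (f n * of_nat n powr (- y)) \<le> cmod (?h n)"
        using eventually_gt_at_top[of 0]
      proof (eventually_elim, intro ballI)
        fix n :: nat and y assume n: "n > 0" and y: "y \<in> ball x ?d \<inter> ?H"
        have "Re (x - y) < ?d" using y complex_Re_le_cmod[of "x - y"] by (simp add: dist_norm)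
        then have Re: "Re y \<ge> 1 + ?d" by (simp add: field_simps)
        have "norm (f n * of_nat n powr (- y)) = norm (f n) * real n powr (- Re y)"
          using n norm_powr_real_powr[of "of_nat n" "- y"] by (simp add: norm_mult)
        also have "\<dots> \<le> 1 * real n powr (- (1 + ?d))"
          using f[of n] n Re by (intro mult_mono powr_mono) auto
        finally show "norm (f n * of_nat n powr (- y)) \<le> norm (?h n)" by simp
      qed
    qed
  qed
  then show ?thesis using that by blast
qed

section \<open>Logarithmic derivatives\<close>

lemma has_sum_divisor_regroup:
  fixes F :: "nat \<times> nat \<Rightarrow> 'a::banach"
  assumes "(F has_sum X) ({1..} \<times> {1..})"
  shows "((\<lambda>n. \<Sum>d | d dvd n. F (d, n div d)) has_sum X) {1..}"
proof -
  have "(F has_sum X) ({1..} \<times> {1..}) \<longleftrightarrow> ((\<lambda>(n, d). F (d, n div d)) has_sum X) (Sigma {1..} (\<lambda>n. {d. d dvd n}))"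
    by (rule has_sum_reindex_bij_witness[of _ "\<lambda>(n, d). (d, n div d)" "\<lambda>(d, m). (d * m, d)"])
       (auto simp: Suc_le_eq elim!: dvdE)
  with assms have "((\<lambda>(n, d). F (d, n div d)) has_sum X) (Sigma {1..} (\<lambda>n. {d. d dvd n}))" by simp
  then show ?thesis
    by (rule has_sum_SigmaD) (auto intro!: has_sum_finite)
qed

lemma sums_iff_has_sum_from_1:
  fixes f :: "nat \<Rightarrow> 'a::banach"
  assumes "f 0 = 0" "(f has_sum X) {1..}"
  shows "f sums X"
proof -
  have "(f has_sum X) UNIV \<longleftrightarrow> (f has_sum X) {1..}"
    by (rule has_sum_cong_neutral) (use assms in \<open>auto simp: not_le\<close>)
  then show ?thesis using assms has_sum_imp_sums by blast
qed

lemma dirichlet_product_sums: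
  fixes a b :: "nat \<Rightarrow> complex"
  assumes a: "summable (\<lambda>n. norm (a n))" "a sums A" and b: "summable (\<lambda>n. norm (b n))" "b sums B"
    and zero: "a 0 = 0" "b 0 = 0"
  shows "(\<lambda>n. \<Sum>d | d dvd n. a d * b (n div d)) sums (A * B)"
proof -
  have na: "((\<lambda>n. norm (a n)) has_sum (\<Sum>n. norm (a n))) UNIV"
    by (rule norm_summable_imp_has_sum) (use a in \<open>auto simp: summable_sums\<close>)
  have nb: "((\<lambda>n. norm (b n)) has_sum (\<Sum>n. norm (b n))) UNIV"
    by (rule norm_summable_imp_has_sum) (use b in \<open>auto simp: summable_sums\<close>)
  have "(\<lambda>(x, y). norm (a x) * norm (b y)) summable_on (UNIV \<times> UNIV)"
  proof (rule summable_on_SigmaI)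
    show "((\<lambda>y. case (x, y) of (x, y) \<Rightarrow> norm (a x) * norm (b y)) has_sum norm (a x) * (\<Sum>n. norm (b n))) UNIV" for x
      using has_sum_cmult_right[OF nb, of "norm (a x)"] by simp
    show "(\<lambda>x. norm (a x) * (\<Sum>n. norm (b n))) summable_on UNIV"
      using has_sum_cmult_left[OF na] by (auto simp: summable_on_def)
  qed auto
  then have sm: "(\<lambda>(x, y). a x * b y) summable_on (UNIV \<times> UNIV)"
    by (intro Infinite_Sum.abs_summable_summable[where f = "\<lambda>(x, y). a x * b y"]) (simp add: case_prod_unfold norm_mult)
  have "((\<lambda>(x, y). a x * b y) has_sum A * B) (UNIV \<times> UNIV)"
  proof (rule has_sum_SigmaI[OF _ _ sm])
    show "((\<lambda>y. case (x, y) of (x, y) \<Rightarrow> a x * b y) has_sum a x * B) UNIV" for x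
      using has_sum_cmult_right[OF norm_summable_imp_has_sum[OF b], of "a x"] by simp
    show "((\<lambda>x. a x * B) has_sum A * B) UNIV"
      using has_sum_cmult_left[OF norm_summable_imp_has_sum[OF a], of B] .
  qed
  also have "((\<lambda>(x, y). a x * b y) has_sum A * B) (UNIV \<times> UNIV) \<longleftrightarrow> ((\<lambda>(x, y). a x * b y) has_sum A * B) ({1..} \<times> {1..})"
    by (rule has_sum_cong_neutral) (use zero in \<open>auto simp: Suc_le_eq intro!: Nat.gr0I\<close>)
  finally have "((\<lambda>n. \<Sum>d | d dvd n. case (d, n div d) of (x, y) \<Rightarrow> a x * b y) has_sum A * B) {1..}"
    by (rule has_sum_divisor_regroup)
  then show ?thesis
    by (intro sums_iff_has_sum_from_1) (auto simp: zero intro: sum.infinite)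
qed

text \<open>The limit is the order of the zero, read off from the factorization (w - s0)^n g.
  Nonconstancy is asked for only at a zero, where it excludes the zero function.\<close>

lemma zero_order_limit:
  assumes E: "E holomorphic_on S" "open S" "connected S" "E s0 = 0 \<Longrightarrow> \<not> E constant_on S" and s0: "s0 \<in> S"
  obtains n :: nat where "((\<lambda>s. (s - s0) * (deriv E s / E s)) \<longlongrightarrow> of_nat n) (at s0)" "n = 0 \<longleftrightarrow> E s0 \<noteq> 0"
proof (cases "E s0 = 0")
  case True
  from holomorphic_factor_zero_nonconstant[OF E(1,2,3) s0 True E(4)[OF True]]
  obtain g r n where n: "0 < n" "0 < r" "ball s0 r \<subseteq> S" and g: "g holomorphic_on ball s0 r"
    and Eg: "\<And>w. w \<in> ball s0 r \<Longrightarrow> E w = (w - s0) ^ n * g w" and g0: "\<And>w. w \<in> ball s0 r \<Longrightarrow> g w \<noteq> 0" by metis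
  have dE: "deriv E w = of_nat n * (w - s0) ^ (n - 1) * g w + (w - s0) ^ n * deriv g w" if w: "w \<in> ball s0 r" for w
  proof (rule DERIV_imp_deriv)
    have "((\<lambda>w. (w - s0) ^ n * g w) has_field_derivative of_nat n * (w - s0) ^ (n - 1) * g w + (w - s0) ^ n * deriv g w) (at w)"
      by (auto intro!: derivative_eq_intros holomorphic_derivI[OF g _ w])
    then show "(E has_field_derivative of_nat n * (w - s0) ^ (n - 1) * g w + (w - s0) ^ n * deriv g w) (at w)"
      by (rule has_field_derivative_transform_within_open[OF _ _ w]) (use Eg in auto)
  qed
  have cont: "isCont (deriv g) s0" "isCont g s0"
    using holomorphic_deriv[OF g] g n(2) by (auto simp: holomorphic_on_imp_continuous_on continuous_on_interior dest!: holomorphic_on_imp_continuous_on)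
  have s0': "g s0 \<noteq> 0" using g0 n by simp
  have "((\<lambda>w. of_nat n + (w - s0) * (deriv g w / g w)) \<longlongrightarrow> of_nat n + (s0 - s0) * (deriv g s0 / g s0)) (at s0)"
    by (intro tendsto_intros isContD cont s0')
  then have lim: "((\<lambda>w. of_nat n + (w - s0) * (deriv g w / g w)) \<longlongrightarrow> of_nat n) (at s0)" by simp
  have "\<forall>\<^sub>F w in at s0. of_nat n + (w - s0) * (deriv g w / g w) = (w - s0) * (deriv E w / E w)"
    unfolding eventually_at_topological
  proof (intro exI[of _ "ball s0 r"] conjI ballI impI)
    fix w assume w: "w \<in> ball s0 r" "w \<noteq> s0"
    have alg: "N + v * (H' / H) = v * ((N * P * H + v * P * H') / (v * P * H))"
      if "v \<noteq> 0" "P \<noteq> 0" "H \<noteq> 0" for N v P H H' :: complex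
      using that by (simp add: field_simps)
    have pow: "(w - s0) ^ n = (w - s0) * (w - s0) ^ (n - 1)" using n(1) by (cases n) auto
    show "of_nat n + (w - s0) * (deriv g w / g w) = (w - s0) * (deriv E w / E w)"
      unfolding dE[OF w(1)] Eg[OF w(1)] pow by (rule alg) (use w g0[OF w(1)] in auto)
  qed (use n in auto)
  from Lim_transform_eventually[OF lim this] show ?thesis using that[of n] n(1) True by simp
next
  case False
  have "isCont (deriv E) s0" "isCont E s0"
    using holomorphic_deriv[OF E(1,2)] E(1,2) s0 by (metis continuous_on_eq_continuous_at holomorphic_on_imp_continuous_on)+
  then have "((\<lambda>s. (s - s0) * (deriv E s / E s)) \<longlongrightarrow> (s0 - s0) * (deriv E s0 / E s0)) (at s0)"
    by (intro tendsto_intros isContD False)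
  then show ?thesis using that[of 0] False by simp
qed

text \<open>
  \<open>E\<close> continues \<open>(s - 1)\<^sup>\<delta> L(s, chi)\<close> to the right half-plane, where \<open>\<delta>\<close> is the order of the pole at 1,
  so the principal and the nonprincipal characters are treated alike.
\<close>
definition L_continuation :: "(nat \<Rightarrow> complex) \<Rightarrow> nat \<Rightarrow> (complex \<Rightarrow> complex) \<Rightarrow> bool" where
  "L_continuation chi \<delta> E \<longleftrightarrow> E holomorphic_on {s. Re s > 0} \<and>
     (\<forall>s. Re s > 1 \<longrightarrow> (\<lambda>n. chi n * of_nat n powr (- s)) sums (E s / (s - 1) ^ \<delta>)) \<and> (\<delta> = 0 \<or> E 1 \<noteq> 0)"

lemma L_continuation_holomorphic: "L_continuation chi \<delta> E \<Longrightarrow> E holomorphic_on {s. Re s > 0}"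
  and L_continuation_sums: "L_continuation chi \<delta> E \<Longrightarrow> Re s > 1 \<Longrightarrow>
     (\<lambda>n. chi n * of_nat n powr (- s)) sums (E s / (s - 1) ^ \<delta>)"
  and L_continuation_at_1: "L_continuation chi \<delta> E \<Longrightarrow> \<delta> > 0 \<Longrightarrow> E 1 \<noteq> 0"
  unfolding L_continuation_def by blast+

text \<open>From ln n <= n^e / e with e = (c - 1) / 2 the exponent e - c is still below -1. The
  bound K is uniform on the half-plane, and this boundedness is what excludes zeros of L
  there.\<close>

lemma summable_mangoldt_series:
  fixes chi :: "nat \<Rightarrow> complex"
  assumes "\<And>n. norm (chi n) \<le> 1" "c > 1"
  shows "\<exists>K. \<forall>s. Re s \<ge> c \<longrightarrow> summable (\<lambda>n. norm (chi n * mangoldt n * of_nat n powr (- s))) \<and>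
    norm (\<Sum>n. chi n * mangoldt n * of_nat n powr (- s)) \<le> K"
proof -
  define e where "e = (c - 1) / 2"
  have e: "e > 0" using assms by (simp add: e_def)
  define h where "h = (\<lambda>n. 1 / e * real n powr (e - c))"
  have h: "summable h"
    unfolding h_def using e by (intro summable_mult) (simp add: summable_real_powr_iff e_def field_simps)
  have bound: "norm (chi n * mangoldt n * of_nat n powr (- s)) \<le> h n" if s: "Re s \<ge> c" for s n
  proof (cases "n = 0")
    case False
    have "norm (chi n * mangoldt n * of_nat n powr (- s)) = norm (chi n) * mangoldt n * real n powr (- Re s)"
      using False norm_powr_real_powr[of "of_nat n" "- s"] by (simp add: norm_mult)
    also have "\<dots> \<le> 1 * (real n powr e / e) * real n powr (- c)"
    proof (intro mult_mono)
      show "mangoldt n \<le> real n powr e / e"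
        using mangoldt_le[of n] ln_powr_bound[of "real n" e] False e by simp
    qed (use assms(1) s False e in \<open>auto intro: powr_mono mangoldt_nonneg\<close>)
    also have "\<dots> = h n" using False by (simp add: h_def powr_diff powr_minus field_simps)
    finally show ?thesis .
  qed (simp add: h_def)
  show ?thesis
  proof (intro exI[of _ "suminf h"] allI impI conjI)
    fix s :: complex assume s: "Re s \<ge> c"
    show sm: "summable (\<lambda>n. norm (chi n * mangoldt n * of_nat n powr (- s)))"
      by (rule summable_comparison_test'[OF h]) (use bound[OF s] in auto)
    have "norm (\<Sum>n. chi n * mangoldt n * of_nat n powr (- s)) \<le> (\<Sum>n. norm (chi n * mangoldt n * of_nat n powr (- s)))"
      by (rule summable_norm[OF sm])
    also have "\<dots> \<le> suminf h" by (rule suminf_le[OF bound[OF s] sm h])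
    finally show "norm (\<Sum>n. chi n * mangoldt n * of_nat n powr (- s)) \<le> suminf h" .
  qed
qed

text \<open>For n >= 2 one has n^(-3) <= 1 / (2 (n - 1) n), which telescopes to 1/2, too little to
  cancel the leading 1. One such point shows that a continuation does not vanish
  identically.\<close>

lemma dirichlet_series_nonzero_at_3:
  fixes a :: "nat \<Rightarrow> complex"
  assumes a: "a 1 = 1" "\<And>n. norm (a n) \<le> 1" and X: "(\<lambda>n. a n * of_nat n powr (- 3)) sums X"
  shows "X \<noteq> 0"
proof
  assume "X = 0"
  let ?f = "\<lambda>n. a n * of_nat n powr (- 3)"
  have "(\<lambda>n. ?f (n + 2)) sums (0 - (\<Sum>n<2. ?f n))"
    using sums_iff_shift[of ?f 2 "0 - (\<Sum>n<2. ?f n)"] X \<open>X = 0\<close> by simp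
  then have s: "(\<lambda>n. ?f (n + 2)) sums (- 1)" using a(1) by (simp add: numeral_2_eq_2)
  have "(\<lambda>n. 1 / 2 * (1 / real (n + 1) - 1 / real (Suc n + 1))) sums (1 / 2 * (1 / real (0 + 1) - 0))"
    by (intro sums_mult telescope_sums') real_asymp
  then have t: "(\<lambda>n. 1 / 2 * (1 / real (n + 1) - 1 / real (Suc n + 1))) sums (1 / 2)" by simp
  have b: "norm (?f (n + 2)) \<le> 1 / 2 * (1 / real (n + 1) - 1 / real (Suc n + 1))" for n
  proof -
    have "norm (?f (n + 2)) \<le> real (n + 2) powr (- 3)"
      using a(2)[of "n + 2"] norm_powr_real_powr[of "of_nat (n + 2)" "- 3"]
      by (simp add: norm_mult mult_left_le_one_le)
    also have "\<dots> = 1 / real (n + 2) ^ 3" by (simp add: powr_minus powr_numeral field_simps)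
    also have "\<dots> \<le> 1 / (2 * (real (n + 1) * real (n + 2)))"
    proof (intro divide_left_mono)
      have "2 * (real (n + 1) * real (n + 2)) \<le> real (n + 2) * (real (n + 2) * real (n + 2))"
        by (simp add: algebra_simps)
      then show "2 * (real (n + 1) * real (n + 2)) \<le> real (n + 2) ^ 3" by (simp add: power3_eq_cube mult.assoc)
    qed auto
    also have "\<dots> = 1 / 2 * (1 / real (n + 1) - 1 / real (Suc n + 1))" by (simp add: field_simps)
    finally show ?thesis .
  qed
  have "norm (\<Sum>n. ?f (n + 2)) \<le> (\<Sum>n. 1 / 2 * (1 / real (n + 1) - 1 / real (Suc n + 1)))"
    by (rule norm_suminf_le[OF b sums_summable[OF t]])
  then show False unfolding sums_unique[OF s, symmetric] sums_unique[OF t, symmetric] by simp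
qed

lemma open_connected_Re_gt: "open {s. Re s > c}" "connected {s. Re s > c}"
  by (simp_all add: open_halfspace_Re_gt convex_connected convex_halfspace_Re_gt)

lemma L_continuation_nonconstant:
  assumes chi: "chi 1 = 1" "\<And>n. norm (chi n) \<le> 1" and E: "L_continuation chi \<delta> E"
    and s: "Re s0 > c" "E s0 = 0" "0 \<le> c" "c \<le> 1"
  shows "\<not> E constant_on {s. Re s > c}"
proof
  assume "E constant_on {s. Re s > c}"
  moreover have "s0 \<in> {s. Re s > c}" "3 \<in> {s. Re s > c}" using s by auto
  ultimately have "E 3 = 0" using s(2) unfolding constant_on_def by metis
  have "(\<lambda>n. chi n * of_nat n powr (- 3)) sums (E 3 / (3 - 1) ^ \<delta>)"
    by (rule L_continuation_sums[OF E]) simp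
  from dirichlet_series_nonzero_at_3[OF chi this] \<open>E 3 = 0\<close> show False by (simp only: div_0)
qed

text \<open>The convolution of \<open>mangoldt\<close> with 1 is ln, which gives L' = - G L without
  dividing by L. At a zero s the quotient E'/E would grow like n / (w - s), but \<open>G\<close> and
  the pole term stay bounded near s. Nonvanishing for Re s > 1 thus comes out of the same identity
  as the formula.\<close>

lemma L_log_derivative:
  assumes chi: "dchar W chi" and W: "W > 0" and E: "L_continuation chi \<delta> E" and s: "Re s > 1"
  shows "E s \<noteq> 0" "(\<lambda>n. chi n * mangoldt n * of_nat n powr (- s)) sums (of_nat \<delta> / (s - 1) - deriv E s / E s)"
proof -
  define G where "G = (\<lambda>s. \<Sum>n. chi n * mangoldt n * of_nat n powr (- s))"
  note le1 = norm_dchar_le[OF chi W]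
  have Gsum: "(\<lambda>n. chi n * mangoldt n * of_nat n powr (- s)) sums G s"
    "summable (\<lambda>n. norm (chi n * mangoldt n * of_nat n powr (- s)))" if s: "Re s > 1" for s
  proof -
    show *: "summable (\<lambda>n. norm (chi n * mangoldt n * of_nat n powr (- s)))"
      using summable_mangoldt_series[of chi, OF le1 s] by (elim exE allE[of _ s]) simp
    show "(\<lambda>n. chi n * mangoldt n * of_nat n powr (- s)) sums G s"
      unfolding G_def by (rule summable_sums[OF summable_norm_cancel[OF *]])
  qed
  note Ehol = L_continuation_holomorphic[OF E] and EL = L_continuation_sums[OF E]
  obtain g g' where g: "\<And>s. Re s > 1 \<Longrightarrow> (\<lambda>n. chi n * of_nat n powr (- s)) sums g s"
    "\<And>s. Re s > 1 \<Longrightarrow> (\<lambda>n. - (chi n * of_real (ln (real n)) * of_nat n powr (- s))) sums g' s"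
    "\<And>s. Re s > 1 \<Longrightarrow> (g has_field_derivative g' s) (at s)"
    using dirichlet_series_deriv[of chi, OF le1] by blast
  have Eg: "E s = g s * (s - 1) ^ \<delta>" if s: "Re s > 1" for s
    using sums_unique2[OF g(1)[OF s] EL[OF s]] s by auto
  have Gg: "G s * g s = - g' s" if s: "Re s > 1" for s
  proof -
    have "summable (\<lambda>n. norm (chi n * of_nat n powr (- s)))"
    proof (rule summable_comparison_test')
      show "summable (\<lambda>n. real n powr (- Re s))" using s by (simp add: summable_real_powr_iff)
      show "norm (norm (chi n * of_nat n powr (- s))) \<le> real n powr (- Re s)" for n
        using le1[of n] norm_powr_real_powr[of "of_nat n" "- s"] by (cases "n = 0") (auto simp: norm_mult mult_left_le_one_le)
    qed
    from dirichlet_product_sums[OF Gsum(2,1)[OF s] this g(1)[OF s]]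
    have "(\<lambda>n. \<Sum>d | d dvd n. chi d * mangoldt d * of_nat d powr (- s) * (chi (n div d) * of_nat (n div d) powr (- s))) sums (G s * g s)"
      by simp
    moreover have "(\<Sum>d | d dvd n. chi d * mangoldt d * of_nat d powr (- s) * (chi (n div d) * of_nat (n div d) powr (- s))) =
      chi n * of_real (ln (real n)) * of_nat n powr (- s)" for n
    proof (cases "n = 0")
      case False
      have "(\<Sum>d | d dvd n. chi d * mangoldt d * of_nat d powr (- s) * (chi (n div d) * of_nat (n div d) powr (- s))) =
         (\<Sum>d | d dvd n. chi n * of_nat n powr (- s) * mangoldt d)"
      proof (rule sum.cong)
        fix d assume "d \<in> {d. d dvd n}"
        then obtain m where m: "n = d * m" by auto
        then have "d > 0" "m > 0" using False by auto
        then have "of_nat n powr (- s) = (of_nat d powr (- s) * of_nat m powr (- s) :: complex)"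
          using m powr_times_real[of "of_nat d" "of_nat m" "- s"] by simp
        then show "chi d * mangoldt d * of_nat d powr (- s) * (chi (n div d) * of_nat (n div d) powr (- s)) =
           chi n * of_nat n powr (- s) * mangoldt d"
          using m \<open>d > 0\<close> dchar_mult[OF chi, of d m] by simp
      qed simp
      also have "\<dots> = chi n * of_real (ln (real n)) * of_nat n powr (- s)"
        using mangoldt_sum[OF False, where 'a = complex] by (simp add: sum_distrib_left[symmetric])
      finally show ?thesis .
    qed (simp add: sum.infinite)
    ultimately have "(\<lambda>n. chi n * of_real (ln (real n)) * of_nat n powr (- s)) sums (G s * g s)" by simp
    from sums_unique2[OF g(2)[OF s] sums_minus[OF this]] show ?thesis by simp
  qed
  have dE: "deriv E s = E s * (of_nat \<delta> / (s - 1) - G s)" if s: "Re s > 1" for s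
  proof (rule DERIV_imp_deriv)
    have s1: "s \<noteq> 1" using s by auto
    have D: "((\<lambda>s. g s * (s - 1) ^ \<delta>) has_field_derivative (g' s * (s - 1) ^ \<delta> + of_nat \<delta> * (s - 1) ^ (\<delta> - 1) * g s)) (at s)"
      by (auto intro!: derivative_eq_intros g(3)[OF s])
    have pow: "of_nat \<delta> * (s - 1) ^ (\<delta> - 1) = of_nat \<delta> * (s - 1) ^ \<delta> / (s - 1)"
      using s1 by (cases \<delta>) auto
    have g's: "g' s = - (G s * g s)" using Gg[OF s] by simp
    have eq: "g' s * (s - 1) ^ \<delta> + of_nat \<delta> * (s - 1) ^ (\<delta> - 1) * g s = E s * (of_nat \<delta> / (s - 1) - G s)"
      unfolding pow g's Eg[OF s] by (simp add: algebra_simps)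
    have "((\<lambda>s. g s * (s - 1) ^ \<delta>) has_field_derivative E s * (of_nat \<delta> / (s - 1) - G s)) (at s)"
      by (rule DERIV_cong[OF D eq])
    then show "(E has_field_derivative E s * (of_nat \<delta> / (s - 1) - G s)) (at s)"
      by (rule has_field_derivative_transform_within_open[OF _ open_connected_Re_gt(1)[of 1]]) (use s Eg in auto)
  qed
  show nz: "E s \<noteq> 0"
  proof
    assume E0: "E s = 0"
    have "\<not> E constant_on {s. Re s > 1}"
      by (rule L_continuation_nonconstant[of chi, OF dchar_1[OF chi] le1 E s E0]) auto
    moreover have "E holomorphic_on {s. Re s > 1}" by (rule holomorphic_on_subset[OF Ehol]) auto
    ultimately obtain n :: nat where n: "((\<lambda>w. (w - s) * (deriv E w / E w)) \<longlongrightarrow> of_nat n) (at s)" "n = 0 \<longleftrightarrow> E s \<noteq> 0"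
      using zero_order_limit[OF _ open_connected_Re_gt, of E 1 s thesis] s by simp
    define c where "c = (1 + Re s) / 2"
    have c: "c > 1" "c < Re s" using s by (auto simp: c_def)
    obtain K where K: "\<forall>s. Re s \<ge> c \<longrightarrow> summable (\<lambda>n. norm (chi n * mangoldt n * of_nat n powr (- s))) \<and> norm (G s) \<le> K"
      using summable_mangoldt_series[of chi, OF le1 c(1)] unfolding G_def by (elim exE)
    have "((\<lambda>w. (w - s) * (deriv E w / E w)) \<longlongrightarrow> 0) (at s)"
    proof (rule Lim_null_comparison)
      have "\<forall>\<^sub>F w in at s. w \<in> {w. Re w > c}"
        using c by (intro eventually_at_in_open' open_connected_Re_gt) auto
      then show "\<forall>\<^sub>F w in at s. norm ((w - s) * (deriv E w / E w)) \<le> norm (w - s) * (of_nat \<delta> / (c - 1) + K)"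
      proof eventually_elim
        case (elim w)
        then have w: "Re w > c" by simp
        have "c - 1 \<le> norm (w - 1)" using w complex_Re_le_cmod[of "w - 1"] by simp
        then have "norm (of_nat \<delta> / (w - 1)) \<le> of_nat \<delta> / (c - 1)"
          using c unfolding norm_divide by (intro frac_le) auto
        then have "norm (of_nat \<delta> / (w - 1) - G w) \<le> of_nat \<delta> / (c - 1) + K"
          using K[rule_format, of w] w norm_triangle_ineq4[of "of_nat \<delta> / (w - 1)" "G w"] by simp
        \<comment> \<open>At a zero of E the quotient is 0 by the convention for division, so the
          bound holds there as well.\<close>
        moreover have "norm (deriv E w / E w) \<le> norm (of_nat \<delta> / (w - 1) - G w)"
          using dE[of w] w c by (cases "E w = 0") auto
        ultimately show ?case unfolding norm_mult by (intro mult_left_mono) auto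
      qed
      have "((\<lambda>w. norm (w - s) * (of_nat \<delta> / (c - 1) + K)) \<longlongrightarrow> norm (s - s) * (of_nat \<delta> / (c - 1) + K)) (at s)"
        by (intro tendsto_intros)
      then show "((\<lambda>w. norm (w - s) * (of_nat \<delta> / (c - 1) + K)) \<longlongrightarrow> 0) (at s)" by simp
    qed
    from tendsto_unique[OF _ n(1) this] n(2) E0 show False by simp
  qed
  show "(\<lambda>n. chi n * mangoldt n * of_nat n powr (- s)) sums (of_nat \<delta> / (s - 1) - deriv E s / E s)"
    using Gsum(1)[OF s] dE[OF s] nz by simp
qed

section \<open>Nonvanishing of real \<open>L\<close>-functions at 1\<close>

text \<open>The inequality of the means for the pairs i and n - 1 - i. The base is a square so that
  the geometric mean is an integral power of u.\<close>

lemma geometric_sum_ge_middle: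
  fixes u :: real
  assumes "0 \<le> u"
  shows "real n * u ^ (n - 1) \<le> (\<Sum>i<n. (u\<^sup>2) ^ i)"
proof -
  have "2 * (real n * u ^ (n - 1)) = (\<Sum>i<n. 2 * u ^ (n - 1))" by simp
  also have "\<dots> \<le> (\<Sum>i<n. (u\<^sup>2) ^ i + (u\<^sup>2) ^ (n - Suc i))"
  proof (rule sum_mono)
    fix i assume i: "i \<in> {..<n}"
    have "0 \<le> (u ^ i - u ^ (n - Suc i))\<^sup>2" by simp
    also have "\<dots> = (u\<^sup>2) ^ i + (u\<^sup>2) ^ (n - Suc i) - 2 * (u ^ i * u ^ (n - Suc i))"
      by (simp add: power2_diff power_mult[symmetric] mult.commute)
    also have "u ^ i * u ^ (n - Suc i) = u ^ (n - 1)" using i by (simp add: power_add[symmetric])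
    finally show "2 * u ^ (n - 1) \<le> (u\<^sup>2) ^ i + (u\<^sup>2) ^ (n - Suc i)" by simp
  qed
  also have "\<dots> = 2 * (\<Sum>i<n. (u\<^sup>2) ^ i)"
    using sum.nat_diff_reindex[of "\<lambda>i. (u\<^sup>2) ^ i" n] by (simp add: sum.distrib)
  finally show ?thesis by simp
qed

text \<open>With u = sqrt t the two geometric factors are at least n u^n and (n + 1) u^n, and their
  product cancels t^n exactly. This is the monotonicity of the sequence \<open>b\<close> in the
  argument for real characters.\<close>

lemma lambert_difference_bound:
  fixes t :: real
  assumes t: "0 < t" "t < 1" and n: "n \<ge> 1"
  shows "t ^ n / (1 - t ^ n) - t ^ Suc n / (1 - t ^ Suc n) \<le> (1 / real n - 1 / real (Suc n)) / (1 - t)"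
proof -
  define g where "g = (\<lambda>n. \<Sum>i<n. t ^ i)"
  have g: "1 - t ^ k = (1 - t) * g k" for k using one_diff_power_eq[of t k] by (simp add: g_def)
  define u where "u = sqrt t"
  have u: "0 < u" "u < 1" "u\<^sup>2 = t" using t by (auto simp: u_def)
  have g1: "real n * u ^ n \<le> g n"
  proof -
    have "real n * u ^ n \<le> real n * u ^ (n - 1)" using u by (intro mult_left_mono power_decreasing) auto
    also have "\<dots> \<le> g n" using geometric_sum_ge_middle[of u n] u by (simp add: g_def)
    finally show ?thesis .
  qed
  have g2: "real (Suc n) * u ^ n \<le> g (Suc n)"
    using geometric_sum_ge_middle[of u "Suc n"] u by (simp add: g_def)
  have un: "0 < real n * u ^ n" "0 < real (Suc n) * u ^ n" using u n by auto
  have gp: "0 < g n" "0 < g (Suc n)" using g1 g2 un by linarith+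
  have "(real n * u ^ n) * (real (Suc n) * u ^ n) \<le> g n * g (Suc n)"
    using g1 g2 un gp by (intro mult_mono) auto
  moreover have "(real n * u ^ n) * (real (Suc n) * u ^ n) = (u * u) ^ n * (real n * real (Suc n))"
    by (simp only: power_mult_distrib mult_ac)
  ultimately have key: "t ^ n * (real n * real (Suc n)) \<le> g n * g (Suc n)"
    using u(3) by (simp only: power2_eq_square)
  have tn: "t ^ n < 1" "t ^ Suc n < 1"
    using t n power_less_one_iff[of t n] power_less_one_iff[of t "Suc n"] by simp_all
  have "t ^ n / (1 - t ^ n) - t ^ Suc n / (1 - t ^ Suc n) = (t ^ n * (1 - t)) / ((1 - t ^ n) * (1 - t ^ Suc n))"
    using tn by (subst diff_frac_eq) (auto simp: algebra_simps)
  also have "\<dots> = (t ^ n / (g n * g (Suc n))) / (1 - t)"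
  proof -
    have "(T * v) / ((v * A) * (v * B)) = (T / (A * B)) / v" if "v \<noteq> 0" for T v A B :: real
      using that by simp
    then show ?thesis unfolding g using t by simp
  qed
  also have "\<dots> \<le> (1 / (real n * real (Suc n))) / (1 - t)"
  proof (rule divide_right_mono)
    have "T / A \<le> 1 / P" if "T * P \<le> A" "A > 0" "P > 0" for T A P :: real
      using that by (simp add: field_simps)
    from this[OF key] show "t ^ n / (g n * g (Suc n)) \<le> 1 / (real n * real (Suc n))" using gp n by simp
  qed (use t in simp)
  also have "1 / (real n * real (Suc n)) = 1 / real n - 1 / real (Suc n)" using n by (simp add: field_simps)
  finally show ?thesis .
qed

section \<open>Divisor sums of real characters and Lambert series\<close>

lemma sum_divisors_prime_power_mult:
  fixes r :: "nat \<Rightarrow> real"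
  assumes mult: "\<And>a b. r (a * b) = r a * r b" "r 1 = 1" and p: "prime p" "\<not> p dvd m" "m > 0"
  shows "(\<Sum>d | d dvd p ^ a * m. r d) = (\<Sum>i\<le>a. r p ^ i) * (\<Sum>d | d dvd m. r d)"
proof -
  have rpow: "r (p ^ i) = r p ^ i" for i by (induction i) (use mult in auto)
  have mul: "multiplicity p (p ^ i * e) = i" if "e dvd m" for i e
  proof -
    have "\<not> p dvd e" "e \<noteq> 0" using that p by (auto intro: dvd_trans)
    then show ?thesis using p by (simp add: prime_elem_multiplicity_mult_distrib not_dvd_imp_multiplicity_0)
  qed
  have "(\<Sum>d | d dvd p ^ a * m. r d) = (\<Sum>(i, e)\<in>{..a} \<times> {e. e dvd m}. r p ^ i * r e)"
  proof (rule sum.reindex_bij_witness[of _ "\<lambda>(i, e). p ^ i * e" "\<lambda>d. (multiplicity p d, d div p ^ multiplicity p d)"])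
    fix d assume "d \<in> {d. d dvd p ^ a * m}"
    then have d: "d dvd p ^ a * m" by simp
    then have d0: "d \<noteq> 0" using p by (auto intro!: Nat.gr0I simp: prime_gt_0_nat)
    obtain e where e: "d = p ^ multiplicity p d * e" "\<not> p dvd e"
      using multiplicity_decompose'[of d p] d0 p by (metis not_prime_unit)
    have pp: "p ^ multiplicity p d > 0" using p by (simp add: prime_gt_0_nat)
    have de: "d div p ^ multiplicity p d = e" using e pp by (metis nonzero_mult_div_cancel_left neq0_conv)
    have "multiplicity p d \<le> multiplicity p (p ^ a * m)"
      by (rule dvd_imp_multiplicity_le[OF d]) (use p in \<open>auto simp: prime_gt_0_nat\<close>)
    also have "\<dots> = a" using mul[of m a] by simp
    finally have le: "multiplicity p d \<le> a" .
    have "coprime e (p ^ a)" using prime_imp_coprime[OF p(1) e(2)] by (simp add: coprime_commute)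
    moreover have "e dvd p ^ a * m" using d e(1) by (metis dvd_mult_right)
    ultimately have "e dvd m" by (simp add: coprime_dvd_mult_right_iff)
    then show "(multiplicity p d, d div p ^ multiplicity p d) \<in> {..a} \<times> {e. e dvd m}" using le de by simp
    show "(case (multiplicity p d, d div p ^ multiplicity p d) of (i, e) \<Rightarrow> p ^ i * e) = d" using e(1) de by simp
    have "r d = r p ^ multiplicity p d * r e" using mult(1)[of "p ^ multiplicity p d" e] e(1) rpow by simp
    then show "(case (multiplicity p d, d div p ^ multiplicity p d) of (i, e) \<Rightarrow> r p ^ i * r e) = r d" using de by simp
  next
    fix x assume "x \<in> {..a} \<times> {e. e dvd m}"
    then obtain i e where x: "x = (i, e)" "i \<le> a" "e dvd m" by auto
    have pp: "p ^ i > 0" using p by (simp add: prime_gt_0_nat)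
    show "(multiplicity p (case x of (i, e) \<Rightarrow> p ^ i * e), (case x of (i, e) \<Rightarrow> p ^ i * e) div p ^ multiplicity p (case x of (i, e) \<Rightarrow> p ^ i * e)) = x"
      using x mul[OF x(3), of i] pp by simp
    show "(case x of (i, e) \<Rightarrow> p ^ i * e) \<in> {d. d dvd p ^ a * m}"
      using x by (auto intro!: mult_dvd_mono le_imp_power_dvd)
  qed
  also have "\<dots> = (\<Sum>i\<le>a. r p ^ i) * (\<Sum>d | d dvd m. r d)"
    by (simp add: sum_product sum.cartesian_product)
  finally show ?thesis .
qed

lemma sum_powers_sign:
  assumes "x \<in> {-1, 0, 1 :: real}"
  shows "0 \<le> (\<Sum>i\<le>a. x ^ i)" "even a \<Longrightarrow> 1 \<le> (\<Sum>i\<le>a. x ^ i)"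
proof -
  consider "x = -1" | "x = 0" | "x = 1" using assms by auto
  then have "0 \<le> (\<Sum>i\<le>a. x ^ i) \<and> (even a \<longrightarrow> 1 \<le> (\<Sum>i\<le>a. x ^ i))"
  proof cases
    case 1
    have "(\<Sum>i\<le>a. (- 1 :: real) ^ i) = (if even a then 1 else 0)" by (induction a) auto
    with 1 show ?thesis by simp
  next
    case 2
    have "(\<Sum>i\<le>a. (0 :: real) ^ i) = 1" by (induction a) auto
    with 2 show ?thesis by simp
  qed auto
  then show "0 \<le> (\<Sum>i\<le>a. x ^ i)" "even a \<Longrightarrow> 1 \<le> (\<Sum>i\<le>a. x ^ i)" by auto
qed

lemma sum_divisors_sign_nonneg:
  fixes r :: "nat \<Rightarrow> real"
  assumes mult: "\<And>a b. r (a * b) = r a * r b" "r 1 = 1" and r: "\<And>n. r n \<in> {-1, 0, 1}" and "n > 0"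
  shows "0 \<le> (\<Sum>d | d dvd n. r d)"
  using \<open>n > 0\<close>
proof (induction n rule: less_induct)
  case (less n)
  show ?case
  proof (cases "n = 1")
    case True
    then show ?thesis using mult by simp
  next
    case False
    then obtain p where p: "prime p" "p dvd n" using prime_factor_nat by blast
    obtain m where m: "n = p ^ multiplicity p n * m" "\<not> p dvd m"
      using multiplicity_decompose'[of n p] less.prems p by (metis not_prime_unit neq0_conv)
    have m0: "m > 0" using m less.prems by (metis mult_0_right neq0_conv)
    have "multiplicity p n > 0" using p less.prems by (simp add: prime_multiplicity_gt_zero_iff)
    then have "1 < p ^ multiplicity p n" by (intro one_less_power prime_gt_1_nat p(1))
    then have "m < n" using m0 by (subst m(1)) simp
    from less.IH[OF this m0] have "0 \<le> (\<Sum>i\<le>multiplicity p n. r p ^ i) * (\<Sum>d | d dvd m. r d)"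
      using sum_powers_sign(1)[OF r] by (intro mult_nonneg_nonneg)
    then show ?thesis
      using sum_divisors_prime_power_mult[of r p m "multiplicity p n", OF mult p(1) m(2) m0] m(1) by simp
  qed
qed

text \<open>Even powers of 2 are a choice that works for every modulus: if r 2 = -1 the alternating
  sum ends at 1, and if r 2 = 0 only the divisor 1 remains.\<close>

lemma sum_divisors_sign_power_4:
  fixes r :: "nat \<Rightarrow> real"
  assumes mult: "\<And>a b. r (a * b) = r a * r b" "r 1 = 1" and r: "\<And>n. r n \<in> {-1, 0, 1}"
  shows "1 \<le> (\<Sum>d | d dvd 4 ^ k. r d)"
proof -
  have "(4::nat) ^ k = 2 ^ (2 * k) * 1" by (simp add: power_mult)
  then have "(\<Sum>d | d dvd 4 ^ k. r d) = (\<Sum>i\<le>2 * k. r 2 ^ i)"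
    using sum_divisors_prime_power_mult[of r 2 1 "2 * k", OF mult] mult(2) by simp
  then show ?thesis using sum_powers_sign(2)[OF r, of "2 * k"] by simp
qed

text \<open>Expanding t^d / (1 - t^d) as a geometric series gives the absolutely convergent double
  series of r d t^(d m), which is then collected by n = d m.\<close>

lemma lambert_series_regroup:
  fixes r :: "nat \<Rightarrow> real" and t :: real
  assumes r: "\<And>n. \<bar>r n\<bar> \<le> 1" and t: "0 < t" "t < 1"
  obtains X where "(\<lambda>n. r n * (if n = 0 then 0 else t ^ n / (1 - t ^ n))) sums X"
    "(\<lambda>n. (\<Sum>d | d dvd n. r d) * t ^ n) sums X"
proof -
  define y where "y = (\<lambda>n. if n = 0 then 0 else t ^ n / (1 - t ^ n))"
  have tn: "t ^ n < 1" if "n > 0" for n using t that by (simp add: power_less_one_iff)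
  have y0: "y n \<ge> 0" for n using tn[of n] t by (auto simp: y_def)
  have yle: "y n \<le> t ^ n / (1 - t)" for n
  proof (cases "n = 0")
    case False
    then have "t ^ n \<le> t ^ 1" using t by (intro power_decreasing) auto
    then show ?thesis using t tn[of n] False by (auto simp: y_def intro!: divide_left_mono mult_pos_pos)
  qed (use t in \<open>simp add: y_def\<close>)
  have "summable (\<lambda>n. t ^ n / (1 - t))" using t by (intro summable_divide summable_geometric) auto
  then have ysum: "summable (\<lambda>n. norm (y n))"
    by (rule summable_comparison_test'[of _ 0]) (use y0 yle in auto)
  have rysum: "summable (\<lambda>n. norm (r n * y n))"
    by (rule summable_comparison_test'[OF ysum, of 0]) (use r in \<open>auto simp: abs_mult mult_left_le_one_le\<close>)
  have inner: "((\<lambda>m. t ^ (d * m)) has_sum y d) {1..}" if d: "d \<in> {1..}" for d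
  proof -
    have "(\<lambda>m. (t ^ d) ^ m) sums (1 / (1 - t ^ d))"
      using tn[of d] d t by (intro geometric_sums) auto
    then have "((\<lambda>m. (t ^ d) ^ m) has_sum (1 / (1 - t ^ d))) UNIV"
      using tn[of d] d t by (intro norm_summable_imp_has_sum) (auto intro!: summable_geometric simp: norm_power)
    then have "((\<lambda>m. (t ^ d) ^ m) has_sum (1 / (1 - t ^ d) - (\<Sum>m\<in>{0}. (t ^ d) ^ m))) (UNIV - {0})"
      by (intro has_sum_Diff has_sum_finite) auto
    moreover have "UNIV - {0::nat} = {1..}" by auto
    moreover have "1 / (1 - t ^ d) - 1 = y d" using tn[of d] d by (simp add: y_def field_simps)
    ultimately show ?thesis by (simp add: power_mult)
  qed
  have y_on: "y summable_on {1..}"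
    using norm_summable_imp_summable_on[OF ysum] by (rule summable_on_subset_banach) auto
  have tsum: "(\<lambda>(d, m). t ^ (d * m)) summable_on ({1..} \<times> {1..})"
    by (rule summable_on_SigmaI[where g = y]) (use inner y_on t in auto)
  have "(\<lambda>p. norm (case p of (d, m) \<Rightarrow> r d * t ^ (d * m))) summable_on ({1..} \<times> {1..})"
    by (rule Infinite_Sum.abs_summable_on_comparison_test'[OF tsum]) (use r t in \<open>auto simp: abs_mult mult_left_le_one_le\<close>)
  then have Fsum: "(\<lambda>(d, m). r d * t ^ (d * m)) summable_on ({1..} \<times> {1..})"
    by (rule Infinite_Sum.abs_summable_summable)
  define X where "X = (\<Sum>n. r n * y n)"
  have X: "(\<lambda>n. r n * y n) sums X" unfolding X_def by (rule summable_sums[OF summable_norm_cancel[OF rysum]])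
  have "((\<lambda>n. r n * y n) has_sum X) UNIV" by (rule norm_summable_imp_has_sum[OF rysum X])
  also have "((\<lambda>n. r n * y n) has_sum X) UNIV \<longleftrightarrow> ((\<lambda>n. r n * y n) has_sum X) {1..}"
    by (rule has_sum_cong_neutral) (auto simp: y_def Suc_le_eq)
  finally have Xs: "((\<lambda>n. r n * y n) has_sum X) {1..}" .
  have "((\<lambda>(d, m). r d * t ^ (d * m)) has_sum X) ({1..} \<times> {1..})"
    by (rule has_sum_SigmaI[OF _ Xs Fsum]) (use inner in \<open>auto intro: has_sum_cmult_right\<close>)
  from has_sum_divisor_regroup[OF this]
  have "((\<lambda>n. \<Sum>d | d dvd n. r d * t ^ (d * (n div d))) has_sum X) {1..}" by simp
  also have "(\<lambda>n. \<Sum>d | d dvd n. r d * t ^ (d * (n div d))) = (\<lambda>n. (\<Sum>d | d dvd n. r d) * t ^ n)"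
    by (auto simp: sum_distrib_right intro!: sum.cong)
  finally have "(\<lambda>n. (\<Sum>d | d dvd n. r d) * t ^ n) sums X"
    by (intro sums_iff_has_sum_from_1) (auto intro: sum.infinite)
  then show ?thesis using that X by (simp add: y_def)
qed

text \<open>
  Monsky's argument: if \<open>L(1, chi)\<close> vanished, summation by parts would bound the Lambert series of \<open>chi\<close>
  near 1, but its power series coefficients are nonnegative and at least 1 at the powers of 4.
\<close>
lemma real_dchar_L_1_nonzero:
  assumes chi: "dchar W chi" and W: "W > 0" and np: "chi \<noteq> principal_dchar W"
    and sq: "(\<lambda>n. chi n * chi n) = principal_dchar W"
    and X: "(\<lambda>n. (\<Sum>k=1..n. chi k) * powr_gap n 1) sums X"
  shows "X \<noteq> 0"
proof
  assume X0: "X = 0"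
  define r where "r = (\<lambda>n. Re (chi n))"
  have val: "chi n \<in> {-1, 0, 1}" for n
  proof -
    have "(chi n)\<^sup>2 = 0 \<or> (chi n)\<^sup>2 = 1" using fun_cong[OF sq, of n]
      by (auto simp: principal_dchar_def power2_eq_square split: if_splits)
    then show ?thesis by (auto simp: power2_eq_1_iff)
  qed
  have chi_r: "chi n = of_real (r n)" for n using val[of n] by (auto simp: r_def)
  have rval: "r n \<in> {-1, 0, 1}" for n using val[of n] by (auto simp: r_def)
  have rmult: "r (a * b) = r a * r b" for a b
    using dchar_mult[OF chi, of a b] chi_r by (metis of_real_eq_iff of_real_mult)
  have r1: "r 1 = 1" using dchar_1[OF chi] by (simp add: r_def)
  have rle: "\<bar>r n\<bar> \<le> 1" for n using rval[of n] by auto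
  define C where "C = 2 * real W + 2"
  define R where "R = (\<lambda>n. \<Sum>k=1..n. r k)"
  have sumR: "(\<Sum>k=1..n. chi k) = of_real (R n)" for n by (simp add: R_def chi_r)
  have RC: "\<bar>R n\<bar> \<le> C" for n
    using periodic_partial_sum_bound[of W chi 0 n, OF W dchar_cong[OF chi] norm_dchar_le[OF chi W]]
      sum_dchar_nonprincipal[OF chi W np] unfolding sumR C_def by (simp only: norm_of_real mult_zero_right diff_0_right)
  have "(\<lambda>n. Re ((\<Sum>k=1..n. chi k) * powr_gap n 1)) sums Re X"
    by (rule sums_Re[OF X])
  moreover have "Re ((\<Sum>k=1..n. chi k) * powr_gap n 1) = R n * (1 / real n - 1 / real (Suc n))" for n
  proof -
    have "(of_nat k :: complex) powr (- 1) = of_real (1 / real k)" for k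
      by (cases "k = 0") (auto simp: powr_minus field_simps)
    then have "(\<Sum>k=1..n. chi k) * powr_gap n 1 =
        complex_of_real (R n * (1 / real n - 1 / real (Suc n)))"
      unfolding sumR by (simp only: of_real_mult of_real_diff)
    then show ?thesis by (simp only: Re_complex_of_real)
  qed
  ultimately have harm: "(\<lambda>n. R n * (1 / real n - 1 / real (Suc n))) sums 0" using X0 by simp
  have bounded: "(\<Sum>k<K. t ^ (4 ^ k)) \<le> C" if t: "0 < t" "t < 1" for t :: real and K
  proof -
    define y where "y = (\<lambda>n. if n = 0 then 0 else t ^ n / (1 - t ^ n))"
    \<comment> \<open>This \<open>X\<close> is the value of the Lambert series at t; it shadows the
      value at s = 1.\<close>
    obtain X where X: "(\<lambda>n. r n * y n) sums X" "(\<lambda>n. (\<Sum>d | d dvd n. r d) * t ^ n) sums X"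
      unfolding y_def by (rule lambert_series_regroup[of r t, OF rle t])
    have "y \<longlonglongrightarrow> 0"
    proof -
      have "(\<lambda>n. t ^ n / (1 - t ^ n)) \<longlonglongrightarrow> 0 / (1 - 0)"
        using t by (intro tendsto_intros LIMSEQ_power_zero) auto
      then have "(\<lambda>n. t ^ n / (1 - t ^ n)) \<longlonglongrightarrow> 0" by simp
      then show ?thesis
        by (rule Lim_transform_eventually) (use eventually_gt_at_top[of 0] in \<open>eventually_elim, simp add: y_def\<close>)
    qed
    have "(\<lambda>N. R N * y N) \<longlonglongrightarrow> 0"
    proof (rule Lim_null_comparison)
      show "\<forall>\<^sub>F n in sequentially. norm (R n * y n) \<le> C * \<bar>y n\<bar>"
        using RC by (intro always_eventually allI) (simp add: abs_mult mult_right_mono)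
      show "(\<lambda>n. C * \<bar>y n\<bar>) \<longlonglongrightarrow> 0"
        using tendsto_mult_right_zero[OF tendsto_rabs_zero[OF \<open>y \<longlonglongrightarrow> 0\<close>], of C] by simp
    qed
    moreover have "(\<lambda>N. \<Sum>n<Suc N. r n * y n) \<longlonglongrightarrow> X"
      using X(1) unfolding sums_def by (rule filterlim_sequentially_Suc[THEN iffD2])
    ultimately have "(\<lambda>N. (\<Sum>n<Suc N. r n * y n) - R N * y N) \<longlonglongrightarrow> X - 0" by (rule tendsto_diff[rotated])
    moreover have "(\<Sum>n<Suc N. r n * y n) - R N * y N = (\<Sum>n<N. R n * (y n - y (Suc n)))" for N
      using abel_summation_finite[of y r N] by (simp add: y_def R_def)
    ultimately have "(\<lambda>n. R n * (y n - y (Suc n))) sums X" by (simp add: sums_def)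
    \<comment> \<open>Here the assumption enters: the series with 1 / (n (1 - t)) sums to 0, so it
      may be added freely, and it removes the growth of \<open>y\<close> as t tends to 1.\<close>
    from sums_diff[OF sums_divide[OF harm, of "1 - t"] this]
    have s: "(\<lambda>n. R n * (1 / real n - 1 / real (Suc n)) / (1 - t) - R n * (y n - y (Suc n))) sums (- X)" by simp
    define b where "b = (\<lambda>n. 1 / (real n * (1 - t)) - y n)"
    have R0: "R 0 = 0" by (simp add: R_def)
    have eq: "R n * (1 / real n - 1 / real (Suc n)) / (1 - t) - R n * (y n - y (Suc n)) = R n * (b n - b (Suc n))" for n
      by (simp add: b_def algebra_simps diff_divide_distrib)
    \<comment> \<open>Index 0 is dropped: \<open>b 0\<close> is 0 by the convention for division and
      would break the monotonicity, while R 0 = 0 makes the term vanish. From index 1 on,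
      \<open>b\<close> decreases from 1 to 0.\<close>
    have s': "(\<lambda>n. R (Suc n) * (b (Suc n) - b (Suc (Suc n)))) sums (- X)"
      using s unfolding eq using sums_Suc_iff[of "\<lambda>n. R n * (b n - b (Suc n))" "- X"] R0 by simp
    have "b \<longlonglongrightarrow> 0 - 0"
      unfolding b_def using t by (intro tendsto_diff \<open>y \<longlonglongrightarrow> 0\<close>) real_asymp
    then have "(\<lambda>n. b (Suc n)) \<longlonglongrightarrow> 0" by (simp add: filterlim_sequentially_Suc)
    from telescope_sums'[OF this] have "(\<lambda>n. b (Suc n) - b (Suc (Suc n))) sums (b (Suc 0) - 0)" .
    moreover have "b (Suc 0) = 1" using t by (simp add: b_def y_def field_simps)
    ultimately have tel: "(\<lambda>n. C * (b (Suc n) - b (Suc (Suc n)))) sums (C * 1)" by (intro sums_mult) simp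
    have "norm (- X) \<le> C * 1"
    proof (rule norm_sums_le[OF s' tel])
      fix n
      have "y (Suc n) - y (Suc (Suc n)) \<le> (1 / real (Suc n) - 1 / real (Suc (Suc n))) / (1 - t)"
        using lambert_difference_bound[OF t, of "Suc n"] by (simp add: y_def)
      then have "0 \<le> b (Suc n) - b (Suc (Suc n))"
        by (simp add: b_def diff_divide_distrib del: of_nat_Suc)
      then show "norm (R (Suc n) * (b (Suc n) - b (Suc (Suc n)))) \<le> C * (b (Suc n) - b (Suc (Suc n)))"
        using RC[of "Suc n"] by (simp add: abs_mult mult_right_mono)
    qed
    then have XC: "X \<le> C" by simp
    have nonneg: "0 \<le> (\<Sum>d | d dvd n. r d) * t ^ n" for n
    proof (cases "n = 0")
      case False
      then show ?thesis using sum_divisors_sign_nonneg[of r n, OF rmult r1 rval] t by simp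
    qed (simp add: sum.infinite)
    have "(\<Sum>k<K. t ^ (4 ^ k)) \<le> (\<Sum>k<K. (\<Sum>d | d dvd 4 ^ k. r d) * t ^ (4 ^ k))"
      using sum_divisors_sign_power_4[of r, OF rmult r1 rval] t by (intro sum_mono) simp
    also have "\<dots> = (\<Sum>n\<in>(\<lambda>k. 4 ^ k) ` {..<K}. (\<Sum>d | d dvd n. r d) * t ^ n)"
      by (subst sum.reindex) (auto simp: inj_on_def)
    also have "\<dots> \<le> (\<Sum>n. (\<Sum>d | d dvd n. r d) * t ^ n)"
      by (rule sum_le_suminf[OF sums_summable[OF X(2)]]) (use nonneg in auto)
    also have "\<dots> = X" using X(2) by (rule sums_unique[symmetric])
    finally show ?thesis using XC by linarith
  qed
  \<comment> \<open>More than C terms, each of which tends to 1 with t.\<close>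
  define K where "K = nat \<lceil>C\<rceil> + 1"
  have "((\<lambda>t. \<Sum>k<K. t ^ (4 ^ k)) \<longlongrightarrow> (\<Sum>k<K. (1::real) ^ (4 ^ k))) (at_left 1)"
    by (intro tendsto_intros)
  moreover have "C < (\<Sum>k<K. (1::real) ^ (4 ^ k))" by (simp add: K_def) linarith
  ultimately have "\<forall>\<^sub>F t in at_left 1. C < (\<Sum>k<K. (t::real) ^ (4 ^ k))" by (rule order_tendstoD)
  moreover have "\<forall>\<^sub>F t in at_left (1::real). t \<in> {0<..<1}" by (rule eventually_at_left_real) simp
  ultimately have "\<forall>\<^sub>F t in at_left (1::real). False"
    by eventually_elim (use bounded[of _ K] in force)
  then show False by (simp add: trivial_limit_at_left_real)
qed

section \<open>Nonvanishing on the line of real part 1\<close>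

lemma L_continuation_exists_nonprincipal:
  assumes chi: "dchar W chi" and W: "W > 0" and np: "chi \<noteq> principal_dchar W"
  obtains E where "L_continuation chi 0 E"
    "(\<lambda>n. (\<Sum>k=1..n. chi k) * powr_gap n 1) sums E 1"
proof -
  have C: "norm (\<Sum>k=1..n. chi k) \<le> 2 * real W + 2" for n
    using periodic_partial_sum_bound[of W chi 0 n, OF W dchar_cong[OF chi] norm_dchar_le[OF chi W]]
      sum_dchar_nonprincipal[OF chi W np] by (simp only: mult_zero_right diff_0_right)
  show ?thesis
  proof (rule dirichlet_series_continuation_bounded[of chi, OF C norm_dchar_le[OF chi W]])
    fix L assume L: "L holomorphic_on {s. Re s > 0}"
      "\<And>s. Re s > 0 \<Longrightarrow> (\<lambda>n. (\<Sum>k=1..n. chi k) * powr_gap n s) sums L s"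
      "\<And>s. Re s > 1 \<Longrightarrow> (\<lambda>n. chi n * of_nat n powr (- s)) sums L s"
    show ?thesis
    proof (rule that[of L])
      show "L_continuation chi 0 L" unfolding L_continuation_def using L(1,3) by simp
      show "(\<lambda>n. (\<Sum>k=1..n. chi k) * powr_gap n 1) sums L 1"
        by (rule L(2)) simp
    qed
  qed
qed

text \<open>Euler's totient, counted over 0 <= a < W to match sums over \<open>a<W\<close>; for W =
  1 the residue counted is 0.\<close>

definition unit_count :: "nat \<Rightarrow> nat" where
  "unit_count W = card {a. a < W \<and> coprime a W}"

lemma sum_principal_dchar: "(\<Sum>a<W. principal_dchar W a) = of_nat (unit_count W)"
proof -
  have "(\<Sum>a<W. principal_dchar W a) = (\<Sum>a\<in>{..<W} \<inter> {a. coprime a W}. 1)"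
    unfolding principal_dchar_def by (subst sum.inter_restrict) auto
  also have "{..<W} \<inter> {a. coprime a W} = {a. a < W \<and> coprime a W}" by auto
  finally show ?thesis by (simp add: unit_count_def)
qed

lemma unit_count_pos: "W > 0 \<Longrightarrow> unit_count W > 0"
proof -
  assume W: "W > 0"
  have "(if W = 1 then 0 else 1) \<in> {a. a < W \<and> coprime a W}" using W by auto
  then show ?thesis unfolding unit_count_def by (subst card_gt_0_iff) auto
qed

lemma unit_count_le: "unit_count W \<le> W"
  unfolding unit_count_def using card_mono[of "{..<W}" "{a. a < W \<and> coprime a W}"] by auto

lemma L_continuation_exists_principal:
  assumes W: "W > 0"
  obtains E where "L_continuation (principal_dchar W) 1 E"
proof -
  let ?m = "complex_of_real (real (unit_count W) / real W)"
  note chi = dchar_principal[OF W]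
  have m: "(\<Sum>a<W. principal_dchar W a) = of_nat W * ?m" using W by (simp add: sum_principal_dchar)
  have C: "norm ((\<Sum>k=1..n. principal_dchar W k) - of_nat n * ?m) \<le> 2 * real W + 2" for n
    by (rule periodic_partial_sum_bound[OF W dchar_cong[OF chi] norm_dchar_le[OF chi W] m])
  have "norm ?m \<le> 1" unfolding norm_of_real using unit_count_le[of W] W by (simp add: divide_le_eq)
  then show ?thesis
  proof (rule dirichlet_series_continuation[of "principal_dchar W", OF C _ norm_dchar_le[OF chi W]])
    fix D assume D: "D holomorphic_on {s. Re s > 0}" "D 1 = ?m"
      "\<And>s. Re s > 1 \<Longrightarrow> (\<lambda>n. principal_dchar W n * of_nat n powr (- s)) sums (D s / (s - 1))"
    have "D 1 \<noteq> 0" using D(2) unit_count_pos[OF W] W by simp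
    then show ?thesis using D by (intro that[of D]) (simp add: L_continuation_def)
  qed
qed

text \<open>Along the horizontal ray towards 1 + \<i> t the order of the pole minus that of the zero
  appears as the limit. Real parts are taken because the trigonometric inequality is about real
  parts.\<close>

lemma log_derivative_limit:
  assumes chi: "chi 1 = 1" "\<And>n. norm (chi n) \<le> 1" and E: "L_continuation chi \<delta> E"
  obtains n :: nat where
    "((\<lambda>x. Re (of_real (x - 1) * (of_nat \<delta> / (of_real x + \<i> * of_real t - 1) -
        deriv E (of_real x + \<i> * of_real t) / E (of_real x + \<i> * of_real t))))
      \<longlongrightarrow> (if t = 0 then real \<delta> else 0) - real n) (at_right 1)"
    "n = 0 \<longleftrightarrow> E (1 + \<i> * of_real t) \<noteq> 0"
proof -
  define s0 where "s0 = 1 + \<i> * complex_of_real t"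
  define z where "z = (\<lambda>x. complex_of_real x + \<i> * complex_of_real t)"
  have "E s0 = 0 \<Longrightarrow> \<not> E constant_on {s. Re s > 0}"
    by (rule L_continuation_nonconstant[of chi, OF chi E, of 0 s0]) (auto simp: s0_def)
  then obtain n :: nat where n: "((\<lambda>s. (s - s0) * (deriv E s / E s)) \<longlongrightarrow> of_nat n) (at s0)" "n = 0 \<longleftrightarrow> E s0 \<noteq> 0"
    using zero_order_limit[OF L_continuation_holomorphic[OF E] open_connected_Re_gt, of s0 thesis] by (auto simp: s0_def)
  have "filterlim z (at s0) (at_right 1)"
    unfolding filterlim_at
  proof
    show "\<forall>\<^sub>F x in at_right 1. z x \<in> UNIV \<and> z x \<noteq> s0"
      using eventually_at_right_less[of 1] by eventually_elim (auto simp: z_def s0_def complex_eq_iff)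
    have "(z \<longlongrightarrow> of_real 1 + \<i> * of_real t) (at_right 1)" unfolding z_def by (intro tendsto_intros)
    then show "(z \<longlongrightarrow> s0) (at_right 1)" by (simp add: s0_def)
  qed
  from filterlim_compose[OF n(1) this]
  have 1: "((\<lambda>x. (z x - s0) * (deriv E (z x) / E (z x))) \<longlongrightarrow> of_nat n) (at_right 1)" .
  have zx: "z x - s0 = of_real (x - 1)" for x by (simp add: z_def s0_def)
  have 2: "((\<lambda>x. of_real (x - 1) * (of_nat \<delta> / (z x - 1))) \<longlongrightarrow> (if t = 0 then of_nat \<delta> else 0)) (at_right 1)"
  proof (cases "t = 0")
    case True
    have "\<forall>\<^sub>F x in at_right 1. of_nat \<delta> = of_real (x - 1) * (of_nat \<delta> / (z x - 1))"
      using eventually_at_right_less[of 1] by eventually_elim (auto simp: z_def True)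
    from Lim_transform_eventually[OF tendsto_const this] show ?thesis using True by simp
  next
    case False
    have "((\<lambda>x. of_real (x - 1) * (of_nat \<delta> / (z x - 1))) \<longlongrightarrow> of_real (1 - 1) * (of_nat \<delta> / (of_real 1 + \<i> * of_real t - 1))) (at_right 1)"
      unfolding z_def using False by (intro tendsto_intros) auto
    then show ?thesis using False by simp
  qed
  have "((\<lambda>x. of_real (x - 1) * (of_nat \<delta> / (z x - 1) - deriv E (z x) / E (z x)))
     \<longlongrightarrow> (if t = 0 then of_nat \<delta> else 0) - of_nat n) (at_right 1)"
    using tendsto_diff[OF 2 1] by (simp only: zx right_diff_distrib)
  from tendsto_Re[OF this] show ?thesis
    using n(2) that[of n] by (cases "t = 0") (simp_all add: z_def s0_def)
qed

text \<open>With w = chi n n^(-\<i> t) on the unit circle, Re (w^2) = 2 (Re w)^2 - 1, and the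
  bracket becomes the square 2 (1 + Re w)^2.\<close>

lemma three_four_one:
  assumes chi: "dchar W chi" and W: "W > 0" and n: "n > 0"
  shows "0 \<le> Re (3 * (principal_dchar W n * mangoldt n * of_nat n powr (- of_real x)) +
                 4 * (chi n * mangoldt n * of_nat n powr (- (of_real x + \<i> * of_real t))) +
                 chi n * chi n * mangoldt n * of_nat n powr (- (of_real x + \<i> * of_real (2 * t))))"
proof (cases "coprime n W")
  case False
  then have "chi n = 0" using dchar_nz_iff[OF chi, of n] by simp
  then show ?thesis using False by (simp add: principal_dchar_def)
next
  case True
  define u where "u = (of_nat n :: complex) powr (- \<i> * of_real t)"
  define w where "w = chi n * u"
  have "norm u = 1" unfolding u_def using n norm_powr_real_powr[of "of_nat n" "- \<i> * of_real t"] by simp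
  then have w: "norm w = 1" using norm_dchar[OF chi W True] by (simp add: w_def norm_mult)
  define v where "v = real n powr (- x)"
  have v: "(of_nat n :: complex) powr (- of_real x) = of_real v"
    using n by (simp add: v_def powr_of_real[symmetric])
  have e1: "(of_nat n :: complex) powr (- (of_real x + \<i> * of_real t)) = of_real v * u"
    unfolding v[symmetric] u_def by (simp add: powr_add[symmetric])
  have e2: "(of_nat n :: complex) powr (- (of_real x + \<i> * of_real (2 * t))) = of_real v * (u * u)"
    unfolding v[symmetric] u_def by (simp add: powr_add[symmetric] algebra_simps)
  have "3 * (principal_dchar W n * mangoldt n * of_nat n powr (- of_real x)) +
                 4 * (chi n * mangoldt n * of_nat n powr (- (of_real x + \<i> * of_real t))) +
                 chi n * chi n * mangoldt n * of_nat n powr (- (of_real x + \<i> * of_real (2 * t)))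
      = of_real (mangoldt n * v) * (3 + 4 * w + w * w)"
    unfolding e1 e2 v using True by (simp add: principal_dchar_def w_def algebra_simps)
  also have "Re \<dots> = mangoldt n * v * (3 + 4 * Re w + Re (w * w))"
  proof -
    have "Re (of_real r * z) = r * Re z" for r z by simp
    then show ?thesis by (simp only:) simp
  qed
  also have "Re (w * w) = 2 * (Re w)\<^sup>2 - 1"
    using w cmod_power2[of w] by (simp add: power2_eq_square algebra_simps)
  also have "3 + 4 * Re w + (2 * (Re w)\<^sup>2 - 1) = 2 * (1 + Re w)\<^sup>2"
    by (simp add: power2_eq_square algebra_simps)
  finally show ?thesis by (simp add: v_def mangoldt_nonneg)
qed

text \<open>Let d1, d2 be the pole orders of chi and its square at the points of heights t and 2 t,
  and n1, n2 the zero orders. In the limit the inequality reads 3 + 4 (d1 - n1) + (d2 - n2) >= 0, so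
  n1 = 0 whenever d1 = d2 = 0. A pole needs t = 0 and chi or its square principal: the first case is
  settled by E 1 \<noteq> 0 in \<open>L_continuation\<close>, the second is that of a real
  character.\<close>

theorem L_nonvanishing:
  assumes chi: "dchar W chi" and W: "W > 0"
  obtains E where "L_continuation chi (if chi = principal_dchar W then 1 else 0) E"
    "\<And>s. Re s \<ge> 1 \<Longrightarrow> E s \<noteq> 0"
proof -
  define \<delta> where "\<delta> = (\<lambda>chi. if chi = principal_dchar W then 1 else (0::nat))"
  have ex: "\<exists>E. L_continuation psi (\<delta> psi) E \<and> (\<delta> psi = 0 \<longrightarrow>
      (\<lambda>n. (\<Sum>k=1..n. psi k) * powr_gap n 1) sums E 1)"
    if psi: "dchar W psi" for psi
  proof (cases "psi = principal_dchar W")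
    case True
    obtain E where "L_continuation (principal_dchar W) 1 E" by (rule L_continuation_exists_principal[OF W])
    then show ?thesis using True by (intro exI[of _ E]) (simp add: \<delta>_def)
  next
    case False
    obtain E where "L_continuation psi 0 E"
      "(\<lambda>n. (\<Sum>k=1..n. psi k) * powr_gap n 1) sums E 1"
      by (rule L_continuation_exists_nonprincipal[OF psi W False])
    then show ?thesis using False by (intro exI[of _ E]) (simp add: \<delta>_def)
  qed
  define chi0 where "chi0 = principal_dchar W"
  define chi2 where "chi2 = (\<lambda>n. chi n * chi n)"
  have chi0: "dchar W chi0" and chi2: "dchar W chi2"
    using dchar_principal[OF W] dchar_times[OF chi chi] by (simp_all add: chi0_def chi2_def)
  obtain E0 where E0: "L_continuation chi0 (\<delta> chi0) E0" using ex[OF chi0] by blast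
  obtain E2 where E2: "L_continuation chi2 (\<delta> chi2) E2" using ex[OF chi2] by blast
  from ex[OF chi] obtain E1 where EE: "L_continuation chi (\<delta> chi) E1 \<and>
    (\<delta> chi = 0 \<longrightarrow> (\<lambda>n. (\<Sum>k=1..n. chi k) * powr_gap n 1) sums E1 1)" ..
  note E1 = EE[THEN conjunct1] and E1' = EE[THEN conjunct2]
  have d0: "\<delta> chi0 = 1" by (simp add: \<delta>_def chi0_def)
  have line: "E1 (1 + \<i> * of_real t) \<noteq> 0" for t :: real
  proof (cases "t = 0 \<and> (\<delta> chi = 1 \<or> \<delta> chi2 = 1)")
    case True
    show ?thesis
    proof (cases "\<delta> chi = 1")
      case d: True
      then show ?thesis using L_continuation_at_1[OF E1] True by simp
    next
      case False
      then have "\<delta> chi = 0" "chi \<noteq> principal_dchar W" "chi2 = principal_dchar W"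
        using True by (auto simp: \<delta>_def split: if_splits)
      then show ?thesis
        using real_dchar_L_1_nonzero[OF chi W, of "E1 1"] E1' True by (simp add: chi2_def)
    qed
  next
    case False
    obtain n0 :: nat where n0: "((\<lambda>x. Re (of_real (x - 1) * (of_nat (\<delta> chi0) / (of_real x + \<i> * of_real 0 - 1) -
        deriv E0 (of_real x + \<i> * of_real 0) / E0 (of_real x + \<i> * of_real 0))))
        \<longlongrightarrow> (if (0::real) = 0 then real (\<delta> chi0) else 0) - real n0) (at_right 1)"
      "n0 = 0 \<longleftrightarrow> E0 (1 + \<i> * of_real 0) \<noteq> 0"
      by (rule log_derivative_limit[of chi0, OF dchar_1[OF chi0] norm_dchar_le[OF chi0 W] E0])
    obtain n1 :: nat where n1: "((\<lambda>x. Re (of_real (x - 1) * (of_nat (\<delta> chi) / (of_real x + \<i> * of_real t - 1) -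
        deriv E1 (of_real x + \<i> * of_real t) / E1 (of_real x + \<i> * of_real t))))
        \<longlongrightarrow> (if t = 0 then real (\<delta> chi) else 0) - real n1) (at_right 1)"
      "n1 = 0 \<longleftrightarrow> E1 (1 + \<i> * of_real t) \<noteq> 0"
      by (rule log_derivative_limit[of chi, OF dchar_1[OF chi] norm_dchar_le[OF chi W] E1])
    obtain n2 :: nat where n2: "((\<lambda>x. Re (of_real (x - 1) * (of_nat (\<delta> chi2) / (of_real x + \<i> * of_real (2 * t) - 1) -
        deriv E2 (of_real x + \<i> * of_real (2 * t)) / E2 (of_real x + \<i> * of_real (2 * t)))))
        \<longlongrightarrow> (if 2 * t = 0 then real (\<delta> chi2) else 0) - real n2) (at_right 1)"
      by (rule log_derivative_limit[of chi2, OF dchar_1[OF chi2] norm_dchar_le[OF chi2 W] E2])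
    have "n0 = 0" using n0(2) L_continuation_at_1[OF E0] d0 by simp
    define H0 where "H0 = (\<lambda>x. of_nat (\<delta> chi0) / (complex_of_real x + \<i> * of_real 0 - 1) -
        deriv E0 (of_real x + \<i> * of_real 0) / E0 (of_real x + \<i> * of_real 0))"
    define H1 where "H1 = (\<lambda>x. of_nat (\<delta> chi) / (complex_of_real x + \<i> * of_real t - 1) -
        deriv E1 (of_real x + \<i> * of_real t) / E1 (of_real x + \<i> * of_real t))"
    define H2 where "H2 = (\<lambda>x. of_nat (\<delta> chi2) / (complex_of_real x + \<i> * of_real (2 * t) - 1) -
        deriv E2 (of_real x + \<i> * of_real (2 * t)) / E2 (of_real x + \<i> * of_real (2 * t)))"
    have nonneg: "0 \<le> 3 * Re (of_real (x - 1) * H0 x) + 4 * Re (of_real (x - 1) * H1 x) + Re (of_real (x - 1) * H2 x)"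
      if x: "x > 1" for x
    proof -
      have s0: "(\<lambda>n. chi0 n * mangoldt n * of_nat n powr (- (of_real x + \<i> * of_real 0))) sums H0 x"
        unfolding H0_def by (rule L_log_derivative(2)[OF chi0 W E0]) (use x in simp)
      have s1: "(\<lambda>n. chi n * mangoldt n * of_nat n powr (- (of_real x + \<i> * of_real t))) sums H1 x"
        unfolding H1_def by (rule L_log_derivative(2)[OF chi W E1]) (use x in simp)
      have s2: "(\<lambda>n. chi2 n * mangoldt n * of_nat n powr (- (of_real x + \<i> * of_real (2 * t)))) sums H2 x"
        unfolding H2_def by (rule L_log_derivative(2)[OF chi2 W E2]) (use x in simp)
      have "0 \<le> Re (3 * H0 x + 4 * H1 x + H2 x)"
      proof (rule sums_le[OF _ sums_zero sums_Re[OF sums_add[OF sums_add[OF sums_mult[OF s0] sums_mult[OF s1]] s2]]])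
        fix n show "0 \<le> Re (3 * (chi0 n * mangoldt n * of_nat n powr (- (of_real x + \<i> * of_real 0))) +
                 4 * (chi n * mangoldt n * of_nat n powr (- (of_real x + \<i> * of_real t))) +
                 chi2 n * mangoldt n * of_nat n powr (- (of_real x + \<i> * of_real (2 * t))))"
        proof (cases "n = 0")
          case False
          then show ?thesis using three_four_one[OF chi W, of n x t] by (simp add: chi0_def chi2_def)
        qed simp
      qed
      then have "0 \<le> (x - 1) * Re (3 * H0 x + 4 * H1 x + H2 x)" using x by simp
      then show ?thesis by (simp add: algebra_simps)
    qed
    have "((\<lambda>x. 3 * Re (of_real (x - 1) * H0 x) + 4 * Re (of_real (x - 1) * H1 x) + Re (of_real (x - 1) * H2 x)) \<longlongrightarrow>
       3 * ((if (0::real) = 0 then real (\<delta> chi0) else 0) - real n0) + 4 * ((if t = 0 then real (\<delta> chi) else 0) - real n1)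
        + ((if 2 * t = 0 then real (\<delta> chi2) else 0) - real n2)) (at_right 1)"
      unfolding H0_def H1_def H2_def by (intro tendsto_add tendsto_mult_left n0(1) n1(1) n2)
    then have "0 \<le> 3 * ((if (0::real) = 0 then real (\<delta> chi0) else 0) - real n0) + 4 * ((if t = 0 then real (\<delta> chi) else 0) - real n1)
        + ((if 2 * t = 0 then real (\<delta> chi2) else 0) - real n2)"
    proof (rule tendsto_lowerbound)
      show "\<forall>\<^sub>F x in at_right 1. 0 \<le> 3 * Re (of_real (x - 1) * H0 x) + 4 * Re (of_real (x - 1) * H1 x) + Re (of_real (x - 1) * H2 x)"
        using eventually_at_right_less[of 1] by eventually_elim (rule nonneg)
    qed simp
    moreover have "t = 0 \<Longrightarrow> \<delta> chi = 0 \<and> \<delta> chi2 = 0" using False by (auto simp: \<delta>_def)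
    ultimately have "4 * real n1 \<le> 3" using \<open>n0 = 0\<close> d0 by (auto split: if_splits)
    then have "n1 = 0" by simp
    then show ?thesis using n1(2) by simp
  qed
  show ?thesis
  proof (rule that[of E1])
    show "L_continuation chi (if chi = principal_dchar W then 1 else 0) E1" using E1 by (simp add: \<delta>_def)
    fix s :: complex assume s: "Re s \<ge> 1"
    show "E1 s \<noteq> 0"
    proof (cases "Re s = 1")
      case True
      then have "s = 1 + \<i> * of_real (Im s)" by (simp add: complex_eq_iff)
      then show ?thesis using line[of "Im s"] by simp
    next
      case False
      then show ?thesis using L_log_derivative(1)[OF chi W E1] s by simp
    qed
  qed
qed

section \<open>Chebyshev's bound and the Tauberian step\<close>

definition psi_sum :: "(nat \<Rightarrow> complex) \<Rightarrow> nat \<Rightarrow> complex" where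
  "psi_sum f n = (\<Sum>k=1..n. f k * mangoldt k)"

text \<open>The upper end M is independent of n so that the formulas for (2 n)! and n! can be
  subtracted term by term; for d > n the factor \<open>n div d\<close> is 0.\<close>

lemma ln_fact_eq_sum_mangoldt:
  "n \<le> M \<Longrightarrow> ln (fact n) = (\<Sum>d=1..M. mangoldt d * real (n div d))"
proof (induction n)
  case (Suc n)
  have sub: "{d. d dvd Suc n} \<subseteq> {1..M}"
  proof
    fix d assume "d \<in> {d. d dvd Suc n}"
    then have "d dvd Suc n" by simp
    then show "d \<in> {1..M}" using dvd_imp_le[of d "Suc n"] dvd_pos_nat[of "Suc n" d] Suc.prems by simp
  qed
  have step: "real (Suc n div d) = real (n div d) + (if d dvd Suc n then 1 else 0)" for d
    by (simp add: div_Suc dvd_eq_mod_eq_0)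
  have "ln (fact (Suc n) :: real) = ln (real (Suc n)) + ln (fact n)"
    by (simp add: ln_mult del: of_nat_Suc)
  also have "ln (real (Suc n)) = (\<Sum>d | d dvd Suc n. mangoldt d)"
    using mangoldt_sum[of "Suc n", where 'a = real] by simp
  also have "\<dots> = (\<Sum>d=1..M. if d dvd Suc n then mangoldt d else 0)"
    using sub by (intro sum.mono_neutral_cong_left) auto
  also have "ln (fact n) = (\<Sum>d=1..M. mangoldt d * real (n div d))" using Suc by simp
  also have "(\<Sum>d=1..M. if d dvd Suc n then mangoldt d else 0) + (\<Sum>d=1..M. mangoldt d * real (n div d)) =
      (\<Sum>d=1..M. mangoldt d * real (Suc n div d))"
    unfolding sum.distrib[symmetric] step by (intro sum.cong) (auto simp: algebra_simps)
  finally show ?case .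
qed (simp add: div_0)

text \<open>In the logarithm of the central binomial coefficient every \<open>mangoldt d\<close> has
  a nonnegative weight, and weight 1 for n < d <= 2 n. The binomial coefficient itself is at most
  4^n.\<close>

lemma psi_double:
  "(\<Sum>k=1..2*n. mangoldt k) \<le> (\<Sum>k=1..n. mangoldt k) + 2 * real n"
proof -
  let ?M = "2 * n"
  have "(\<Sum>k=n+1..2*n. mangoldt k) \<le> (\<Sum>d=1..?M. mangoldt d * (real (?M div d) - 2 * real (n div d)))"
  proof -
    have nn: "0 \<le> mangoldt d * (real (?M div d) - 2 * real (n div d))" for d
    proof -
      have "2 * (n div d) \<le> 2 * n div d" by (cases "d = 0") (auto simp: less_eq_div_iff_mult_less_eq mult.assoc)
      then have "2 * real (n div d) \<le> real (2 * n div d)" by (metis of_nat_le_iff of_nat_mult of_nat_numeral)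
      then show ?thesis by (simp add: mangoldt_nonneg)
    qed
    have "(\<Sum>k=n+1..2*n. mangoldt k) = (\<Sum>d=n+1..2*n. mangoldt d * (real (?M div d) - 2 * real (n div d)))"
    proof (rule sum.cong)
      fix d assume d: "d \<in> {n+1..2*n}"
      then have "n div d = 0" "?M div d = 1" by (auto intro: div_nat_eqI)
      then show "mangoldt d = mangoldt d * (real (?M div d) - 2 * real (n div d))" by simp
    qed simp
    also have "\<dots> \<le> (\<Sum>d=1..?M. mangoldt d * (real (?M div d) - 2 * real (n div d)))"
      by (rule sum_mono2) (use nn in auto)
    finally show ?thesis .
  qed
  also have "\<dots> = ln (fact ?M) - 2 * ln (fact n)"
    using ln_fact_eq_sum_mangoldt[of ?M ?M] ln_fact_eq_sum_mangoldt[of n ?M]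
    by (simp add: right_diff_distrib sum_subtractf sum_distrib_left mult_ac)
  also have "\<dots> = ln (real (?M choose n))"
  proof -
    have "fact n * fact n * (?M choose n) = (fact ?M :: nat)" using binomial_fact_lemma[of n ?M] by simp
    then have "(fact ?M :: real) = fact n * fact n * real (?M choose n)" by (metis of_nat_fact of_nat_mult)
    then show ?thesis by (simp add: ln_mult zero_less_binomial)
  qed
  also have "\<dots> \<le> ln (2 ^ ?M)"
  proof -
    have "(?M choose n) \<le> (\<Sum>k\<le>?M. ?M choose k)" by (rule member_le_sum) auto
    then have "(?M choose n) \<le> 2 ^ ?M" by (simp only: choose_row_sum)
    then have "real (?M choose n) \<le> 2 ^ ?M" by (metis of_nat_le_iff of_nat_numeral of_nat_power)
    then show ?thesis by (simp add: zero_less_binomial)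
  qed
  also have "\<dots> = 2 * real n * ln 2" by (simp add: ln_realpow)
  also have "\<dots> \<le> 2 * real n * 1" using ln_2_less_1 by (intro mult_left_mono) auto
  finally have "(\<Sum>k=n+1..2*n. mangoldt k) \<le> 2 * real n" by simp
  moreover have "(\<Sum>k=1..2*n. mangoldt k) = (\<Sum>k=1..n. mangoldt k) + (\<Sum>k=n+1..2*n. mangoldt k :: real)"
    using sum.ub_add_nat[of 1 n "mangoldt :: nat \<Rightarrow> real" n] by (simp add: mult_2)
  ultimately show ?thesis by simp
qed

text \<open>Halving gives (6 + 2) m for n = 2 m; for odd n the last term adds at most ln n <= n - 1
  = 2 m, and 10 m is still below 6 n.\<close>

lemma psi_le: "(\<Sum>k=1..n. mangoldt k) \<le> 6 * real n"
proof (induction n rule: less_induct)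
  case (less n)
  show ?case
  proof (cases "n = 0")
    case False
    define m where "m = n div 2"
    have "m < n" using False by (simp add: m_def)
    from less[OF this] have "(\<Sum>k=1..2*m. mangoldt k) \<le> 8 * real m" using psi_double[of m] by simp
    moreover have "n = 2 * m \<or> n = Suc (2 * m)" unfolding m_def by presburger
    ultimately show ?thesis
    proof (elim disjE)
      assume n: "n = Suc (2 * m)" and le: "(\<Sum>k=1..2*m. mangoldt k) \<le> 8 * real m"
      have "mangoldt n \<le> ln (real n)" using mangoldt_le[of n] False by simp
      also have "\<dots> \<le> real n - 1" using False by (intro ln_le_minus_one) simp
      finally show ?thesis using le n by simp
    qed simp
  qed simp
qed

lemma norm_psi_sum_le:
  assumes "\<And>n. norm (f n) \<le> 1"
  shows "norm (psi_sum f n) \<le> 6 * real n"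
proof -
  have "norm (psi_sum f n) \<le> (\<Sum>k=1..n. mangoldt k)"
    unfolding psi_sum_def
  proof (rule sum_norm_le)
    fix k show "norm (f k * mangoldt k) \<le> mangoldt k"
      using assms[of k] mangoldt_nonneg[of k] by (simp add: norm_mult mult_left_le_one_le)
  qed
  then show ?thesis using psi_le[of n] by linarith
qed

section \<open>Newman's theorem for characters and for residue classes\<close>

text \<open>The transform of the subtracted main term n. Its residue Z 1 = 1 is what matches the
  pole of - L'/L.\<close>

lemma zeta_continuation:
  "\<exists>Z. Z holomorphic_on {s. Re s > 0} \<and> Z 1 = 1 \<and> (\<forall>s. Re s > 1 \<longrightarrow>
    (\<lambda>n. of_nat n * powr_gap n s) sums (Z s / (s - 1)))"
proof (rule dirichlet_series_continuation[of "\<lambda>_. 1" 1 0])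
  fix D assume D: "D holomorphic_on {s. Re s > 0}" "D 1 = 1"
    "\<And>s. Re s > 1 \<Longrightarrow> (\<lambda>n. 1 * of_nat n powr (- s)) sums (D s / (s - 1))"
  have "(\<lambda>n. of_nat n * powr_gap n s) sums (D s / (s - 1))" if "Re s > 1" for s
    using D(3)[OF that] abel_summation_sums_iff[of "\<lambda>_. 1" 1 s] that by simp
  with D show ?thesis by (intro exI[of _ D]) simp
qed auto

text \<open>At s = 1 + z the transform of \<open>c\<close> is (- E'/E + d (1 - Z) / (s - 1)) / s.
  The poles at s = 1 have cancelled into the removable quotient \<open>h\<close>, and the
  nonvanishing of E for Re s >= 1 puts the closed half-plane inside the open set \<open>U\<close> on
  which \<open>g\<close> is holomorphic.\<close>

lemma dchar_newman:
  assumes chi: "dchar W chi" and W: "W > 0"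
  defines "d \<equiv> (if chi = principal_dchar W then 1 else 0 :: nat)"
  shows "convergent (\<lambda>N. \<Sum>k=1..<N. (psi_sum chi k - of_nat d * of_nat k) * newman_kernel k 0)"
proof -
  note le1 = norm_dchar_le[OF chi W]
  define H where "H = {s::complex. Re s > 0}"
  define H1 where "H1 = {z::complex. Re z > - 1}"
  have op: "open H" "open H1" unfolding H_def H1_def by (rule open_halfspace_Re_gt)+
  have "\<exists>E. L_continuation chi d E \<and> (\<forall>s. Re s \<ge> 1 \<longrightarrow> E s \<noteq> 0)"
  proof (rule L_nonvanishing[OF chi W])
    fix E assume "L_continuation chi (if chi = principal_dchar W then 1 else 0) E" "\<And>s. Re s \<ge> 1 \<Longrightarrow> E s \<noteq> 0"
    then show ?thesis unfolding d_def by (intro exI[of _ E] conjI allI impI)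
  qed
  then obtain E where EE: "L_continuation chi d E \<and> (\<forall>s. Re s \<ge> 1 \<longrightarrow> E s \<noteq> 0)" ..
  note E = EE[THEN conjunct1] and nz = EE[THEN conjunct2, rule_format]
  have Ehol: "E holomorphic_on H" using L_continuation_holomorphic[OF E] by (simp add: H_def)
  from zeta_continuation obtain Z where ZZ: "Z holomorphic_on {s. Re s > 0} \<and> Z 1 = 1 \<and> (\<forall>s. Re s > 1 \<longrightarrow>
    (\<lambda>n. of_nat n * powr_gap n s) sums (Z s / (s - 1)))" ..
  note Z = ZZ[THEN conjunct1, folded H_def] ZZ[THEN conjunct2, THEN conjunct1]
    ZZ[THEN conjunct2, THEN conjunct2, rule_format]
  have shift: "(\<lambda>z. f (1 + z)) holomorphic_on H1" if "f holomorphic_on H" for f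
  proof -
    have "(f \<circ> (\<lambda>z. 1 + z)) holomorphic_on H1"
      by (rule holomorphic_on_compose_gen[OF _ that]) (auto intro!: holomorphic_intros simp: H_def H1_def)
    then show ?thesis by (simp add: o_def)
  qed
  define Z1 where "Z1 = (\<lambda>z. Z (1 + z))"
  define h where "h = (\<lambda>z. if z = 0 then deriv Z1 0 else (Z1 z - Z1 0) / (z - 0))"
  have h: "h holomorphic_on H1"
    unfolding h_def by (rule pole_lemma_open[OF shift[OF Z(1), folded Z1_def] op(2)])
  define U where "U = {z \<in> H1. E (1 + z) \<in> - {0}}"
  have U: "open U"
    unfolding U_def using op(2)
    by (intro continuous_open_preimage[OF holomorphic_on_imp_continuous_on[OF shift[OF Ehol]], unfolded vimage_def Int_def, simplified]) auto
  define g where "g = (\<lambda>z. (- (deriv E (1 + z) / E (1 + z)) - of_nat d * h z) / (1 + z))"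
  have sub: "U \<subseteq> H1" by (auto simp: U_def)
  have g: "g holomorphic_on U"
    unfolding g_def
  proof (intro holomorphic_intros)
    show "(\<lambda>z. deriv E (1 + z)) holomorphic_on U"
      by (rule holomorphic_on_subset[OF shift[OF holomorphic_deriv[OF Ehol op(1)]] sub])
    show "(\<lambda>z. E (1 + z)) holomorphic_on U" by (rule holomorphic_on_subset[OF shift[OF Ehol] sub])
    show "h holomorphic_on U" by (rule holomorphic_on_subset[OF h sub])
    show "E (1 + z) \<noteq> 0" "1 + z \<noteq> 0" if "z \<in> U" for z
      using that by (auto simp: U_def H1_def add_eq_0_iff)
  qed
  define c where "c = (\<lambda>k. psi_sum chi k - of_nat d * of_nat k)"
  \<comment> \<open>6 from Chebyshev's bound and 1 from the subtracted main term.\<close>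
  have cB: "norm (c k) \<le> 7 * real k" for k
  proof -
    have "norm (of_nat d * of_nat k :: complex) \<le> real k"
      by (auto simp: d_def)
    then show ?thesis
      using norm_psi_sum_le[of chi k, OF le1] norm_triangle_ineq4[of "psi_sum chi k" "of_nat d * of_nat k"]
      unfolding c_def by linarith
  qed
  have c0: "c 0 = 0" using cB[of 0] by simp
  have lim: "(\<lambda>N. \<Sum>k=1..<N. c k * newman_kernel k z) \<longlonglongrightarrow> g z" if z: "Re z > 0" for z
  proof -
    define s where "s = 1 + z"
    have s: "Re s > 1" "s \<noteq> 0" "z \<noteq> 0" using z by (auto simp: s_def add_eq_0_iff)
    have "(\<lambda>n. chi n * mangoldt n * of_nat n powr (- s)) sums (of_nat d / (s - 1) - deriv E s / E s)"
      by (rule L_log_derivative(2)[OF chi W E s(1)])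
    then have 1: "(\<lambda>n. psi_sum chi n * powr_gap n s) sums (of_nat d / (s - 1) - deriv E s / E s)"
      using abel_summation_sums_iff[of "\<lambda>k. chi k * mangoldt k" 6 s "of_nat d / (s - 1) - deriv E s / E s"]
        norm_psi_sum_le[of chi, OF le1] s(1) unfolding psi_sum_def by simp
    have "(\<lambda>n. c n * powr_gap n s) sums
       (of_nat d / (s - 1) - deriv E s / E s - of_nat d * (Z s / (s - 1)))"
      using sums_diff[OF 1 sums_mult[OF Z(3)[OF s(1)], of "of_nat d"]] by (simp add: c_def left_diff_distrib mult.assoc)
    also have "of_nat d / (s - 1) - deriv E s / E s - of_nat d * (Z s / (s - 1)) = (1 + z) * g z"
    proof -
      have "h z = (Z s - 1) / z" using s Z(2) by (simp add: h_def Z1_def s_def)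
      then show ?thesis using s by (simp add: g_def s_def diff_divide_distrib right_diff_distrib)
    qed
    also have "(\<lambda>n. c n * powr_gap n s) = (\<lambda>n. (1 + z) * (c n * newman_kernel n z))"
    proof
      fix n show "c n * powr_gap n s = (1 + z) * (c n * newman_kernel n z)"
      proof (cases "n = 0")
        case False
        then show ?thesis using newman_kernel_eq[of n z] unfolding s_def by (simp only: mult.left_commute)
      qed (simp add: c0)
    qed
    finally have "(\<lambda>n. (1 + z) * (c n * newman_kernel n z)) sums ((1 + z) * g z)" .
    then have "(\<lambda>n. c n * newman_kernel n z) sums g z" using s(2) by (simp add: s_def sums_mult_iff)
    moreover have "(\<Sum>n<N. c n * newman_kernel n z) = (\<Sum>k=1..<N. c k * newman_kernel k z)" for N
      by (rule sum.mono_neutral_right) (auto simp: c0 not_le Suc_le_eq)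
    ultimately show ?thesis by (simp add: sums_def)
  qed
  have "(\<lambda>N. \<Sum>k=1..<N. c k * newman_kernel k 0) \<longlonglongrightarrow> g 0"
  proof (rule newman_tauberian[OF U _ g _ cB lim])
    show "{z. Re z \<ge> 0} \<subseteq> U" using nz by (auto simp: U_def H1_def)
  qed auto
  then show ?thesis unfolding c_def convergent_def by blast
qed

text \<open>Convergence becomes linear in the weight once the subtracted constant is written as the
  linear functional \<open>mean\<close>, which is 1 on the principal character and 0 on the others.
  Hence it extends to all sums of multiples of characters, among them the indicator of the class,
  whose \<open>mean\<close> is 1 / \<open>unit_count W\<close>.\<close>

lemma class_newman:
  assumes W: "W > 0" and b: "coprime b W"
  shows "convergent (\<lambda>N. \<Sum>k=1..<N. ((\<Sum>j | j \<in> {1..k} \<and> [j = b] (mod W). mangoldt j) - real k / real (unit_count W))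
           * (1 / real k - 1 / real (Suc k)))"
proof -
  define mean where "mean = (\<lambda>f. (\<Sum>a<W. f a) / (of_nat (unit_count W) :: complex))"
  define P where "P = (\<lambda>f. convergent (\<lambda>N. \<Sum>k=1..<N. (psi_sum f k - mean f * of_nat k) * newman_kernel k 0))"
  have u0: "(of_nat (unit_count W) :: complex) \<noteq> 0" using unit_count_pos[OF W] by simp
  define f where "f = (\<lambda>n. if [n = b] (mod W) then 1 else 0 :: complex)"
  have "P f"
  proof (rule dchar_span_induct[OF W])
    show "f x = f y" if "[x = y] (mod W)" for x y
      using that unfolding f_def by (metis cong_sym cong_trans)
    show "f x = 0" if "\<not> coprime x W" for x
      using that b unfolding f_def by (metis cong_imp_coprime cong_sym)
    show "P (\<lambda>n. c * chi n)" if chi: "dchar W chi" for c chi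
    proof -
      let ?d = "if chi = principal_dchar W then 1 else 0 :: nat"
      have "mean chi = of_nat ?d"
        using sum_dchar_nonprincipal[OF chi W] u0 sum_principal_dchar[of W] by (auto simp: mean_def)
      moreover have "mean (\<lambda>n. c * chi n) = c * mean chi" "psi_sum (\<lambda>n. c * chi n) k = c * psi_sum chi k" for k
        by (simp_all add: mean_def psi_sum_def sum_distrib_left mult.assoc)
      ultimately have "(\<lambda>N. \<Sum>k=1..<N. (psi_sum (\<lambda>n. c * chi n) k - mean (\<lambda>n. c * chi n) * of_nat k) * newman_kernel k 0) =
         (\<lambda>N. c * (\<Sum>k=1..<N. (psi_sum chi k - of_nat ?d * of_nat k) * newman_kernel k 0))"
        by (simp only: sum_distrib_left right_diff_distrib left_diff_distrib mult.assoc)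
      then show ?thesis unfolding P_def using convergent_mult[OF convergent_const dchar_newman[OF chi W]] by simp
    qed
    show "P (\<lambda>n. f n + h n)" if "P f" "P h" for f h
    proof -
      have "mean (\<lambda>n. f n + h n) = mean f + mean h" "psi_sum (\<lambda>n. f n + h n) k = psi_sum f k + psi_sum h k" for k
        by (simp_all add: mean_def psi_sum_def sum.distrib add_divide_distrib distrib_right)
      then have "(\<lambda>N. \<Sum>k=1..<N. (psi_sum (\<lambda>n. f n + h n) k - mean (\<lambda>n. f n + h n) * of_nat k) * newman_kernel k 0) =
         (\<lambda>N. (\<Sum>k=1..<N. (psi_sum f k - mean f * of_nat k) * newman_kernel k 0) + (\<Sum>k=1..<N. (psi_sum h k - mean h * of_nat k) * newman_kernel k 0))"
        by (simp add: sum.distrib[symmetric] algebra_simps)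
      then show ?thesis using convergent_add[of "\<lambda>N. \<Sum>k=1..<N. (psi_sum f k - mean f * of_nat k) * newman_kernel k 0"] that unfolding P_def by simp
    qed
  qed
  then obtain L where L: "(\<lambda>N. \<Sum>k=1..<N. (psi_sum f k - mean f * of_nat k) * newman_kernel k 0) \<longlonglongrightarrow> L"
    unfolding P_def convergent_def by blast
  have "(\<Sum>a<W. f a) = 1"
  proof -
    have "f a = (if a = b mod W then 1 else 0)" if "a < W" for a using that by (simp add: f_def cong_def)
    then have "(\<Sum>a<W. f a) = (\<Sum>a<W. if a = b mod W then 1 else 0)" by (intro sum.cong) auto
    then show ?thesis using W by simp
  qed
  then have mf: "mean f = of_real (1 / real (unit_count W))" by (simp add: mean_def)
  have psi_f: "psi_sum f k = of_real (\<Sum>j | j \<in> {1..k} \<and> [j = b] (mod W). mangoldt j)" for k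
  proof -
    have "psi_sum f k = (\<Sum>j\<in>{1..k}. if [j = b] (mod W) then mangoldt j else 0)"
      unfolding psi_sum_def f_def by (intro sum.cong) auto
    also have "\<dots> = (\<Sum>j | j \<in> {1..k} \<and> [j = b] (mod W). mangoldt j)"
      by (rule sum.inter_filter[symmetric]) simp
    finally show ?thesis by simp
  qed
  have eq: "(\<Sum>k=1..<N. (psi_sum f k - mean f * of_nat k) * newman_kernel k 0) =
     of_real (\<Sum>k=1..<N. ((\<Sum>j | j \<in> {1..k} \<and> [j = b] (mod W). mangoldt j) - real k / real (unit_count W)) * (1 / real k - 1 / real (Suc k)))" for N
    unfolding of_real_sum
  proof (rule sum.cong)
    fix k assume k: "k \<in> {1..<N}"
    have inv: "(of_nat j :: complex) powr (- 1) = of_real (1 / real j)" for j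
      by (cases "j = 0") (auto simp: powr_minus field_simps)
    have "newman_kernel k 0 = of_nat k powr (- 1) - of_nat (Suc k) powr (- 1)"
      using newman_kernel_eq[of k 0] k by (simp del: of_nat_Suc)
    then have "newman_kernel k 0 = of_real (1 / real k - 1 / real (Suc k))"
      unfolding inv of_real_diff .
    then show "(psi_sum f k - mean f * of_nat k) * newman_kernel k 0 =
      complex_of_real (((\<Sum>j | j \<in> {1..k} \<and> [j = b] (mod W). mangoldt j) - real k / real (unit_count W)) * (1 / real k - 1 / real (Suc k)))"
      unfolding psi_f mf by simp
  qed simp
  from tendsto_Re[OF L] show ?thesis unfolding eq Re_complex_of_real convergent_def by blast
qed

section \<open>From a convergent series to prime counts\<close>

text \<open>If A n exceeded lam n by e n, monotonicity would keep A k - lam k above e n / 2 for all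
  k between n and (1 + h) n, and this block would add at least a fixed c to the series for
  arbitrarily large n, against the Cauchy property. For the lower bound the block lies to the left
  of n.\<close>

lemma monotone_tauberian:
  fixes A :: "nat \<Rightarrow> real"
  assumes mono: "mono A" and lam: "lam > 0"
    and conv: "convergent (\<lambda>N. \<Sum>k=1..<N. (A k - lam * real k) * (1 / real k - 1 / real (Suc k)))"
  shows "(\<lambda>n. A n / real n) \<longlonglongrightarrow> lam"
proof -
  define F where "F = (\<lambda>N. \<Sum>k=1..<N. (A k - lam * real k) * (1 / real k - 1 / real (Suc k)))"
  have block: "F n - F m = (\<Sum>k=m..<n. (A k - lam * real k) * (1 / real k - 1 / real (Suc k)))"
    if "1 \<le> m" "m \<le> n" for m n
    unfolding F_def using sum.atLeastLessThan_concat[OF that, of "\<lambda>k. (A k - lam * real k) * (1 / real k - 1 / real (Suc k))"]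
    by (simp add: algebra_simps)
  have tel: "(\<Sum>k=m..<n. D * (1 / real k - 1 / real (Suc k))) = D * (1 / real m - 1 / real n)" if "m \<le> n" for m n D
    using sum_Suc_diff'[OF that, of "\<lambda>k. - (1 / real k)"] by (simp add: sum_distrib_left[symmetric])
  have w0: "0 \<le> 1 / real k - 1 / real (Suc k)" if "1 \<le> k" for k using that by (simp add: field_simps)
  have cauchy: "\<exists>M. \<forall>m\<ge>M. \<forall>n\<ge>M. \<bar>F m - F n\<bar> < c" if "c > 0" for c
    using convergent_Cauchy[OF conv] that unfolding Cauchy_def F_def dist_real_def by blast
  have upper: "\<forall>\<^sub>F n in sequentially. A n < (lam + e) * real n" if e: "e > 0" for e
  proof -
    \<comment> \<open>Half of the excess pays for the growth of lam k across the block: lam h = e /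
      2.\<close>
    define h where "h = e / (2 * lam)"
    have h: "h > 0" "lam * h = e / 2" using e lam by (simp_all add: h_def)
    define c where "c = e / 2 * (1 - 1 / (1 + h / 2))"
    have "1 / (1 + h / 2) < 1" using h by simp
    then have c: "c > 0" using e by (simp add: c_def)
    obtain M where M: "\<And>m n. m \<ge> M \<Longrightarrow> n \<ge> M \<Longrightarrow> \<bar>F m - F n\<bar> < c" using cauchy[OF c] by blast
    show ?thesis
      \<comment> \<open>From n >= 2 / h one gets h n / 2 >= 1, which absorbs the rounding of (1 + h)
        n to an integer.\<close>
      using eventually_ge_at_top[of M] eventually_ge_at_top[of "nat \<lceil>2 / h\<rceil>"] eventually_gt_at_top[of 0]
    proof eventually_elim
      case (elim n)
      show ?case
      proof (rule ccontr)
        assume "\<not> A n < (lam + e) * real n"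
        then have big: "A n \<ge> (lam + e) * real n" by simp
        have "2 / h \<le> real n" using elim by linarith
        then have hn: "h * real n \<ge> 2" using h by (simp add: field_simps)
        define n' where "n' = nat \<lfloor>(1 + h) * real n\<rfloor>"
        have n'1: "real n' \<le> (1 + h) * real n" using h by (simp add: n'_def)
        have "real n' > (1 + h) * real n - 1" unfolding n'_def by linarith
        then have n'2: "real n' \<ge> (1 + h / 2) * real n" using hn by (simp add: algebra_simps)
        have "1 * real n \<le> (1 + h / 2) * real n" using h by (intro mult_right_mono) auto
        then have nn': "n \<le> n'" using n'2 by linarith
        have "(\<Sum>k=n..<n'. (e / 2 * real n) * (1 / real k - 1 / real (Suc k))) \<le> F n' - F n"
          unfolding block[OF Suc_leI[OF elim(3), folded One_nat_def] nn']
        proof (intro sum_mono mult_right_mono)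
          fix k assume k: "k \<in> {n..<n'}"
          then have "lam * real k \<le> lam * ((1 + h) * real n)" using n'1 lam by (intro mult_left_mono) auto
          also have "\<dots> = lam * real n + (lam * h) * real n" by (simp add: algebra_simps)
          finally have "lam * real k \<le> lam * real n + e / 2 * real n" by (simp only: h)
          moreover have "A n \<le> A k" using k mono by (auto intro: monoD)
          moreover have "(lam + e) * real n = lam * real n + e * real n" by (simp add: algebra_simps)
          ultimately show "e / 2 * real n \<le> A k - lam * real k" using big by simp
          show "0 \<le> 1 / real k - 1 / real (Suc k)" using k elim by (intro w0) auto
        qed
        also have "(\<Sum>k=n..<n'. (e / 2 * real n) * (1 / real k - 1 / real (Suc k))) = e / 2 * (1 - real n / real n')"
          unfolding tel[OF nn'] using elim by (simp add: field_simps)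
        finally have "e / 2 * (1 - real n / real n') \<le> F n' - F n" .
        moreover have "c \<le> e / 2 * (1 - real n / real n')"
        proof -
          have "real n / real n' \<le> real n / ((1 + h / 2) * real n)"
            using n'2 h elim nn' by (intro divide_left_mono mult_pos_pos) auto
          also have "\<dots> = 1 / (1 + h / 2)" using elim by simp
          finally show ?thesis unfolding c_def using e by (intro mult_left_mono) auto
        qed
        ultimately show False using M[of n' n] elim nn' by simp
      qed
    qed
  qed
  have lower: "\<forall>\<^sub>F n in sequentially. A n > (lam - e) * real n" if e: "e > 0" "e < lam" for e
  proof -
    define h where "h = e / (2 * lam)"
    have h: "h > 0" "h < 1 / 2" "lam * h = e / 2" using e lam by (simp_all add: h_def field_simps)
    define c where "c = e / 2 * (1 / (1 - h / 2) - 1)"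
    have "1 / (1 - h / 2) > 1" using h by simp
    then have c: "c > 0" using e by (simp add: c_def)
    obtain M where M: "\<And>m n. m \<ge> M \<Longrightarrow> n \<ge> M \<Longrightarrow> \<bar>F m - F n\<bar> < c" using cauchy[OF c] by blast
    show ?thesis
      \<comment> \<open>The block begins at some m >= n / 2, because h < 1/2; doubling M keeps this
        start beyond M.\<close>
      using eventually_ge_at_top[of "2 * M"] eventually_ge_at_top[of "nat \<lceil>2 / h\<rceil>"] eventually_gt_at_top[of 0]
    proof eventually_elim
      case (elim n)
      show ?case
      proof (rule ccontr)
        assume "\<not> A n > (lam - e) * real n"
        then have small: "A n \<le> (lam - e) * real n" by simp
        have "2 / h \<le> real n" using elim by linarith
        then have hn: "h * real n \<ge> 2" using h by (simp add: field_simps)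
        define m where "m = nat \<lceil>(1 - h) * real n\<rceil>"
        have pos: "0 < (1 - h) * real n" using h elim by simp
        then have m1: "real m \<ge> (1 - h) * real n" unfolding m_def by linarith
        have "real m < (1 - h) * real n + 1" using pos unfolding m_def by linarith
        then have m2: "real m \<le> (1 - h / 2) * real n" using hn by (simp add: algebra_simps)
        have "(1 - h / 2) * real n \<le> 1 * real n" using h by (intro mult_right_mono) auto
        then have mn: "m \<le> n" using m2 by linarith
        have m0: "m \<ge> 1" using m1 pos by (cases "m = 0") auto
        have "1 / 2 * real n \<le> (1 - h) * real n" using h by (intro mult_right_mono) auto
        then have mM: "m \<ge> M" using m1 elim by linarith
        have "F n - F m \<le> (\<Sum>k=m..<n. (- (e / 2 * real n)) * (1 / real k - 1 / real (Suc k)))"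
          unfolding block[OF m0 mn]
        proof (intro sum_mono mult_right_mono)
          fix k assume k: "k \<in> {m..<n}"
          then have "lam * ((1 - h) * real n) \<le> lam * real k" using m1 lam by (intro mult_left_mono) auto
          moreover have "lam * ((1 - h) * real n) = lam * real n - (lam * h) * real n" by (simp add: algebra_simps)
          ultimately have "lam * real n - e / 2 * real n \<le> lam * real k" by (simp only: h)
          moreover have "A k \<le> A n" using k mono by (auto intro: monoD)
          moreover have "(lam - e) * real n = lam * real n - e * real n" by (simp add: algebra_simps)
          ultimately show "A k - lam * real k \<le> - (e / 2 * real n)" using small by simp
          show "0 \<le> 1 / real k - 1 / real (Suc k)" using k m0 by (intro w0) auto
        qed
        also have "\<dots> = - (e / 2 * (real n / real m - 1))"
          unfolding tel[OF mn] using elim m0 by (simp add: field_simps)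
        finally have "F n - F m \<le> - (e / 2 * (real n / real m - 1))" .
        moreover have "c \<le> e / 2 * (real n / real m - 1)"
        proof -
          have "1 / (1 - h / 2) = real n / ((1 - h / 2) * real n)" using elim by simp
          also have "\<dots> \<le> real n / real m"
            using m2 m0 h elim by (intro divide_left_mono mult_pos_pos) auto
          finally show ?thesis unfolding c_def using e by (intro mult_left_mono) auto
        qed
        moreover have "\<bar>F n - F m\<bar> < c" by (rule M) (use elim mM in auto)
        ultimately show False by linarith
      qed
    qed
  qed
  show ?thesis
  proof (rule LIMSEQ_I)
    fix r :: real assume r: "r > 0"
    define e where "e = min r (lam / 2)"
    have e: "e > 0" "e < lam" "e \<le> r" using r lam by (auto simp: e_def)
    have "\<forall>\<^sub>F n in sequentially. norm (A n / real n - lam) < r"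
      using upper[OF e(1)] lower[OF e(1,2)] eventually_gt_at_top[of 0]
    proof eventually_elim
      case (elim n)
      have "A n / real n < lam + e" "lam - e < A n / real n"
        using elim by (simp_all add: pos_divide_less_eq pos_less_divide_eq)
      then show ?case using e(3) by (simp add: abs_less_iff)
    qed
    then show "\<exists>no. \<forall>n\<ge>no. norm (A n / real n - lam) < r" by (simp add: eventually_sequentially)
  qed
qed

section \<open>From weighted sums over prime powers to counts of primes\<close>

text \<open>A proper prime power p^k up to n has p <= sqrt n and k <= log 2 n. Counting the pairs is
  crude, but o(n) even after the factor ln n.\<close>

lemma sum_mangoldt_nonprime_le:
  assumes n: "n \<ge> 1"
  shows "(\<Sum>j | j \<in> {1..n} \<and> \<not> prime j. mangoldt j) \<le> sqrt (real n) * (log 2 (real n) + 1) * ln (real n)"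
proof -
  define S where "S = {j \<in> {1..n}. primepow j \<and> \<not> prime j}"
  have fin: "finite S" by (simp add: S_def)
  have "(\<Sum>j | j \<in> {1..n} \<and> \<not> prime j. mangoldt j) = (\<Sum>j\<in>S. mangoldt j)"
    by (rule sum.mono_neutral_right) (auto simp: S_def mangoldt_def)
  also have "\<dots> \<le> (\<Sum>j\<in>S. ln (real n))"
  proof (rule sum_mono)
    fix j assume "j \<in> S"
    then have "j > 0" "j \<le> n" by (auto simp: S_def)
    then show "mangoldt j \<le> ln (real n)" using mangoldt_le[of j] by (auto elim: order_trans)
  qed
  also have "\<dots> = real (card S) * ln (real n)" by simp
  also have "real (card S) \<le> sqrt (real n) * (log 2 (real n) + 1)"
  proof -
    let ?a = "nat \<lfloor>sqrt (real n)\<rfloor>" and ?b = "nat \<lfloor>log 2 (real n)\<rfloor>"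
    have "S \<subseteq> (\<lambda>(p, k). p ^ k) ` ({1..?a} \<times> {..?b})"
    proof
      fix j assume j: "j \<in> S"
      then obtain p k where pk: "prime p" "k > 0" "j = p ^ k" by (auto simp: S_def primepow_def)
      have "k \<noteq> 1" using pk j by (auto simp: S_def)
      with pk have k: "k \<ge> 2" by simp
      have p: "p \<ge> 2" using pk by (simp add: prime_ge_2_nat)
      have jn: "p ^ k \<le> n" using j pk by (simp add: S_def)
      have "p ^ 2 \<le> p ^ k" using k p by (intro power_increasing) auto
      then have "p ^ 2 \<le> n" using jn by linarith
      then have "real p ^ 2 \<le> real n" by (metis of_nat_le_iff of_nat_power)
      then have "real p \<le> sqrt (real n)" by (rule real_le_rsqrt)
      then have 1: "p \<le> ?a" by (rule le_nat_floor)
      have "2 ^ k \<le> p ^ k" using p by (intro power_mono) auto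
      then have "2 ^ k \<le> n" using jn by linarith
      then have "(2::real) ^ k \<le> real n" by (metis of_nat_le_iff of_nat_numeral of_nat_power)
      then have "real k \<le> log 2 (real n)" by (intro le_log_of_power) auto
      then have 2: "k \<le> ?b" by (rule le_nat_floor)
      show "j \<in> (\<lambda>(p, k). p ^ k) ` ({1..?a} \<times> {..?b})"
        by (rule image_eqI[of _ _ "(p, k)"]) (use pk 1 2 p in auto)
    qed
    then have "card S \<le> card ((\<lambda>(p, k). p ^ k) ` ({1..?a} \<times> {..?b}))" by (intro card_mono) auto
    also have "\<dots> \<le> card ({1..?a} \<times> {..?b})" by (rule card_image_le) simp
    also have "\<dots> = ?a * (?b + 1)" by (simp add: card_cartesian_product)
    finally have "real (card S) \<le> real (?a * (?b + 1))" by (rule of_nat_mono)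
    then have "real (card S) \<le> real ?a * (real ?b + 1)" by (simp only: of_nat_mult of_nat_add of_nat_1)
    also have "\<dots> \<le> sqrt (real n) * (log 2 (real n) + 1)"
      using n by (intro mult_mono add_mono) (auto simp: zero_le_log_cancel_iff)
    finally show ?thesis .
  qed
  finally show ?thesis using n by (simp add: mult_right_mono)
qed

definition prime_class_count :: "nat \<Rightarrow> nat \<Rightarrow> nat \<Rightarrow> nat" where
  "prime_class_count W b n = card {p. prime p \<and> p \<le> n \<and> [p = b] (mod W)}"

text \<open>Bounding ln p by ln n gives one direction. For the other, primes beyond n^a have ln p >=
  a ln n, and at most n^a primes are given up; the factor 1 / a is then brought close to 1.\<close>

lemma prime_class_count_asymp_of_psi:
  assumes lam: "lam > 0"
    and psi: "(\<lambda>n. (\<Sum>j | j \<in> {1..n} \<and> [j = b] (mod W). mangoldt j) / real n) \<longlonglongrightarrow> lam"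
  shows "(\<lambda>n. real (prime_class_count W b n) * ln (real n) / real n) \<longlonglongrightarrow> lam"
proof -
  define P where "P = (\<lambda>n. {p. prime p \<and> p \<le> n \<and> [p = b] (mod W)})"
  define ps where "ps = (\<lambda>n. \<Sum>j | j \<in> {1..n} \<and> [j = b] (mod W). mangoldt j :: real)"
  define th where "th = (\<lambda>n. \<Sum>p\<in>P n. ln (real p))"
  define f where "f = (\<lambda>n. real (prime_class_count W b n) * ln (real n) / real n)"
  have cP: "prime_class_count W b n = card (P n)" for n by (simp add: prime_class_count_def P_def)
  have finP: "finite (P n)" for n by (rule finite_subset[of _ "{..n}"]) (auto simp: P_def)
  have Pge: "p \<ge> 2" if "p \<in> P n" for p n using that by (auto simp: P_def prime_ge_2_nat)
  have split: "ps n = th n + (\<Sum>j | j \<in> {1..n} \<and> [j = b] (mod W) \<and> \<not> prime j. mangoldt j)" for n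
  proof -
    have eq: "{j. j \<in> {1..n} \<and> [j = b] (mod W)} = P n \<union> {j. j \<in> {1..n} \<and> [j = b] (mod W) \<and> \<not> prime j}"
      by (auto simp: P_def prime_ge_Suc_0_nat)
    have "ps n = (\<Sum>j\<in>P n. mangoldt j) + (\<Sum>j | j \<in> {1..n} \<and> [j = b] (mod W) \<and> \<not> prime j. mangoldt j)"
      unfolding ps_def eq by (rule sum.union_disjoint) (auto simp: finP, auto simp: P_def)
    also have "(\<Sum>j\<in>P n. mangoldt j) = th n"
      unfolding th_def by (intro sum.cong) (auto simp: P_def)
    finally show ?thesis .
  qed
  have th_le: "th n \<le> ps n" for n
    unfolding split by (simp add: sum_nonneg mangoldt_nonneg)
  have th_ge: "th n \<ge> ps n - sqrt (real n) * (log 2 (real n) + 1) * ln (real n)" if "n \<ge> 1" for n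
  proof -
    have "(\<Sum>j | j \<in> {1..n} \<and> [j = b] (mod W) \<and> \<not> prime j. mangoldt j) \<le> (\<Sum>j | j \<in> {1..n} \<and> \<not> prime j. mangoldt j :: real)"
      by (rule sum_mono2) (auto simp: mangoldt_nonneg)
    then show ?thesis using split[of n] sum_mangoldt_nonprime_le[OF that] by linarith
  qed
  have psi': "(\<lambda>n. ps n / real n) \<longlonglongrightarrow> lam" using psi by (simp add: ps_def)
  have lower: "\<forall>\<^sub>F n in sequentially. ps n / real n - sqrt (real n) * (log 2 (real n) + 1) * ln (real n) / real n \<le> f n"
    using eventually_ge_at_top[of 1]
  proof eventually_elim
    case (elim n)
    have "th n \<le> (\<Sum>p\<in>P n. ln (real n))"
      unfolding th_def
    proof (rule sum_mono)
      fix p assume p: "p \<in> P n"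
      then have "p \<le> n" by (simp add: P_def)
      then show "ln (real p) \<le> ln (real n)" using Pge[OF p] by simp
    qed
    then have "ps n - sqrt (real n) * (log 2 (real n) + 1) * ln (real n) \<le> real (card (P n)) * ln (real n)"
      using th_ge[OF elim] by simp
    then show ?case unfolding f_def cP diff_divide_distrib[symmetric] by (rule divide_right_mono) simp
  qed
  have upper: "\<forall>\<^sub>F n in sequentially. f n \<le> ps n / real n / a + ln (real n) * real n powr a / real n" if a: "0 < a" "a < 1" for a
    using eventually_ge_at_top[of 2]
  proof eventually_elim
    case (elim n)
    have L: "ln (real n) > 0" using elim by simp
    define Q where "Q = {p \<in> P n. real p \<le> real n powr a}"
    have "card Q \<le> card {1..nat \<lfloor>real n powr a\<rfloor>}"
      by (rule card_mono) (auto simp: Q_def P_def prime_ge_Suc_0_nat intro: le_nat_floor)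
    also have "\<dots> = nat \<lfloor>real n powr a\<rfloor>" by simp
    finally have "real (card Q) \<le> real n powr a" 
      using of_nat_floor[of "real n powr a"] by (simp add: order_trans[OF of_nat_mono])
    moreover have "card (P n - Q) = card (P n) - card Q" "card Q \<le> card (P n)"
      using finP by (auto intro!: card_Diff_subset card_mono simp: Q_def)
    ultimately have "real (card (P n)) - real n powr a \<le> real (card (P n - Q))" by linarith
    then have "(real (card (P n)) - real n powr a) * (a * ln (real n)) \<le> real (card (P n - Q)) * (a * ln (real n))"
      using L a by (intro mult_right_mono) auto
    also have "\<dots> = (\<Sum>p\<in>P n - Q. a * ln (real n))" by simp
    also have "\<dots> \<le> (\<Sum>p\<in>P n - Q. ln (real p))"
    proof (rule sum_mono)
      fix p assume p: "p \<in> P n - Q"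
      then have "real n powr a \<le> real p" by (auto simp: Q_def)
      then have "ln (real n powr a) \<le> ln (real p)" using elim by (intro ln_mono) auto
      then show "a * ln (real n) \<le> ln (real p)" using elim by (simp add: ln_powr)
    qed
    also have "\<dots> \<le> th n"
      unfolding th_def using finP Pge by (intro sum_mono2) (auto intro!: ln_ge_zero simp: numeral_2_eq_2 Suc_le_eq dest: Pge)
    also have "\<dots> \<le> ps n" by (rule th_le)
    finally have "real (card (P n)) * ln (real n) \<le> ps n / a + ln (real n) * real n powr a"
      using a by (simp add: field_simps)
    then have "real (card (P n)) * ln (real n) / real n \<le> (ps n / a + ln (real n) * real n powr a) / real n"
      by (rule divide_right_mono) simp
    then show ?case by (simp add: f_def cP add_divide_distrib divide_divide_eq_left mult.commute)
  qed
  have "f \<longlonglongrightarrow> lam"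
  proof (rule order_tendstoI)
    fix l assume l: "l < lam"
    have "(\<lambda>n. sqrt (real n) * (log 2 (real n) + 1) * ln (real n) / real n) \<longlonglongrightarrow> 0" by real_asymp
    from tendsto_diff[OF psi' this]
    have "(\<lambda>n. ps n / real n - sqrt (real n) * (log 2 (real n) + 1) * ln (real n) / real n) \<longlonglongrightarrow> lam" by simp
    from order_tendstoD(1)[OF this l] lower show "\<forall>\<^sub>F n in sequentially. l < f n"
      by eventually_elim linarith
  next
    fix u assume u: "lam < u"
    \<comment> \<open>Any a strictly between lam / u and 1 satisfies lam / a < u; the midpoint of q
      and 1 is taken.\<close>
    define q where "q = lam / u"
    define a where "a = (q + 1) / 2"
    have "q < 1" "0 < q" using u lam by (simp_all add: q_def)
    then have a: "0 < a" "a < 1" "q < a" by (simp_all add: a_def)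
    then have "lam < a * u" using lam u by (simp add: q_def pos_divide_less_eq)
    then have "lam / a < u" using a by (simp add: field_simps)
    moreover have "(\<lambda>n. ps n / real n / a + ln (real n) * real n powr a / real n) \<longlonglongrightarrow> lam / a + 0"
    proof (intro tendsto_add tendsto_divide psi' tendsto_const)
      show "(\<lambda>n. ln (real n) * real n powr a / real n) \<longlonglongrightarrow> 0" using a by real_asymp
    qed (use a in auto)
    ultimately have "\<forall>\<^sub>F n in sequentially. ps n / real n / a + ln (real n) * real n powr a / real n < u"
      by (intro order_tendstoD) auto
    with upper[OF a(1,2)] show "\<forall>\<^sub>F n in sequentially. f n < u"
      by eventually_elim linarith
  qed
  then show ?thesis by (simp add: f_def)
qed

section \<open>Primes in gaps\<close>

theorem prime_class_count_asymp:
  assumes W: "W > 0" and b: "coprime b W"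
  shows "(\<lambda>n. real (prime_class_count W b n) * ln (real n) / real n) \<longlonglongrightarrow> 1 / real (unit_count W)"
proof (rule prime_class_count_asymp_of_psi)
  let ?A = "\<lambda>k. \<Sum>j | j \<in> {1..k} \<and> [j = b] (mod W). mangoldt j :: real"
  show u: "1 / real (unit_count W) > 0" using unit_count_pos[OF W] by simp
  show "(\<lambda>n. ?A n / real n) \<longlonglongrightarrow> 1 / real (unit_count W)"
  proof (rule monotone_tauberian[OF _ u])
    show "mono ?A"
    proof (rule monoI)
      fix m n :: nat assume "m \<le> n"
      then show "?A m \<le> ?A n" by (intro sum_mono2) (auto simp: mangoldt_nonneg)
    qed
    show "convergent (\<lambda>N. \<Sum>k=1..<N. (?A k - 1 / real (unit_count W) * real k) * (1 / real k - 1 / real (Suc k)))"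
      using class_newman[OF W b] by simp
  qed
qed

lemma prime_class_count_mono: "m \<le> n \<Longrightarrow> prime_class_count W b m \<le> prime_class_count W b n"
  unfolding prime_class_count_def by (rule card_mono) (auto intro: finite_subset[of _ "{..n}"])

abbreviation prime_class_count_real :: "nat \<Rightarrow> nat \<Rightarrow> real \<Rightarrow> real" where
  "prime_class_count_real W b x \<equiv> real (prime_class_count W b (nat \<lfloor>x\<rfloor>))"

lemma prime_class_count_real_mono:
  "x \<le> y \<Longrightarrow> prime_class_count_real W b x \<le> prime_class_count_real W b y"
  by (intro of_nat_mono prime_class_count_mono nat_mono floor_mono)

lemma prime_class_count_real_asymp:
  assumes W: "W > 0" and b: "coprime b W"
  shows "((\<lambda>x. prime_class_count_real W b x * ln x / x) \<longlongrightarrow> 1 / real (unit_count W)) at_top"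
proof -
  let ?n = "\<lambda>x::real. nat \<lfloor>x\<rfloor>"
  have nat: "filterlim ?n sequentially at_top"
    by (rule filterlim_compose[OF filterlim_nat_sequentially filterlim_floor_sequentially])
  have 1: "((\<lambda>x. prime_class_count_real W b x * ln (real (?n x)) / real (?n x)) \<longlongrightarrow> 1 / real (unit_count W)) at_top"
    by (rule filterlim_compose[OF prime_class_count_asymp[OF W b] nat])
  have 2: "((\<lambda>x::real. (ln x / x) / (ln (of_int \<lfloor>x\<rfloor>) / of_int \<lfloor>x\<rfloor>)) \<longlongrightarrow> 1) at_top"
    by real_asymp
  have "((\<lambda>x. prime_class_count_real W b x * ln (real (?n x)) / real (?n x) * ((ln x / x) / (ln (of_int \<lfloor>x\<rfloor>) / of_int \<lfloor>x\<rfloor>)))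
     \<longlongrightarrow> 1 / real (unit_count W) * 1) at_top"
    by (rule tendsto_mult[OF 1 2])
  moreover have "\<forall>\<^sub>F x::real in at_top. prime_class_count_real W b x * ln (real (?n x)) / real (?n x) * ((ln x / x) / (ln (of_int \<lfloor>x\<rfloor>) / of_int \<lfloor>x\<rfloor>))
     = prime_class_count_real W b x * ln x / x"
    using eventually_ge_at_top[of 2]
  proof eventually_elim
    case (elim x)
    have i: "2 \<le> \<lfloor>x\<rfloor>" using elim by (simp add: le_floor_iff)
    then have n: "real (?n x) = of_int \<lfloor>x\<rfloor>" by simp
    have alg: "Q * L / X * ((l / y) / (L / X)) = Q * l / y" if "L > 0" "X > 0" for Q L X l y :: real
      using that by simp
    show ?case unfolding n by (rule alg) (use i in simp_all)
  qed
  ultimately show ?thesis by (simp add: Lim_transform_eventually)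
qed

text \<open>In the quotient of the two asymptotic formulas only ln (a x) / ln x is left over besides
  1 / a, and it tends to 1.\<close>

lemma prime_class_count_real_ratio:
  assumes W: "W > 0" and b: "coprime b W" and a: "a > 0"
  shows "((\<lambda>x. prime_class_count_real W b x / prime_class_count_real W b (a * x)) \<longlongrightarrow> 1 / a) at_top"
proof -
  let ?Q = "prime_class_count_real W b" and ?l = "1 / real (unit_count W)"
  have l: "?l \<noteq> 0" using unit_count_pos[OF W] by simp
  have ax: "filterlim (\<lambda>x. a * x) at_top at_top" using a by real_asymp
  note as = prime_class_count_real_asymp[OF W b]
  have 1: "((\<lambda>x. (?Q x * ln x / x) / (?Q (a * x) * ln (a * x) / (a * x))) \<longlongrightarrow> ?l / ?l) at_top"
    by (rule tendsto_divide[OF as filterlim_compose[OF as ax] l])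
  have "((\<lambda>x. ln (a * x) / ln x) \<longlongrightarrow> 1) at_top"
    using a by real_asymp
  then have 2: "((\<lambda>x. ln (a * x) / ln x / a) \<longlongrightarrow> 1 / a) at_top"
    by (rule tendsto_divide[OF _ tendsto_const]) (use a in simp)
  have "((\<lambda>x. (?Q x * ln x / x) / (?Q (a * x) * ln (a * x) / (a * x)) * (ln (a * x) / ln x / a)) \<longlongrightarrow> ?l / ?l * (1 / a)) at_top"
    by (rule tendsto_mult[OF 1 2])
  moreover have "\<forall>\<^sub>F x::real in at_top. (?Q x * ln x / x) / (?Q (a * x) * ln (a * x) / (a * x)) * (ln (a * x) / ln x / a) = ?Q x / ?Q (a * x)"
    using eventually_gt_at_top[of 1] filterlim_at_top_dense[THEN iffD1, OF ax, rule_format, of 1]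
  proof eventually_elim
    case (elim x)
    have "ln x > 0" "ln (a * x) > 0" "x > 0" using elim by auto
    moreover have "(Q * L / X) / (R * M / (a * X)) * (M / L / a) = Q / R" if "L > 0" "M > 0" "X > 0" for Q R L M X :: real
      using that a by (cases "R = 0") (simp_all add: field_simps)
    ultimately show ?case by blast
  qed
  ultimately show ?thesis using l by (simp add: Lim_transform_eventually)
qed

lemma prime_class_count_real_at_top:
  assumes W: "W > 0" and b: "coprime b W"
  shows "filterlim (prime_class_count_real W b) at_top at_top"
proof -
  have xl: "filterlim (\<lambda>x::real. x / ln x) at_top at_top" by real_asymp
  have "filterlim (\<lambda>x. prime_class_count_real W b x * ln x / x * (x / ln x)) at_top at_top"
    by (rule filterlim_tendsto_pos_mult_at_top[OF prime_class_count_real_asymp[OF W b] _ xl])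
       (use unit_count_pos[OF W] in simp)
  moreover have "\<forall>\<^sub>F x::real in at_top. prime_class_count_real W b x * ln x / x * (x / ln x) = prime_class_count_real W b x"
    using eventually_gt_at_top[of 1] by eventually_elim simp
  ultimately show ?thesis by (rule filterlim_mono_eventually[OF _ order_refl order_refl])
qed

section \<open>Density and sumset of the gap primes\<close>

lemma rapidly_increasing_props:
  assumes N: "rapidly_increasing N"
  shows "N k \<ge> 1" "strict_mono N" "filterlim N at_top sequentially"
    "filterlim (\<lambda>k. N (Suc k) / N k) at_top sequentially"
proof -
  show m: "strict_mono N" and r: "filterlim (\<lambda>k. N (Suc k) / N k) at_top sequentially"
    using N by (auto simp: rapidly_increasing_def)
  have ge: "N k \<ge> 1" for k
    using N strict_mono_less_eq[OF m, of 0 k] by (simp add: rapidly_increasing_def)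
  then show "N k \<ge> 1" .
  have "filterlim (\<lambda>k. N (Suc k)) at_top sequentially"
  proof (rule filterlim_at_top_mono[OF r always_eventually], intro allI)
    fix k show "N (Suc k) / N k \<le> N (Suc k)"
      using divide_left_mono[of 1 "N k" "N (Suc k)"] ge[of k] ge[of "Suc k"] by simp
  qed
  then show "filterlim N at_top sequentially" by (simp add: filterlim_sequentially_Suc)
qed

text \<open>Such a prime lies in an interval from \<alpha> N_j to N_(j+1), and N_(j+1) > N_k forces
  j >= k. Empty intervals, which can occur for small indices, cause no exception.\<close>

lemma gap_primes_gt_imp_ge:
  assumes m: "strict_mono N" and \<alpha>: "\<alpha> > 2" and ge: "\<And>k. N k \<ge> 1" and p: "p \<in> gap_primes \<alpha> N" "real p > N k"
  shows "\<alpha> * N k \<le> real p"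
proof -
  have "N 0 \<le> N k" using strict_mono_less_eq[OF m] by simp
  with p obtain j where j: "\<alpha> * N j \<le> real p" "real p \<le> N (Suc j)" by (auto simp: gap_primes_def)
  have "k \<le> j"
  proof (rule ccontr)
    assume "\<not> k \<le> j"
    then have "N (Suc j) \<le> N k" using strict_mono_less_eq[OF m] by simp
    then show False using j p by linarith
  qed
  then have "N k \<le> N j" using strict_mono_less_eq[OF m] by simp
  then have "\<alpha> * N k \<le> \<alpha> * N j" using \<alpha> by (intro mult_left_mono) auto
  then show ?thesis using j by linarith
qed

text \<open>The upper bound samples the quotient at floor (\<alpha> N_k). For the lower bound all of
  the set below \<alpha> N_k is discarded. As M runs from N_(k+1) to N_(k+2), the lower estimate
  left over first falls, while only the denominator grows, and then rises, so its least value is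
  \<rho> k, attained around \<alpha> N_(k+1).\<close>

lemma gap_primes_density:
  assumes \<alpha>: "\<alpha> > 2" and N: "rapidly_increasing N" and W: "W > 0" and b: "coprime b W"
  shows "rel_lower_density (gap_primes \<alpha> N) W b = ereal (1 / \<alpha>)"
proof -
  note N_ge = rapidly_increasing_props(1)[OF N] and N_mono = rapidly_increasing_props(2)[OF N]
    and N_top = rapidly_increasing_props(3)[OF N] and N_ratio = rapidly_increasing_props(4)[OF N]
  let ?Q = "prime_class_count_real W b"
  define num where "num = (\<lambda>M. card {n \<in> gap_primes \<alpha> N. 1 \<le> n \<and> n \<le> M \<and> [n = b] (mod W)})"
  define q where "q = (\<lambda>M. {p. prime p \<and> p \<le> M \<and> [p = b] (mod W)})"
  have finq: "finite (q M)" for M by (rule finite_subset[of _ "{..M}"]) (auto simp: q_def)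
  have Qq: "?Q x = real (card (q (nat \<lfloor>x\<rfloor>)))" for x by (simp add: prime_class_count_def q_def)
  have memq: "p \<in> q (nat \<lfloor>x\<rfloor>) \<longleftrightarrow> prime p \<and> real p \<le> x \<and> [p = b] (mod W)" if "x \<ge> 0" for p x
    using that by (auto simp: q_def le_nat_iff le_floor_iff)
  have den: "{n. prime n \<and> 1 \<le> n \<and> n \<le> M \<and> [n = b] (mod W)} = q M" for M
    by (auto simp: q_def prime_ge_Suc_0_nat)
  define f where "f = (\<lambda>M. real (num M) / real (card (q M)))"
  have dens: "rel_lower_density (gap_primes \<alpha> N) W b = liminf (\<lambda>M. ereal (f M))"
    unfolding rel_lower_density_def den f_def num_def ..
  have \<alpha>N_top: "filterlim (\<lambda>k. \<alpha> * N k) at_top sequentially"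
    by (rule filterlim_tendsto_pos_mult_at_top[OF tendsto_const _ N_top]) (use \<alpha> in simp)
  have lim1: "(\<lambda>k. ?Q (N k) / ?Q (\<alpha> * N k)) \<longlonglongrightarrow> 1 / \<alpha>"
    by (rule filterlim_compose[OF prime_class_count_real_ratio[OF W b] N_top]) (use \<alpha> in simp)
  have Q_top: "filterlim (\<lambda>k. ?Q (\<alpha> * N k)) at_top sequentially"
    by (rule filterlim_compose[OF prime_class_count_real_at_top[OF W b] \<alpha>N_top])
  have lim2: "(\<lambda>k. ?Q (\<alpha> * N k) / ?Q (\<alpha> * N (Suc k))) \<longlonglongrightarrow> 0"
  proof (rule LIMSEQ_I)
    fix r :: real assume r: "r > 0"
    \<comment> \<open>Eventually N_(k+1) >= K N_k, so the quotient is at most one that tends to 1 /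
      K = r / 2.\<close>
    define K where "K = 2 / r"
    have K: "K > 0" "1 / K < r" using r by (simp_all add: K_def)
    have "(\<lambda>k. ?Q (\<alpha> * N k) / ?Q (K * (\<alpha> * N k))) \<longlonglongrightarrow> 1 / K"
      by (rule filterlim_compose[OF prime_class_count_real_ratio[OF W b K(1)] \<alpha>N_top])
    then have "\<forall>\<^sub>F k in sequentially. ?Q (\<alpha> * N k) / ?Q (K * (\<alpha> * N k)) < r"
      using K(2) by (rule order_tendstoD)
    moreover have "\<forall>\<^sub>F k in sequentially. N (Suc k) / N k \<ge> K"
      using N_ratio by (simp add: filterlim_at_top)
    moreover have "filterlim (\<lambda>k. ?Q (K * (\<alpha> * N k))) at_top sequentially"
      by (rule filterlim_compose[OF prime_class_count_real_at_top[OF W b]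
           filterlim_tendsto_pos_mult_at_top[OF tendsto_const K(1) \<alpha>N_top]])
    then have "\<forall>\<^sub>F k in sequentially. ?Q (K * (\<alpha> * N k)) > 0" unfolding filterlim_at_top_dense by (rule spec)
    ultimately have "\<forall>\<^sub>F k in sequentially. norm (?Q (\<alpha> * N k) / ?Q (\<alpha> * N (Suc k)) - 0) < r"
    proof eventually_elim
      case (elim k)
      have "K * N k \<le> N (Suc k)" using elim(2) N_ge[of k] by (simp add: pos_le_divide_eq)
      then have "\<alpha> * (K * N k) \<le> \<alpha> * N (Suc k)" using \<alpha> by (intro mult_left_mono) auto
      then have "?Q (K * (\<alpha> * N k)) \<le> ?Q (\<alpha> * N (Suc k))"
        by (intro prime_class_count_real_mono) (simp add: mult_ac)
      then have "?Q (\<alpha> * N k) / ?Q (\<alpha> * N (Suc k)) \<le> ?Q (\<alpha> * N k) / ?Q (K * (\<alpha> * N k))"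
        using elim(3) by (intro divide_left_mono mult_pos_pos) auto
      then show ?case using elim(1) by simp
    qed
    then show "\<exists>no. \<forall>k\<ge>no. norm (?Q (\<alpha> * N k) / ?Q (\<alpha> * N (Suc k)) - 0) < r"
      by (simp add: eventually_sequentially)
  qed
  define \<rho> where "\<rho> = (\<lambda>k. (?Q (N (Suc k)) - ?Q (\<alpha> * N k)) / ?Q (\<alpha> * N (Suc k)))"
  have "(\<lambda>k. ?Q (N (Suc k)) / ?Q (\<alpha> * N (Suc k)) - ?Q (\<alpha> * N k) / ?Q (\<alpha> * N (Suc k))) \<longlonglongrightarrow> 1 / \<alpha> - 0"
    by (rule tendsto_diff[OF LIMSEQ_Suc[OF lim1] lim2])
  then have \<rho>: "\<rho> \<longlonglongrightarrow> 1 / \<alpha>" by (simp add: \<rho>_def[abs_def] diff_divide_distrib)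
  have lower: "\<rho> k \<le> f M" if M: "N (Suc k) \<le> real M" "real M < N (Suc (Suc k))" and Qpos: "?Q (\<alpha> * N (Suc k)) > 0" for k M
  proof -
    have pos: "0 \<le> \<alpha> * N j" "0 \<le> N j" for j using N_ge[of j] \<alpha> by auto
    have NN: "N (Suc k) \<le> \<alpha> * N (Suc k)" using mult_right_mono[of 1 \<alpha> "N (Suc k)"] \<alpha> pos[of "Suc k"] by simp
    define S1 where "S1 = q (nat \<lfloor>N (Suc k)\<rfloor>) - q (nat \<lfloor>\<alpha> * N k\<rfloor>)"
    define S2 where "S2 = q M - q (nat \<lfloor>\<alpha> * N (Suc k)\<rfloor>)"
    have fin: "finite S1" "finite S2" using finq by (auto simp: S1_def S2_def)
    have c1: "real (card S1) \<ge> ?Q (N (Suc k)) - ?Q (\<alpha> * N k)"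
      using diff_card_le_card_Diff[OF finq[of "nat \<lfloor>\<alpha> * N k\<rfloor>"], of "q (nat \<lfloor>N (Suc k)\<rfloor>)"] unfolding S1_def Qq by linarith
    have c2: "real (card S2) \<ge> real (card (q M)) - ?Q (\<alpha> * N (Suc k))"
      using diff_card_le_card_Diff[OF finq[of "nat \<lfloor>\<alpha> * N (Suc k)\<rfloor>"], of "q M"] unfolding S2_def Qq by linarith
    have S1: "p \<in> S1 \<Longrightarrow> prime p \<and> [p = b] (mod W) \<and> \<alpha> * N k < real p \<and> real p \<le> N (Suc k)" for p
      unfolding S1_def by (auto simp: memq[OF pos(1)] memq[OF pos(2)])
    have S2: "p \<in> S2 \<Longrightarrow> prime p \<and> [p = b] (mod W) \<and> \<alpha> * N (Suc k) < real p \<and> p \<le> M" for p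
      unfolding S2_def by (auto simp: memq[OF pos(1)]) (auto simp: q_def)
    have "S1 \<inter> S2 = {}" using S1 S2 NN by fastforce
    then have card12: "card (S1 \<union> S2) = card S1 + card S2" using fin by (rule card_Un_disjoint[rotated 2])
    have "S1 \<union> S2 \<subseteq> {n \<in> gap_primes \<alpha> N. 1 \<le> n \<and> n \<le> M \<and> [n = b] (mod W)}"
    proof
      fix p assume "p \<in> S1 \<union> S2"
      then show "p \<in> {n \<in> gap_primes \<alpha> N. 1 \<le> n \<and> n \<le> M \<and> [n = b] (mod W)}"
      proof
        assume "p \<in> S1"
        from S1[OF this] have p: "prime p" "[p = b] (mod W)" "\<alpha> * N k < real p" "real p \<le> N (Suc k)" by auto
        then have "p \<in> gap_primes \<alpha> N" unfolding gap_primes_def by (auto intro!: exI[of _ k])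
        moreover have "p \<le> M" using p M by linarith
        ultimately show ?thesis using p by (simp add: prime_ge_Suc_0_nat)
      next
        assume "p \<in> S2"
        from S2[OF this] have p: "prime p" "[p = b] (mod W)" "\<alpha> * N (Suc k) < real p" "p \<le> M" by auto
        moreover have "real p \<le> N (Suc (Suc k))" using p M by linarith
        ultimately have "p \<in> gap_primes \<alpha> N" unfolding gap_primes_def by (auto intro!: exI[of _ "Suc k"])
        then show ?thesis using p by (simp add: prime_ge_Suc_0_nat)
      qed
    qed
    then have "card (S1 \<union> S2) \<le> num M" unfolding num_def by (intro card_mono) auto
    then have numge: "real (num M) \<ge> real (card S1) + real (card S2)" using card12 by linarith
    show ?thesis
    proof (cases "real M \<le> \<alpha> * N (Suc k)")
      case True
      have sub: "q M \<subseteq> q (nat \<lfloor>\<alpha> * N (Suc k)\<rfloor>)" using True memq[OF pos(1)] by (auto simp: q_def)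
      have dle: "real (card (q M)) \<le> ?Q (\<alpha> * N (Suc k))"
        unfolding Qq using card_mono[OF finq sub] by simp
      show ?thesis
      \<comment> \<open>If the class has no prime up to M, then f M is 0 by the convention for
        division; in that case none lies below N_(k+1) either, and \<rho> k <= 0.\<close>
      proof (cases "card (q M) = 0")
        case True
        then have "q M = {}" using finq by simp
        moreover have "q (nat \<lfloor>N (Suc k)\<rfloor>) \<subseteq> q M" using M memq[OF pos(2)] by (auto simp: q_def)
        ultimately have "?Q (N (Suc k)) = 0" by (simp add: Qq)
        then have "\<rho> k \<le> 0" unfolding \<rho>_def using Qpos by (simp add: divide_le_0_iff)
        then show ?thesis using True by (simp add: f_def)
      next
        case False
        have "\<rho> k \<le> real (card S1) / ?Q (\<alpha> * N (Suc k))"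
          unfolding \<rho>_def using c1 by (intro divide_right_mono) auto
        also have "\<dots> \<le> real (num M) / real (card (q M))"
          using numge dle False by (intro frac_le) auto
        finally show ?thesis by (simp add: f_def)
      qed
    next
      case False
      have sub: "q (nat \<lfloor>\<alpha> * N (Suc k)\<rfloor>) \<subseteq> q M" using False memq[OF pos(1)] by (auto simp: q_def)
      have dge: "?Q (\<alpha> * N (Suc k)) \<le> real (card (q M))"
        unfolding Qq using card_mono[OF finq sub] by simp
      \<comment> \<open>Beyond \<alpha> N_(k+1) at most D primes of the class up to M are outside
        the set, and D no longer depends on M; so 1 - D / |q M| only improves as M grows.\<close>
      define D where "D = ?Q (\<alpha> * N (Suc k)) - ?Q (N (Suc k)) + ?Q (\<alpha> * N k)"
      have D: "D \<ge> 0" using prime_class_count_real_mono[OF NN, of W b] by (simp add: D_def)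
      have "\<rho> k = 1 - D / ?Q (\<alpha> * N (Suc k))" unfolding \<rho>_def D_def using Qpos by (simp add: field_simps)
      also have "\<dots> \<le> 1 - D / real (card (q M))"
        using D dge Qpos by (intro diff_left_mono divide_left_mono mult_pos_pos) auto
      also have "\<dots> = (real (card (q M)) - D) / real (card (q M))" using dge Qpos by (simp add: diff_divide_distrib)
      also have "\<dots> \<le> f M" unfolding f_def using numge c1 c2 by (intro divide_right_mono) (auto simp: D_def)
      finally show ?thesis .
    qed
  qed
  have ge: "ereal (1 / \<alpha>) \<le> liminf (\<lambda>M. ereal (f M))"
    unfolding le_Liminf_iff
  proof (intro allI impI)
    fix y assume y: "y < ereal (1 / \<alpha>)"
    obtain r where r: "y < ereal r" "r < 1 / \<alpha>" using ereal_dense2[OF y] by auto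
    have "\<forall>\<^sub>F k in sequentially. \<rho> k > r \<and> ?Q (\<alpha> * N (Suc k)) > 0"
      using order_tendstoD(1)[OF \<rho> r(2)] Q_top[THEN filterlim_sequentially_Suc[THEN iffD2], unfolded filterlim_at_top_dense, rule_format, of 0]
      by eventually_elim simp
    then obtain k0 where k0: "\<And>k. k \<ge> k0 \<Longrightarrow> \<rho> k > r \<and> ?Q (\<alpha> * N (Suc k)) > 0"
      by (auto simp: eventually_sequentially)
    have "y < ereal (f M)" if M: "M \<ge> nat \<lceil>N (Suc k0)\<rceil>" for M
    proof -
      have MN: "real M \<ge> N (Suc k0)" using M by linarith
      have ex: "\<exists>j. real M < N j"
        using filterlim_at_top_dense[THEN iffD1, OF N_top, rule_format, of "real M"] by (auto simp: eventually_sequentially)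
      define j where "j = (LEAST j. real M < N j)"
      have j: "real M < N j" unfolding j_def by (rule LeastI_ex[OF ex])
      have "Suc k0 < j"
      proof (rule ccontr)
        assume "\<not> Suc k0 < j"
        then have "N j \<le> N (Suc k0)" using strict_mono_less_eq[OF N_mono] by simp
        then show False using j MN by linarith
      qed
      then obtain k where k: "j = Suc (Suc k)" "k \<ge> k0"
        by (metis Suc_leD Suc_le_eq Suc_le_D Suc_le_mono less_Suc_eq_le)
      have "\<not> real M < N (Suc k)"
        using not_less_Least[of "Suc k" "\<lambda>j. real M < N j"] k(1) by (simp add: j_def)
      then have "\<rho> k \<le> f M" using j k k0[OF k(2)] by (intro lower) auto
      then show ?thesis using k0[OF k(2)] r(1) by (auto intro: less_trans)
    qed
    then show "\<forall>\<^sub>F M in sequentially. y < ereal (f M)"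
      unfolding eventually_sequentially by (intro exI[of _ "nat \<lceil>N (Suc k0)\<rceil>"] allI impI)
  qed
  have le: "liminf (\<lambda>M. ereal (f M)) \<le> ereal (1 / \<alpha>)"
  proof (rule ccontr)
    assume "\<not> liminf (\<lambda>M. ereal (f M)) \<le> ereal (1 / \<alpha>)"
    then have "ereal (1 / \<alpha>) < liminf (\<lambda>M. ereal (f M))" by simp
    then obtain r where r: "1 / \<alpha> < r" "ereal r < liminf (\<lambda>M. ereal (f M))" using ereal_dense2 by force
    have ev: "\<forall>\<^sub>F M in sequentially. ereal r < ereal (f M)" using less_LiminfD[OF r(2)] .
    have sub: "filterlim (\<lambda>k. nat \<lfloor>\<alpha> * N k\<rfloor>) sequentially sequentially"
      by (rule filterlim_compose[OF filterlim_compose[OF filterlim_nat_sequentially filterlim_floor_sequentially] \<alpha>N_top])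
    have ev': "\<forall>\<^sub>F k in sequentially. ereal r < ereal (f (nat \<lfloor>\<alpha> * N k\<rfloor>))"
      by (rule eventually_compose_filterlim[OF ev sub])
    have "(\<lambda>k. 1 / ?Q (\<alpha> * N k)) \<longlonglongrightarrow> 0"
      by (rule tendsto_divide_0[OF tendsto_const]) (use Q_top in \<open>auto intro: filterlim_at_top_imp_at_infinity\<close>)
    from tendsto_add[OF lim1 this] have "(\<lambda>k. (?Q (N k) + 1) / ?Q (\<alpha> * N k)) \<longlonglongrightarrow> 1 / \<alpha>"
      by (simp add: add_divide_distrib)
    from order_tendstoD(2)[OF this r(1)] have "\<forall>\<^sub>F k in sequentially. (?Q (N k) + 1) / ?Q (\<alpha> * N k) < r" .
    with ev' have "\<forall>\<^sub>F k in sequentially. False"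
    proof eventually_elim
      case (elim k)
      have pos: "0 \<le> \<alpha> * N k" "0 \<le> N k" using N_ge[of k] \<alpha> by auto
      \<comment> \<open>The inserted element accounts for \<alpha> N_k itself, which belongs to the
        closed interval and may be prime.\<close>
      have "{n \<in> gap_primes \<alpha> N. 1 \<le> n \<and> n \<le> nat \<lfloor>\<alpha> * N k\<rfloor> \<and> [n = b] (mod W)} \<subseteq> insert (nat \<lfloor>\<alpha> * N k\<rfloor>) (q (nat \<lfloor>N k\<rfloor>))"
      proof
        fix p assume "p \<in> {n \<in> gap_primes \<alpha> N. 1 \<le> n \<and> n \<le> nat \<lfloor>\<alpha> * N k\<rfloor> \<and> [n = b] (mod W)}"
        then have p: "p \<in> gap_primes \<alpha> N" "p \<le> nat \<lfloor>\<alpha> * N k\<rfloor>" "[p = b] (mod W)" by auto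
        have "prime p" using p(1) by (simp add: gap_primes_def)
        show "p \<in> insert (nat \<lfloor>\<alpha> * N k\<rfloor>) (q (nat \<lfloor>N k\<rfloor>))"
        proof (cases "real p \<le> N k")
          case True
          then show ?thesis using memq[OF pos(2)] p \<open>prime p\<close> by simp
        next
          case False
          then have "\<alpha> * N k \<le> real p" using gap_primes_gt_imp_ge[OF N_mono \<alpha> N_ge p(1)] by simp
          then have "nat \<lfloor>\<alpha> * N k\<rfloor> \<le> p" by linarith
          then show ?thesis using p by simp
        qed
      qed
      then have "num (nat \<lfloor>\<alpha> * N k\<rfloor>) \<le> card (insert (nat \<lfloor>\<alpha> * N k\<rfloor>) (q (nat \<lfloor>N k\<rfloor>)))"
        unfolding num_def using finq by (intro card_mono) auto
      also have "\<dots> \<le> Suc (card (q (nat \<lfloor>N k\<rfloor>)))" by (rule card_insert_le_m1) auto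
      finally have "real (num (nat \<lfloor>\<alpha> * N k\<rfloor>)) \<le> ?Q (N k) + 1" unfolding Qq by linarith
      then have "f (nat \<lfloor>\<alpha> * N k\<rfloor>) \<le> (?Q (N k) + 1) / ?Q (\<alpha> * N k)"
        unfolding f_def Qq by (rule divide_right_mono) simp
      then show False using elim by simp
    qed
    then show False by simp
  qed
  show ?thesis unfolding dens using ge le by (rule antisym[rotated])
qed

lemma card_even_le: "card {n::nat. 1 \<le> n \<and> n \<le> X \<and> even n} = X div 2"
proof -
  have "{n. 1 \<le> n \<and> n \<le> X \<and> even n} = (\<lambda>m. 2 * m) ` {1..X div 2}"
    by (auto elim!: evenE simp: image_iff)
  then show ?thesis by (simp add: card_image inj_on_def)
qed

text \<open>Up to \<alpha> N_k there are about \<alpha> N_k / 2 even numbers, and at most N_k of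
  them are not above 2 N_k. The others are all missed, a proportion tending to 1 - 2/\<alpha>, of
  which half is claimed for the limsup.\<close>

lemma gap_primes_misses:
  assumes \<alpha>: "\<alpha> > 2" and N: "rapidly_increasing N"
  shows "misses_positive_proportion_even (gap_primes \<alpha> N + gap_primes \<alpha> N)"
proof -
  note N_ge = rapidly_increasing_props(1)[OF N] and N_mono = rapidly_increasing_props(2)[OF N]
    and N_top = rapidly_increasing_props(3)[OF N]
  let ?A = "gap_primes \<alpha> N"
  define X where "X = (\<lambda>k. nat \<lfloor>\<alpha> * N k\<rfloor>)"
  have notin: "n \<notin> ?A + ?A" if n: "2 * N k < real n" "real n \<le> \<alpha> * N k" for n k
  proof
    assume "n \<in> ?A + ?A"
    then obtain p p' where p: "p \<in> ?A" "p' \<in> ?A" "n = p + p'" by (auto simp: set_plus_def)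
    have pp: "p \<ge> 1" "p' \<ge> 1" using p by (auto simp: gap_primes_def prime_ge_Suc_0_nat)
    have "real p > N k \<or> real p' > N k" using n p(3) by auto
    then have "\<alpha> * N k \<le> real p \<or> \<alpha> * N k \<le> real p'"
      using gap_primes_gt_imp_ge[OF N_mono \<alpha> N_ge] p by blast
    \<comment> \<open>The other prime is at least 1, so the right endpoint \<alpha> N_k of the range
      is excluded as well.\<close>
    then show False using n p(3) pp by auto
  qed
  have miss: "missed_even_proportion (?A + ?A) (X k) \<ge> 1 - N k / (\<alpha> * N k / 2 - 1)" if big: "\<alpha> * N k > 4" for k
  proof -
    have pos: "0 \<le> \<alpha> * N k" "0 \<le> N k" using N_ge[of k] \<alpha> by auto
    have X1: "real (X k) \<le> \<alpha> * N k" using pos by (simp add: X_def)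
    have "real (X k) > \<alpha> * N k - 1" unfolding X_def by linarith
    moreover have "real (X k) \<le> 2 * real (X k div 2) + 1" by linarith
    ultimately have X2: "\<alpha> * N k / 2 - 1 \<le> real (X k div 2)" by linarith
    define m where "m = nat \<lfloor>N k\<rfloor>"
    have m: "real m \<le> N k" using pos by (simp add: m_def)
    have "(\<lambda>j. 2 * j) ` {m<..X k div 2} \<subseteq> {n. 1 \<le> n \<and> n \<le> X k \<and> even n \<and> n \<notin> ?A + ?A}"
    proof
      fix n assume "n \<in> (\<lambda>j. 2 * j) ` {m<..X k div 2}"
      then obtain j where j: "n = 2 * j" "m < j" "j \<le> X k div 2" by auto
      have "N k < real j" using j(2) unfolding m_def by linarith
      moreover have "n \<le> X k" using j by linarith
      ultimately have n: "2 * N k < real n" "real n \<le> \<alpha> * N k" using X1 j(1) by simp_all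
      have "1 \<le> n" "even n" using j by simp_all
      with notin[OF n] \<open>n \<le> X k\<close> show "n \<in> {n. 1 \<le> n \<and> n \<le> X k \<and> even n \<and> n \<notin> ?A + ?A}"
        by (intro CollectI conjI)
    qed
    then have "card ((\<lambda>j. 2 * j) ` {m<..X k div 2}) \<le> card {n. 1 \<le> n \<and> n \<le> X k \<and> even n \<and> n \<notin> ?A + ?A}"
      by (rule card_mono[rotated]) (rule finite_subset[of _ "{..X k}"], auto)
    then have "X k div 2 - m \<le> card {n. 1 \<le> n \<and> n \<le> X k \<and> even n \<and> n \<notin> ?A + ?A}"
      by (simp add: card_image inj_on_def)
    then have c: "real (X k div 2) - N k \<le> real (card {n. 1 \<le> n \<and> n \<le> X k \<and> even n \<and> n \<notin> ?A + ?A})"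
      using m by linarith
    have d: "0 < \<alpha> * N k / 2 - 1" using big by simp
    have "N k / real (X k div 2) \<le> N k / (\<alpha> * N k / 2 - 1)"
      using X2 d pos by (intro divide_left_mono mult_pos_pos) auto
    then have "1 - N k / (\<alpha> * N k / 2 - 1) \<le> (real (X k div 2) - N k) / real (X k div 2)"
      using X2 d by (simp add: diff_divide_distrib)
    also have "\<dots> \<le> missed_even_proportion (?A + ?A) (X k)"
      unfolding missed_even_proportion_def card_even_le using c by (rule divide_right_mono) simp
    finally show ?thesis .
  qed
  define e where "e = 1 - 2 / \<alpha>"
  define c where "c = e / 2"
  have "e > 0" using \<alpha> by (simp add: e_def)
  then have c: "c > 0" "c < e" by (simp_all add: c_def)
  have "((\<lambda>x. 1 - x / (\<alpha> * x / 2 - 1)) \<longlongrightarrow> 1 - 2 / \<alpha>) at_top"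
    using \<alpha> by real_asymp
  from order_tendstoD(1)[OF filterlim_compose[OF this N_top] c(2)[unfolded e_def]]
  have ev1: "\<forall>\<^sub>F k in sequentially. c < 1 - N k / (\<alpha> * N k / 2 - 1)" .
  have \<alpha>N_top: "filterlim (\<lambda>k. \<alpha> * N k) at_top sequentially"
    by (rule filterlim_tendsto_pos_mult_at_top[OF tendsto_const _ N_top]) (use \<alpha> in simp)
  then have ev2: "\<forall>\<^sub>F k in sequentially. \<alpha> * N k > 4" by (simp add: filterlim_at_top_dense)
  have sub: "filterlim X sequentially sequentially"
    unfolding X_def by (rule filterlim_compose[OF filterlim_compose[OF filterlim_nat_sequentially filterlim_floor_sequentially] \<alpha>N_top])
  have "ereal c \<le> limsup (\<lambda>X. ereal (missed_even_proportion (?A + ?A) X))"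
  proof (rule ccontr)
    assume "\<not> ereal c \<le> limsup (\<lambda>X. ereal (missed_even_proportion (?A + ?A) X))"
    then have "limsup (\<lambda>X. ereal (missed_even_proportion (?A + ?A) X)) < ereal c" by simp
    from Limsup_lessD[OF this] have ev: "\<forall>\<^sub>F x in sequentially. ereal (missed_even_proportion (?A + ?A) x) < ereal c" .
    have "\<forall>\<^sub>F k in sequentially. ereal (missed_even_proportion (?A + ?A) (X k)) < ereal c"
      by (rule eventually_compose_filterlim[OF ev sub])
    with ev1 ev2 have "\<forall>\<^sub>F k in sequentially. False"
    proof eventually_elim
      case (elim k)
      then show False using miss[of k] by simp
    qed
    then show False by simp
  qed
  then show ?thesis unfolding misses_positive_proportion_even_def using c(1)
    by (metis ereal_less(2) less_le_trans)
qed

text \<open>An explicit sequence for the sharpness claim. The shift avoids 0! = 1!, which would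
  violate strict monotonicity.\<close>

lemma rapidly_increasing_fact: "rapidly_increasing (\<lambda>k. fact (Suc k))"
  unfolding rapidly_increasing_def
proof (intro conjI)
  show "strict_mono (\<lambda>k. fact (Suc k) :: real)"
    by (rule strict_monoI_Suc) (intro fact_less_mono; simp)
  have "(fact (Suc (Suc k)) :: real) / fact (Suc k) = real k + 2" for k by simp
  moreover have "filterlim (\<lambda>k. real k + 2) at_top sequentially" by real_asymp
  ultimately show "filterlim (\<lambda>k. (fact (Suc (Suc k)) :: real) / fact (Suc k)) at_top sequentially" by (simp only:)
qed simp

theorem mainTheorem3:
  "(\<forall>c :: real. c < 1/2 \<longrightarrow> \<not> density_Goldbach_statement c) \<and>
   (\<forall>(\<alpha> :: real) (N :: nat \<Rightarrow> real). \<alpha> > 2 \<longrightarrow> rapidly_increasing N \<longrightarrow>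
      (\<forall>W b :: nat. W > 0 \<longrightarrow> coprime b W \<longrightarrow>
         rel_lower_density (gap_primes \<alpha> N) W b = ereal (1 / \<alpha>)) \<and>
      misses_positive_proportion_even (gap_primes \<alpha> N + gap_primes \<alpha> N))"
proof (intro conjI allI impI)
  fix c :: real assume c: "c < 1/2"
  \<comment> \<open>A density strictly between c and 1/2; the maximum keeps it positive when c is
    negative, so that \<alpha> = 1 / d exceeds 2.\<close>
  define d where "d = (max c 0 + 1 / 2) / 2"
  have d: "0 < d" "d < 1 / 2" "c < d" using c by (auto simp: d_def)
  define \<alpha> where "\<alpha> = 1 / d"
  have \<alpha>: "\<alpha> > 2" "c < 1 / \<alpha>" using d by (auto simp: \<alpha>_def field_simps)
  let ?A = "gap_primes \<alpha> (\<lambda>k. fact (Suc k))"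
  show "\<not> density_Goldbach_statement c"
  proof
    assume "density_Goldbach_statement c"
    moreover have "?A \<subseteq> {p. prime p}" by (auto simp: gap_primes_def)
    moreover have "ereal c < (INF (W, b) \<in> reduced_classes. rel_lower_density ?A W b)"
    proof (rule less_le_trans)
      show "ereal c < ereal (1 / \<alpha>)" using \<alpha> by simp
      show "ereal (1 / \<alpha>) \<le> (INF (W, b) \<in> reduced_classes. rel_lower_density ?A W b)"
        using gap_primes_density[OF \<alpha>(1) rapidly_increasing_fact]
        by (intro INF_greatest) (auto simp: reduced_classes_def simp del: fact_Suc)
    qed
    ultimately have "missed_even_proportion (?A + ?A) \<longlonglongrightarrow> 0"
      unfolding density_Goldbach_statement_def contains_almost_all_even_def by blast
    then have "(\<lambda>X. ereal (missed_even_proportion (?A + ?A) X)) \<longlonglongrightarrow> ereal 0" by (rule tendsto_ereal)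
    then have "limsup (\<lambda>X. ereal (missed_even_proportion (?A + ?A) X)) = 0"
      by (simp add: lim_imp_Limsup zero_ereal_def)
    then show False
      using gap_primes_misses[OF \<alpha>(1) rapidly_increasing_fact] by (simp add: misses_positive_proportion_even_def)
  qed
qed (auto intro: gap_primes_density gap_primes_misses)

end
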